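(* Fix $s>0$ and an integer $K\ge1$. Let $G\subset\mathit{Conf}$ be a dense $G_\delta$ set and $\mathcal H\subset\mathbb S^1$ a dense $G_\delta$ set of full Lebesgue measure such that for every $g\in G$ and $\theta\in\mathcal H$ the billiard flow $\phi_t^{g,\theta}$ has infinite ergodic index. Then for each $g\in G$, each measurable $A\subset\mathcal B^g$ of positive finite area, each $\theta\in\mathcal H$, and all $i,j\in[\theta]=\{\pm\theta,\pm(\pi-\theta)\}$, for $\mu^K$-almost every initial condition $(\vec z,\vec\theta)$ with $\vec z\in(\mathcal B^g)^K$ and $\vec\theta\in[\theta]^K$, $$\frac{\int_0^T f_i^A\big((\phi_t^{g,\theta}\times\cdots\times\phi_t^{g,\theta})(\vec z,\vec\theta)\big)\,dt}{\int_0^T f_j^A\big((\phi_t^{g,\theta}\times\cdots\times\phi_t^{g,\theta})(\vec z,\vec\theta)\big)\,dt}\longrightarrow 1\qquad\text{as }T\to\infty,$$ where the product flow has $K$ factors.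
   Context: Configurations. Let $d$ be the $L^1$ distance on $\mathbb R^2$. A rhombus is a square with sides parallel to the lines $y=\pm x$. Fix $s>0$. A configuration is an at most countable (possibly finite or empty) subset $g\subset\mathbb R^2$ such that $d(z_1,z_2)\ge s$ for all distinct $z_1,z_2\in g$; it encodes the collection of rhombi ("trees") $\{w: d(w,z)\le s/2\}$, $z\in g$. $\mathit{Conf}$ is the set of all configurations. Its topology is given by the metric $d_H$: via inverse stereographic projection (polar coordinates $(r,\theta)$ go to the point of the unit sphere with spherical coordinates $(2\arctan(1/r),\theta)$, first coordinate measured from the north pole $\infty$), let $\hat g$ be the image of $g$ together with $\infty$; $d_H(g_1,g_2)$ is the Hausdorff distance between $\hat g_1$ and $\hat g_2$ with respect to the geodesic distance on the sphere. Billiard flow. The wind-tree table $\mathcal B^g$ is $\mathbb R^2$ minus the interiors of the trees of $g$. For $\theta\in\mathbb S^1$, the billiard flow $\phi_t^{g,\theta}$ in direction $\theta$ is unit speed free motion in the interior of $\mathcal B^g$ with elastic reflection at the boundary of the trees; orbits hitting a corner stop and are not defined afterwards. Measuring angles from a side direction of the trees, only the directions $[\theta]=\{\pm\theta,\pm(\pi-\theta)\}$ occur, so the phase space is a subset of $\mathcal B^g\times[\theta]$. The flow preserves the (infinite) measure $\mu$ which is area on $\mathcal B^g$ times counting (up to a constant) measure on $[\theta]$; $\mu^K=\mu\times\cdots\times\mu$. Ergodicity. A flow $\psi_t$ preserving a Borel measure $m$ (possibly infinite) is ergodic if every Borel set $B$ with $m(\psi_t(B)\triangle B)=0$ for all $t\in\mathbb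 R$ satisfies $m(B)=0$ or $m(B^c)=0$. It has infinite ergodic index if for every integer $L\ge1$ the $L$-fold product $\psi_t\times\cdots\times\psi_t$ is ergodic with respect to $m\times\cdots\times m$. Counting functions. For $\vec z=(z_1,\dots,z_K)\in(\mathcal B^g)^K$, $\vec\theta=(\vec\theta_1,\dots,\vec\theta_K)\in[\theta]^K$ and $i\in[\theta]$, $f_i(\vec z,\vec\theta)=\#\{k:\vec\theta_k=i\}$ is the number of particles pointing in direction $i$. For $A\subset\mathcal B^g$, $f_i^A$ is $f_i$ restricted to $A\times\cdots\times A$: $f_i^A(\vec z,\vec\theta)=f_i(\vec z,\vec\theta)$ if $z_k\in A$ for all $k$, and $f_i^A(\vec z,\vec\theta)=0$ otherwise. *)

theory Defs
  imports "HOL-Analysis.Analysis"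
begin

text \<open>The plane is modelled by \<^typ>\<open>complex\<close>, and the circle of directions by the unit
  circle of \<^typ>\<open>complex\<close>, the angle \<open>\<theta>\<close> being represented by \<open>cis \<theta>\<close>.\<close>

definition dist_L1 :: "complex \<Rightarrow> complex \<Rightarrow> real" where
  "dist_L1 z w = \<bar>Re z - Re w\<bar> + \<bar>Im z - Im w\<bar>"

definition Conf :: "real \<Rightarrow> complex set set" where
  "Conf s = {g. countable g \<and> (\<forall>z\<in>g. \<forall>w\<in>g. z \<noteq> w \<longrightarrow> dist_L1 z w \<ge> s)}"

text \<open>The angle \<open>2 * arctan (1 / r)\<close> from the north pole is written \<open>pi - 2 * arctan r\<close>,
  which agrees with it for \<open>r > 0\<close> and is \<open>pi\<close> (the south pole) for \<open>r = 0\<close>, where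
  \<open>1 / 0 = 0\<close> in HOL would give the north pole.\<close>

definition inv_stereographic :: "complex \<Rightarrow> complex \<times> real" where
  "inv_stereographic z =
     (let \<alpha> = pi - 2 * arctan (cmod z) in (of_real (sin \<alpha>) * sgn z, cos \<alpha>))"

definition north_pole :: "complex \<times> real" where
  "north_pole = (0, 1)"

definition geodesic_dist :: "complex \<times> real \<Rightarrow> complex \<times> real \<Rightarrow> real" where
  "geodesic_dist x y = arccos (x \<bullet> y)"

definition hausdorff_dist :: "('a \<Rightarrow> 'a \<Rightarrow> real) \<Rightarrow> 'a set \<Rightarrow> 'a set \<Rightarrow> real" where
  "hausdorff_dist d A B = max (SUP x\<in>A. INF y\<in>B. d x y) (SUP y\<in>B. INF x\<in>A. d x y)"

definition conf_dist :: "complex set \<Rightarrow> complex set \<Rightarrow> real" where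
  "conf_dist g h = hausdorff_dist geodesic_dist
     (insert north_pole (inv_stereographic ` g)) (insert north_pole (inv_stereographic ` h))"

definition Conf_topology :: "real \<Rightarrow> complex set topology" where
  "Conf_topology s = Metric_space.mtopology (Conf s) conf_dist"

definition tree :: "real \<Rightarrow> complex \<Rightarrow> complex set" where
  "tree s z = {w. dist_L1 w z \<le> s / 2}"

definition corners :: "real \<Rightarrow> complex \<Rightarrow> complex set" where
  "corners s z = {z + of_real (s / 2), z - of_real (s / 2),
                  z + \<i> * of_real (s / 2), z - \<i> * of_real (s / 2)}"

definition table :: "real \<Rightarrow> complex set \<Rightarrow> complex set" where
  "table s g = - (\<Union>z\<in>g. interior (tree s z))"

text \<open>The angles \<open>\<theta>\<close>, \<open>- \<theta>\<close>, \<open>pi - \<theta>\<close>, \<open>- (pi - \<theta>)\<close>; note that the angle \<open>- \<theta>\<close> is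
  represented by the conjugate of \<open>\<theta>\<close>.\<close>

definition directions :: "complex \<Rightarrow> complex set" where
  "directions \<theta> = {\<theta>, cnj \<theta>, - cnj \<theta>, - \<theta>}"

text \<open>Directions are measured from the side direction \<open>y = x\<close>, hence the rotation by \<open>pi / 4\<close>.\<close>

definition velocity :: "complex \<Rightarrow> complex" where
  "velocity u = cis (pi / 4) * u"

text \<open>At a boundary point only the outgoing direction of a reflection belongs to the phase
  space; corners are excluded altogether.\<close>

definition phase_space :: "real \<Rightarrow> complex set \<Rightarrow> complex \<Rightarrow> (complex \<times> complex) set" where
  "phase_space s g \<theta> = {(p, u). p \<in> table s g \<and> u \<in> directions \<theta> \<and> (\<forall>z\<in>g. p \<notin> corners s z) \<and>
     (\<exists>\<epsilon>>0. \<forall>\<tau>\<in>{0<..<\<epsilon>}. p + \<tau> *\<^sub>R velocity u \<in> interior (table s g))}"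

text \<open>The outer unit normal at a boundary point \<open>p\<close>, not a corner, of the tree centred at \<open>z\<close>.\<close>

definition outer_normal :: "complex \<Rightarrow> complex \<Rightarrow> complex" where
  "outer_normal z p = Complex (sgn (Re (p - z))) (sgn (Im (p - z))) / of_real (sqrt 2)"

definition elastic_reflection ::
    "real \<Rightarrow> complex set \<Rightarrow> complex \<Rightarrow> complex \<Rightarrow> complex \<Rightarrow> bool" where
  "elastic_reflection s g p u u' \<longleftrightarrow> (\<exists>z\<in>g. p \<in> frontier (tree s z) \<and>
     velocity u' = velocity u - (2 * (velocity u \<bullet> outer_normal z p)) *\<^sub>R outer_normal z p)"

text \<open>In the following local description of an orbit over the time interval \<open>I\<close>, \<open>u\<close> is the
  direction just before time \<open>t\<close>, while the second component of \<open>\<gamma> t\<close> is the direction from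
  time \<open>t\<close> on.\<close>

definition billiard_orbit ::
    "real \<Rightarrow> complex set \<Rightarrow> complex \<Rightarrow> real set \<Rightarrow> (real \<Rightarrow> complex \<times> complex) \<Rightarrow> bool" where
  "billiard_orbit s g \<theta> I \<gamma> \<longleftrightarrow>
     (\<forall>t\<in>I. \<gamma> t \<in> phase_space s g \<theta> \<and>
       (\<exists>u. \<exists>\<epsilon>>0.
          (fst (\<gamma> t) \<in> interior (table s g) \<and> u = snd (\<gamma> t) \<or>
           elastic_reflection s g (fst (\<gamma> t)) u (snd (\<gamma> t))) \<and>
          (\<forall>t'\<in>I. t \<le> t' \<and> t' < t + \<epsilon> \<longrightarrow>
             \<gamma> t' = (fst (\<gamma> t) + (t' - t) *\<^sub>R velocity (snd (\<gamma> t)), snd (\<gamma> t))) \<and>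
          (\<forall>t'\<in>I. t - \<epsilon> < t' \<and> t' < t \<longrightarrow>
             \<gamma> t' = (fst (\<gamma> t) + (t' - t) *\<^sub>R velocity u, u))))"

text \<open>Flows are families of partial maps, undefined where the orbit stops before time \<open>t\<close>.\<close>

definition billiard_flow ::
    "real \<Rightarrow> complex set \<Rightarrow> complex \<Rightarrow> real \<Rightarrow> complex \<times> complex \<Rightarrow> (complex \<times> complex) option" where
  "billiard_flow s g \<theta> t x =
     (if \<exists>\<gamma>. billiard_orbit s g \<theta> (closed_segment 0 t) \<gamma> \<and> \<gamma> 0 = x
      then Some (THE y. \<exists>\<gamma>. billiard_orbit s g \<theta> (closed_segment 0 t) \<gamma> \<and> \<gamma> 0 = x \<and> \<gamma> t = y)
      else None)"

definition billiard_measure ::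
    "real \<Rightarrow> complex set \<Rightarrow> complex \<Rightarrow> (complex \<times> complex) measure" where
  "billiard_measure s g \<theta> =
     restrict_space lborel (table s g) \<Otimes>\<^sub>M count_space (directions \<theta>)"

definition flow_image :: "(real \<Rightarrow> 'a \<Rightarrow> 'a option) \<Rightarrow> real \<Rightarrow> 'a set \<Rightarrow> 'a set" where
  "flow_image \<psi> t B = {y. \<exists>x\<in>B. \<psi> t x = Some y}"

text \<open>The completion is used because images of measurable sets need only be measurable up to
  null sets, and \<^const>\<open>emeasure\<close> is \<open>0\<close> on non-measurable sets.\<close>

definition preserves_measure :: "'a measure \<Rightarrow> (real \<Rightarrow> 'a \<Rightarrow> 'a option) \<Rightarrow> bool" where
  "preserves_measure m \<psi> \<longleftrightarrow>
     (\<forall>t. (AE x in m. \<psi> t x \<noteq> None) \<and>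
       (\<forall>B\<in>sets m. flow_image \<psi> t B \<in> sets (completion m) \<and>
          emeasure (completion m) (flow_image \<psi> t B) = emeasure m B))"

definition ergodic_flow :: "'a measure \<Rightarrow> (real \<Rightarrow> 'a \<Rightarrow> 'a option) \<Rightarrow> bool" where
  "ergodic_flow m \<psi> \<longleftrightarrow> preserves_measure m \<psi> \<and>
     (\<forall>B\<in>sets m. (\<forall>t. sym_diff (flow_image \<psi> t B) B \<in> null_sets (completion m)) \<longrightarrow>
        emeasure m B = 0 \<or> emeasure m (space m - B) = 0)"

definition product_flow ::
    "nat \<Rightarrow> (real \<Rightarrow> 'a \<Rightarrow> 'a option) \<Rightarrow> real \<Rightarrow> (nat \<Rightarrow> 'a) \<Rightarrow> (nat \<Rightarrow> 'a) option" where
  "product_flow L \<psi> t x =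
     (if \<forall>k<L. \<psi> t (x k) \<noteq> None then Some (\<lambda>k\<in>{..<L}. the (\<psi> t (x k))) else None)"

definition infinite_ergodic_index :: "'a measure \<Rightarrow> (real \<Rightarrow> 'a \<Rightarrow> 'a option) \<Rightarrow> bool" where
  "infinite_ergodic_index m \<psi> \<longleftrightarrow>
     (\<forall>L\<ge>1. ergodic_flow (Pi\<^sub>M {..<L} (\<lambda>_. m)) (product_flow L \<psi>))"

definition num_in_direction :: "nat \<Rightarrow> complex \<Rightarrow> (nat \<Rightarrow> complex \<times> complex) \<Rightarrow> nat" where
  "num_in_direction K i x = card {k. k < K \<and> snd (x k) = i}"

definition num_in_direction_within ::
    "nat \<Rightarrow> complex set \<Rightarrow> complex \<Rightarrow> (nat \<Rightarrow> complex \<times> complex) \<Rightarrow> nat" where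
  "num_in_direction_within K A i x =
     (if \<forall>k<K. fst (x k) \<in> A then num_in_direction K i x else 0)"

end

theory Submission
  imports Defs
begin

text \<open>The ratio of the two time averages is governed by Hopf's ratio ergodic theorem, applied to the
  \<open>K\<close>-fold product flow on an infinite measure space. For bounded observables of an ergodic flow, the
  set where the orbit integrals of \<open>f - q h\<close> are unbounded above is invariant, and by the maximal
  ergodic lemma it cannot have full measure when \<open>f - q h\<close> has negative integral; hence the limit of
  the ratio is the ratio of the space integrals as soon as the orbit integrals of \<open>h\<close> diverge.

  Divergence (conservativity) comes from ergodicity of the \<open>2 K\<close>-fold product: if the integral \<open>U\<close> of
  \<open>h\<close> along forward orbits were finite, then the pairs \<open>(x, y)\<close> for which \<open>U\<close> of the orbit of \<open>x\<close>
  drops below a level \<open>a\<close> strictly before that of \<open>y\<close> would form an invariant set disjoint from its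
  mirror image, which forces \<open>U\<close> to be almost everywhere constant and \<open>h\<close> to have integral zero.

  Finally, the numbers of particles in the directions \<open>i\<close> and \<open>j\<close>, restricted to \<open>A\<close>, have the
  same space integral.\<close>

section \<open>Measure-preserving flows and the ratio ergodic theorem\<close>

text \<open>Ergodicity alone cannot yield divergence: translation on the real line is ergodic for an
  infinite invariant measure, yet forward orbit integrals of integrable functions converge. Its
  square is not ergodic, and the argument with pairs detects exactly this.

  The other obstacle is that the given flow is partial and that the hypotheses speak of images up to
  null sets. Points with an orbit for all real times form an invariant set of full measure; freezing
  the other points gives a group of total maps, whose measurability is obtained for the completed
  measure. The abstract theory is therefore stated for a total flow and later applied to a
  completion.

  Fubini needs joint measurability in time and state, which is not assumed; it comes from right
  continuity of orbits, the recorded direction at a reflection being the outgoing one. A Lebesgue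
  set \<open>A\<close> is exchanged for a Borel subset, since almost every orbit meets the
  difference only during a null set of times. The two space integrals agree because counting measure
  weights all directions equally.\<close>

locale measure_preserving_flow = sigma_finite_measure N for N :: "'a measure" +
  fixes \<phi> :: "real \<Rightarrow> 'a \<Rightarrow> 'a"
  assumes flow_zero: "x \<in> space N \<Longrightarrow> \<phi> 0 x = x"
    and flow_add: "x \<in> space N \<Longrightarrow> \<phi> (t + r) x = \<phi> t (\<phi> r x)"
    and flow_measurable [measurable]: "\<phi> t \<in> N \<rightarrow>\<^sub>M N"
    and flow_distr: "distr N N (\<phi> t) = N"
begin

lemma flow_space: "x \<in> space N \<Longrightarrow> \<phi> t x \<in> space N"
  using measurable_space[OF flow_measurable] .

lemma flow_inverse: "x \<in> space N \<Longrightarrow> \<phi> (- t) (\<phi> t x) = x"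
  using flow_add[of x "- t" t] flow_zero by simp

text \<open>Only sets that are invariant at every point are tested. This suffices because the sets
  to which it is applied are defined through the total flow and are invariant exactly, not merely up
  to null sets.\<close>

definition ergodic :: bool where
  "ergodic \<longleftrightarrow> (\<forall>B\<in>sets N. (\<forall>t. \<forall>x\<in>space N. \<phi> t x \<in> B \<longleftrightarrow> x \<in> B) \<longrightarrow>
     (AE x in N. x \<notin> B) \<or> (AE x in N. x \<in> B))"

definition doubly_ergodic :: bool where
  "doubly_ergodic \<longleftrightarrow> (\<forall>C\<in>sets (N \<Otimes>\<^sub>M N).
     (\<forall>t. \<forall>x\<in>space N. \<forall>y\<in>space N. (\<phi> t x, \<phi> t y) \<in> C \<longleftrightarrow> (x, y) \<in> C) \<longrightarrow>
     (AE z in N \<Otimes>\<^sub>M N. z \<notin> C) \<or> (AE z in N \<Otimes>\<^sub>M N. z \<in> C))"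

text \<open>Joint measurability is what Fubini and the measurability of orbit integrals require;
  measurability of \<open>f\<close> and of each single map of the flow would not provide it.\<close>

definition observable :: "('a \<Rightarrow> real) \<Rightarrow> bool" where
  "observable f \<longleftrightarrow> (\<lambda>(t, x). f (\<phi> t x)) \<in> borel_measurable (lborel \<Otimes>\<^sub>M N)"

definition orbit_integral :: "('a \<Rightarrow> real) \<Rightarrow> real \<Rightarrow> real \<Rightarrow> 'a \<Rightarrow> real" where
  "orbit_integral f a b x = (LBINT t:{a..b}. f (\<phi> t x))"

lemma observable_measurable_pair [measurable (raw)]:
  assumes f: "observable f" and [measurable]: "p \<in> M \<rightarrow>\<^sub>M borel" "q \<in> M \<rightarrow>\<^sub>M N"
  shows "(\<lambda>w. f (\<phi> (p w) (q w))) \<in> borel_measurable M"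
proof -
  have "(\<lambda>w. (p w, q w)) \<in> M \<rightarrow>\<^sub>M lborel \<Otimes>\<^sub>M N" by measurable
  from measurable_compose[OF this f[unfolded observable_def]] show ?thesis by simp
qed

lemma observable_measurable_orbit:
  assumes "observable f" "x \<in> space N"
  shows "(\<lambda>t. f (\<phi> t x)) \<in> borel_measurable lborel"
  using assms by (intro observable_measurable_pair) auto

lemma observable_linear:
  assumes "observable f" "observable h"
  shows "observable (\<lambda>x. a * f x + b * h x)"
  using assms unfolding observable_def by (auto simp: case_prod_beta)

context
  fixes f :: "'a \<Rightarrow> real" and c :: real
  assumes f: "observable f" and bounded: "\<And>x. \<bar>f x\<bar> \<le> c"
begin

lemma orbit_set_integrable:
  assumes "x \<in> space N"
  shows "set_integrable lborel {a..b} (\<lambda>t. f (\<phi> t x))"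
  unfolding set_integrable_def
  using observable_measurable_orbit[OF f assms] bounded
  by (intro integrableI_bounded_set_indicator[where B=c]) (auto simp: emeasure_lborel_Icc_eq)

lemma orbit_integral_combine:
  assumes "x \<in> space N" "a \<le> b" "b \<le> d"
  shows "orbit_integral f a d x = orbit_integral f a b x + orbit_integral f b d x"
proof -
  have "{a..d} = {a..b} \<union> {b..d}" using assms by auto
  moreover have "AE t in lborel. \<not> (t \<in> {a..b} \<and> t \<in> {b..d})"
    by (rule AE_mp[OF AE_lborel_singleton[of b]]) auto
  ultimately show ?thesis
    unfolding orbit_integral_def using orbit_set_integrable[OF assms(1)]
    by (simp add: set_integral_Un_AE)
qed

lemma orbit_integral_shift:
  assumes "x \<in> space N"
  shows "orbit_integral f a b (\<phi> r x) = orbit_integral f (a + r) (b + r) x"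
proof -
  have "orbit_integral f (a + r) (b + r) x =
      (LBINT t. indicator {a + r..b + r} (r + 1 * t) *\<^sub>R f (\<phi> (r + 1 * t) x))"
    unfolding orbit_integral_def set_lebesgue_integral_def
    by (subst lborel_integral_real_affine[where c=1 and t=r]) auto
  also have "\<dots> = orbit_integral f a b (\<phi> r x)"
    unfolding orbit_integral_def set_lebesgue_integral_def
    by (rule Bochner_Integration.integral_cong)
       (auto simp: flow_add[OF assms, symmetric] add.commute indicator_def)
  finally show ?thesis ..
qed

lemma orbit_integral_bound:
  assumes "x \<in> space N" "a \<le> b"
  shows "\<bar>orbit_integral f a b x\<bar> \<le> c * (b - a)"
proof -
  have "norm (orbit_integral f a b x) \<le> (LBINT t. norm (indicator {a..b} t *\<^sub>R f (\<phi> t x)))"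
    unfolding orbit_integral_def set_lebesgue_integral_def by (rule integral_norm_bound)
  also have "\<dots> \<le> (LBINT t. indicator {a..b} t * c)"
  proof (rule integral_mono)
    show "integrable lborel (\<lambda>t. indicator {a..b} t * c)"
      by (intro integrable_mult_left integrable_real_indicator) (auto simp: emeasure_lborel_Icc_eq)
  qed (use orbit_set_integrable[OF assms(1), of a b] bounded in \<open>auto simp: set_integrable_def indicator_def\<close>)
  also have "\<dots> = c * (b - a)" using assms by simp
  finally show ?thesis by simp
qed

text \<open>The time windows of length \<open>T\<close> along the two orbits differ only in end
  pieces of length \<open>\<bar>r\<bar>\<close>. The bound does not depend on \<open>T\<close>, so
  boundedness of orbit integrals is a property of the whole orbit.\<close>

lemma orbit_integral_flow:
  assumes x: "x \<in> space N" and "T \<ge> 0"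
  shows "\<bar>orbit_integral f 0 T (\<phi> r x) - orbit_integral f 0 T x\<bar> \<le> 2 * c * \<bar>r\<bar>"
proof -
  have *: "\<bar>orbit_integral f 0 T (\<phi> r x) - orbit_integral f 0 T x\<bar> \<le> 2 * c * r"
    if r: "r \<ge> 0" and x: "x \<in> space N" for r x
  proof -
    have "orbit_integral f 0 T (\<phi> r x) = orbit_integral f r (T + r) x"
      using orbit_integral_shift[OF x] by simp
    moreover have "orbit_integral f 0 (T + r) x = orbit_integral f 0 T x + orbit_integral f T (T + r) x"
      "orbit_integral f 0 (T + r) x = orbit_integral f 0 r x + orbit_integral f r (T + r) x"
      using r \<open>T \<ge> 0\<close> x by (auto intro!: orbit_integral_combine)
    moreover have "\<bar>orbit_integral f T (T + r) x\<bar> \<le> c * r" "\<bar>orbit_integral f 0 r x\<bar> \<le> c * r"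
      using orbit_integral_bound[OF x, of T "T + r"] orbit_integral_bound[OF x, of 0 r] r by auto
    ultimately show ?thesis by linarith
  qed
  show ?thesis
  proof (cases "r \<ge> 0")
    case True
    then show ?thesis using *[OF _ x] by simp
  next
    case False
    \<comment> \<open>A negative \<open>r\<close> is reduced to a positive one by exchanging the
      roles of the two points.\<close>
    have "\<phi> (- r) (\<phi> r x) = x" using flow_inverse[OF x] .
    then show ?thesis using *[of "- r" "\<phi> r x"] flow_space[OF x, of r] False
      by (auto simp: abs_minus_commute)
  qed
qed

lemma orbit_integral_measurable [measurable]: "orbit_integral f a b \<in> borel_measurable N"
  unfolding orbit_integral_def[abs_def] set_lebesgue_integral_def
  using f by measurable

text \<open>The bridge from continuous time to ergodic sums of the time-one map, for which the
  maximal ergodic lemma is proved.\<close>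

lemma orbit_integral_sum:
  assumes x: "x \<in> space N"
  shows "orbit_integral f 0 (real n) x = (\<Sum>k<n. orbit_integral f 0 1 (\<phi> (real k) x))"
proof (induction n)
  case 0
  then show ?case using orbit_integral_bound[OF x, of 0 0] by simp
next
  case (Suc n)
  have "orbit_integral f 0 (real (Suc n)) x =
      orbit_integral f 0 (real n) x + orbit_integral f (real n) (real (Suc n)) x"
    by (rule orbit_integral_combine[OF x]) auto
  also have "orbit_integral f (real n) (real (Suc n)) x = orbit_integral f 0 1 (\<phi> (real n) x)"
    using orbit_integral_shift[OF x, of 0 1 "real n"] by (simp add: add.commute)
  finally show ?case using Suc by simp
qed

end

section \<open>Invariance of integrals and the maximal ergodic lemma\<close>

lemma integrable_flow:
  assumes "integrable N (f :: 'a \<Rightarrow> real)"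
  shows "integrable N (\<lambda>x. f (\<phi> t x))" "(\<integral>x. f (\<phi> t x) \<partial>N) = (\<integral>x. f x \<partial>N)"
proof -
  have "integrable (distr N N (\<phi> t)) f" using assms flow_distr by simp
  then show "integrable N (\<lambda>x. f (\<phi> t x))" by (rule integrable_distr[OF flow_measurable])
  have "(\<integral>x. f x \<partial>distr N N (\<phi> t)) = (\<integral>x. f (\<phi> t x) \<partial>N)"
    using assms by (intro integral_distr) auto
  then show "(\<integral>x. f (\<phi> t x) \<partial>N) = (\<integral>x. f x \<partial>N)" using flow_distr by simp
qed

lemma AE_flow:
  assumes "AE x in N. P x"
  shows "AE x in N. P (\<phi> t x)"
proof -
  have "AE x in distr N N (\<phi> t). P x" using assms by (simp only: flow_distr)
  then show ?thesis
    by (rule AE_distrD[OF flow_measurable])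
qed

lemma pair_sigma_finite_lborel: "pair_sigma_finite lborel N"
  by (simp add: pair_sigma_finite_def sigma_finite_measure_axioms sigma_finite_lborel)

text \<open>Fubini: every time slice of the double integral has the same value, by invariance of the
  measure, and the time interval has length 1.\<close>

lemma
  assumes f: "observable f" and int: "integrable N f"
  shows integrable_orbit_integral: "integrable N (orbit_integral f 0 1)"
    and integral_orbit_integral: "(\<integral>x. orbit_integral f 0 1 x \<partial>N) = (\<integral>x. f x \<partial>N)"
proof -
  interpret P: pair_sigma_finite lborel N by (rule pair_sigma_finite_lborel)
  have meas: "(\<lambda>(t, x). indicator {0..1} t *\<^sub>R f (\<phi> t x)) \<in> borel_measurable (lborel \<Otimes>\<^sub>M N)"
    using f unfolding observable_def by (simp add: case_prod_beta)
  have norm: "(\<integral>x. norm (indicator {0..1} t *\<^sub>R f (\<phi> t x)) \<partial>N) =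
      indicator {0..1} t *\<^sub>R (\<integral>x. \<bar>f x\<bar> \<partial>N)" for t :: real
    using integrable_flow[of "\<lambda>x. \<bar>f x\<bar>" t] int by (auto simp: indicator_def)
  have *: "integrable (lborel \<Otimes>\<^sub>M N) (\<lambda>(t, x). indicator {0..1} t *\<^sub>R f (\<phi> t x))"
  proof (rule P.Fubini_integrable[OF meas])
    show "integrable lborel (\<lambda>t. \<integral>x. norm (case (t, x) of (t, x) \<Rightarrow> indicator {0..1::real} t *\<^sub>R f (\<phi> t x)) \<partial>N)"
      by (simp add: norm[simplified])
    show "AE t in lborel. integrable N (\<lambda>x. case (t, x) of (t, x) \<Rightarrow> indicator {0..1::real} t *\<^sub>R f (\<phi> t x))"
      using integrable_flow(1)[OF int] by simp
  qed
  show "integrable N (orbit_integral f 0 1)"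
    using P.integrable_snd[OF *] unfolding orbit_integral_def[abs_def] set_lebesgue_integral_def .
  have "(\<integral>x. orbit_integral f 0 1 x \<partial>N) = (LBINT t. (\<integral>x. indicator {0..1::real} t *\<^sub>R f (\<phi> t x) \<partial>N))"
    unfolding orbit_integral_def[abs_def] set_lebesgue_integral_def
    by (rule P.Fubini_integral[OF *])
  also have "\<dots> = (LBINT t. indicator {0..1::real} t *\<^sub>R (\<integral>x. f x \<partial>N))"
    using integrable_flow(2)[OF int] by simp
  finally show "(\<integral>x. orbit_integral f 0 1 x \<partial>N) = (\<integral>x. f x \<partial>N)" by simp
qed

text \<open>The maximum of \<open>0\<close> and the first \<open>n\<close> ergodic sums of the time-one map, in the recursive form
  that Garsia's proof of the maximal ergodic lemma needs.\<close>

fun max_ergodic_sum :: "('a \<Rightarrow> real) \<Rightarrow> nat \<Rightarrow> 'a \<Rightarrow> real" where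
  "max_ergodic_sum f 0 x = 0"
| "max_ergodic_sum f (Suc n) x = max 0 (f x + max_ergodic_sum f n (\<phi> 1 x))"

lemma max_ergodic_sum_Suc_ge: "max_ergodic_sum f n x \<le> max_ergodic_sum f (Suc n) x"
proof (induction n arbitrary: x)
  case (Suc n)
  show ?case using Suc[of "\<phi> 1 x"] by (auto simp: max_def)
qed simp

lemma max_ergodic_sum_nonneg: "0 \<le> max_ergodic_sum f n x"
  by (cases n) auto

lemma max_ergodic_sum_ge:
  assumes "x \<in> space N"
  shows "(\<Sum>k<n. f (\<phi> (real k) x)) \<le> max_ergodic_sum f n x"
  using assms
proof (induction n arbitrary: x)
  case (Suc n)
  have "(\<Sum>k<Suc n. f (\<phi> (real k) x)) = f x + (\<Sum>k<n. f (\<phi> (real k) (\<phi> 1 x)))"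
    unfolding sum.lessThan_Suc_shift using flow_add[OF Suc.prems, of _ 1, symmetric]
    by (simp add: flow_zero[OF Suc.prems] add.commute)
  also have "\<dots> \<le> f x + max_ergodic_sum f n (\<phi> 1 x)"
    using Suc.IH[of "\<phi> 1 x"] flow_space[OF Suc.prems] by simp
  finally show ?case by simp
qed simp

lemma integrable_max_ergodic_sum:
  assumes "integrable N f"
  shows "integrable N (max_ergodic_sum f n)"
proof (induction n)
  case 0
  then show ?case by (simp add: max_ergodic_sum.simps[abs_def])
next
  case (Suc n)
  from integrable_flow(1)[OF this, of 1] assms show ?case
    by (simp add: max_ergodic_sum.simps[abs_def])
qed

text \<open>Garsia's argument: \<open>f\<close> dominates a difference of maximal sums whose
  integral is nonnegative, because the flow preserves integrals and maximal sums grow with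
  \<open>n\<close>. This holds on each set \<open>?E (Suc n)\<close>; by \<open>pos\<close> these
  sets exhaust the space up to a null set, and \<open>\<bar>f\<bar>\<close> dominates in the
  limit.\<close>

lemma maximal_ergodic_lemma:
  assumes f: "integrable N f" and pos: "AE x in N. \<exists>n. max_ergodic_sum f n x > 0"
  shows "0 \<le> (\<integral>x. f x \<partial>N)"
proof -
  let ?M = "max_ergodic_sum f" and ?E = "\<lambda>n. {x. max_ergodic_sum f n x > 0}"
  note [measurable] = borel_measurable_integrable[OF integrable_max_ergodic_sum[OF f]]
    borel_measurable_integrable[OF f]
  have ind [measurable]: "(\<lambda>x. indicator (?E n) x :: real) \<in> borel_measurable N" for n
    unfolding indicator_def by measurable
  have nonneg: "0 \<le> (\<integral>x. indicator (?E (Suc n)) x * f x \<partial>N)" for n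
  proof -
    \<comment> \<open>On \<open>?E (Suc n)\<close> the recursion makes this an equality; elsewhere
      the first maximal sum is 0 and the subtracted one is nonnegative.\<close>
    have "?M (Suc n) x - ?M n (\<phi> 1 x) \<le> indicator (?E (Suc n)) x * f x" for x
      using max_ergodic_sum_nonneg[of f n "\<phi> 1 x"] by (auto simp: indicator_def)
    moreover have "integrable N (\<lambda>x. indicator (?E (Suc n)) x * f x)"
      by (rule Bochner_Integration.integrable_bound[OF f]) (auto simp: indicator_def)
    moreover have "integrable N (\<lambda>x. ?M (Suc n) x - ?M n (\<phi> 1 x))"
      by (intro Bochner_Integration.integrable_diff integrable_max_ergodic_sum integrable_flow f)
    ultimately have "(\<integral>x. ?M (Suc n) x - ?M n (\<phi> 1 x) \<partial>N) \<le> (\<integral>x. indicator (?E (Suc n)) x * f x \<partial>N)"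
      by (intro integral_mono) auto
    moreover have "(\<integral>x. ?M (Suc n) x - ?M n (\<phi> 1 x) \<partial>N) = (\<integral>x. ?M (Suc n) x \<partial>N) - (\<integral>x. ?M n x \<partial>N)"
      using integrable_max_ergodic_sum[OF f] integrable_flow[OF integrable_max_ergodic_sum[OF f]]
      by (subst Bochner_Integration.integral_diff) auto
    moreover have "(\<integral>x. ?M n x \<partial>N) \<le> (\<integral>x. ?M (Suc n) x \<partial>N)"
      by (intro integral_mono integrable_max_ergodic_sum f max_ergodic_sum_Suc_ge)
    ultimately show ?thesis by linarith
  qed
  have "(\<lambda>n. \<integral>x. indicator (?E (Suc n)) x * f x \<partial>N) \<longlonglongrightarrow> (\<integral>x. f x \<partial>N)"
  proof (rule integral_dominated_convergence[where w="\<lambda>x. \<bar>f x\<bar>"])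
    show "AE x in N. (\<lambda>n. indicator (?E (Suc n)) x * f x) \<longlonglongrightarrow> f x"
      using pos
    proof eventually_elim
      case (elim x)
      then obtain m where m: "?M m x > 0" by blast
      have "?M n x > 0" if "n \<ge> m" for n
        using m lift_Suc_mono_le[of "\<lambda>n. ?M n x", OF max_ergodic_sum_Suc_ge that] by linarith
      then have "\<forall>\<^sub>F n in sequentially. indicator (?E (Suc n)) x * f x = f x"
        unfolding eventually_sequentially by (intro exI[of _ m]) (auto simp del: max_ergodic_sum.simps)
      then show ?case by (rule tendsto_eventually)
    qed
  qed (use f in \<open>auto simp: indicator_def simp del: max_ergodic_sum.simps\<close>)
  then show ?thesis using nonneg by (intro LIMSEQ_le_const) auto
qed

text \<open>Unboundedness above is invariant by \<open>orbit_integral_flow\<close>, so ergodicity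
  decides it. Restricting to integer times and integer levels keeps the set measurable.\<close>

lemma orbit_integral_dichotomy:
  assumes erg: ergodic and f: "observable f" and c: "\<And>x. \<bar>f x\<bar> \<le> c"
  shows "(AE x in N. \<forall>m::nat. \<exists>n::nat. real m < orbit_integral f 0 (real n) x) \<or>
    (AE x in N. \<exists>C. \<forall>T\<ge>0. orbit_integral f 0 T x \<le> C)"
proof -
  let ?I = "orbit_integral f"
  have [measurable]: "?I a b \<in> borel_measurable N" for a b
    by (rule orbit_integral_measurable[OF f c])
  define B where "B = {x\<in>space N. \<forall>m::nat. \<exists>n::nat. ?I 0 (real n) x > real m}"
  have B [measurable]: "B \<in> sets N" unfolding B_def by measurable
  have *: "\<phi> t x \<in> B" if "x \<in> B" for t x
  proof -
    have x: "x \<in> space N" using that B_def by auto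
    show ?thesis unfolding B_def
    proof (safe intro!: flow_space[OF x])
      fix m :: nat
      \<comment> \<open>The level is raised by the largest possible change of an orbit integral when
        the starting point moves by time \<open>t\<close>.\<close>
      obtain m' :: nat where m': "real m' \<ge> real m + 2 * c * \<bar>t\<bar>" using real_arch_simple by blast
      from that have "\<exists>n::nat. ?I 0 (real n) x > real m'" by (simp add: B_def)
      then obtain n :: nat where "?I 0 (real n) x > real m'" ..
      then show "\<exists>n::nat. ?I 0 (real n) (\<phi> t x) > real m"
        using orbit_integral_flow[OF f c x, of "real n" t] m' by (intro exI[of _ n]) auto
    qed
  qed
  have inv: "\<phi> t x \<in> B \<longleftrightarrow> x \<in> B" if "x \<in> space N" for t x
    using *[of x t] *[of "\<phi> t x" "- t"] flow_inverse[OF that] by auto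
  from erg B inv consider "AE x in N. x \<in> B" | "AE x in N. x \<notin> B" unfolding ergodic_def by blast
  then show ?thesis
  proof cases
    case 1
    then show ?thesis unfolding B_def by auto
  next
    case 2
    then have "AE x in N. \<exists>C. \<forall>T\<ge>0. ?I 0 T x \<le> C"
    proof (rule AE_mp, intro AE_I2 impI)
      fix x assume x: "x \<in> space N" and "x \<notin> B"
      then have "\<exists>m::nat. \<forall>n::nat. ?I 0 (real n) x \<le> real m" by (simp add: B_def not_less)
      then obtain m :: nat where m: "\<And>n::nat. ?I 0 (real n) x \<le> real m" by blast
      show "\<exists>C. \<forall>T\<ge>0. ?I 0 T x \<le> C"
      \<comment> \<open>The additional \<open>c\<close> pays for the part of the orbit between the
        integer \<open>\<lfloor>T\<rfloor>\<close> and \<open>T\<close>, which lasts at most one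
        unit of time.\<close>
      proof (intro exI[of _ "real m + c"] allI impI)
        fix T :: real assume T: "T \<ge> 0"
        let ?n = "nat \<lfloor>T\<rfloor>"
        have n: "real ?n \<le> T" "T \<le> real ?n + 1" using T by linarith+
        have "\<bar>?I (real ?n) T x\<bar> \<le> c * (T - real ?n)" using n by (intro orbit_integral_bound[OF f c x])
        also have "\<dots> \<le> c * 1" using n c[of x] by (intro mult_left_mono) linarith+
        finally show "?I 0 T x \<le> real m + c"
          using orbit_integral_combine[OF f c x, of 0 "real ?n" T] n m[of ?n] by auto
      qed
    qed
    then show ?thesis by blast
  qed
qed

text \<open>In the unbounded alternative almost every point has a positive ergodic sum, and the
  maximal ergodic lemma would force a nonnegative integral.\<close>

lemma orbit_integral_bdd_above:
  assumes erg: ergodic and f: "observable f" and int: "integrable N f"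
    and c: "\<And>x. \<bar>f x\<bar> \<le> c" and neg: "(\<integral>x. f x \<partial>N) < 0"
  shows "AE x in N. \<exists>C. \<forall>T\<ge>0. orbit_integral f 0 T x \<le> C"
proof -
  let ?I = "orbit_integral f"
  have "\<not> (AE x in N. \<forall>m::nat. \<exists>n::nat. real m < ?I 0 (real n) x)"
  proof
    assume "AE x in N. \<forall>m::nat. \<exists>n::nat. real m < ?I 0 (real n) x"
    then have "AE x in N. \<exists>n. max_ergodic_sum (?I 0 1) n x > 0"
    proof (rule AE_mp, intro AE_I2 impI)
      fix x assume x: "x \<in> space N" and "\<forall>m::nat. \<exists>n::nat. real m < ?I 0 (real n) x"
      then obtain n :: nat where "real 0 < ?I 0 (real n) x" by blast
      then show "\<exists>n. max_ergodic_sum (?I 0 1) n x > 0"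
        using max_ergodic_sum_ge[OF x, of "?I 0 1" n] orbit_integral_sum[OF f c x, of n]
        by (intro exI[of _ n]) auto
    qed
    from maximal_ergodic_lemma[OF integrable_orbit_integral[OF f int] this]
      integral_orbit_integral[OF f int] neg show False by simp
  qed
  then show ?thesis using orbit_integral_dichotomy[OF erg f c] by blast
qed

text \<open>Only the forward half of the orbit is integrated, so the value can only decrease along
  orbits; this monotonicity distinguishes a pair from its mirror image. Values in
  \<open>ennreal\<close> admit divergence.\<close>

definition total_orbit_integral :: "('a \<Rightarrow> real) \<Rightarrow> 'a \<Rightarrow> ennreal" where
  "total_orbit_integral f x = (\<integral>\<^sup>+t. ennreal (f (\<phi> t x)) * indicator {0..} t \<partial>lborel)"

lemma total_orbit_integral_measurable:
  assumes "observable f"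
  shows "total_orbit_integral f \<in> borel_measurable N"
  unfolding total_orbit_integral_def[abs_def] using assms by measurable

lemma AE_pair_rectangle:
  assumes [measurable]: "P \<in> sets N" "Q \<in> sets N"
    and *: "AE z in N \<Otimes>\<^sub>M N. \<not> (fst z \<in> P \<and> snd z \<in> Q)"
  shows "(AE x in N. x \<notin> P) \<or> (AE x in N. x \<notin> Q)"
proof -
  have "P \<times> Q \<in> null_sets (N \<Otimes>\<^sub>M N)"
    by (rule AE_iff_null_sets[THEN iffD2]) (use * in \<open>auto simp: mem_Times_iff\<close>)
  then have "emeasure N P * emeasure N Q = 0"
    using emeasure_pair_measure_Times[of P N Q] by auto
  then have "P \<in> null_sets N \<or> Q \<in> null_sets N" by auto
  then show ?thesis using AE_not_in by blast
qed

context
  fixes f :: "'a \<Rightarrow> real" and c :: real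
  assumes f: "observable f" and nonneg: "\<And>x. 0 \<le> f x" and bounded: "\<And>x. f x \<le> c"
begin

lemma abs_bounded: "\<bar>f x\<bar> \<le> c"
  using nonneg[of x] bounded[of x] by simp

lemma nn_integral_orbit:
  assumes x: "x \<in> space N"
  shows "(\<integral>\<^sup>+t. ennreal (f (\<phi> t x)) * indicator {a..b} t \<partial>lborel) = ennreal (orbit_integral f a b x)"
proof -
  have "(\<integral>\<^sup>+t. ennreal (f (\<phi> t x)) * indicator {a..b} t \<partial>lborel) =
      (\<integral>\<^sup>+t. ennreal (indicator {a..b} t *\<^sub>R f (\<phi> t x)) \<partial>lborel)"
    by (intro nn_integral_cong) (auto simp: indicator_def)
  also have "\<dots> = ennreal (orbit_integral f a b x)"
    unfolding orbit_integral_def set_lebesgue_integral_def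
    using orbit_set_integrable[OF f abs_bounded x] nonneg unfolding set_integrable_def
    by (intro nn_integral_eq_integral) auto
  finally show ?thesis .
qed

lemma orbit_integral_nonneg: "0 \<le> orbit_integral f a b x"
  unfolding orbit_integral_def set_lebesgue_integral_def
  using nonneg by (intro Bochner_Integration.integral_nonneg) auto

lemma orbit_integral_mono:
  assumes "x \<in> space N" "0 \<le> a" "a \<le> b"
  shows "orbit_integral f 0 a x \<le> orbit_integral f 0 b x"
  using orbit_integral_combine[OF f abs_bounded assms] orbit_integral_nonneg[of a b x] by simp

lemma total_orbit_integral_flow:
  assumes x: "x \<in> space N" and r: "r \<ge> 0"
  shows "total_orbit_integral f x = ennreal (orbit_integral f 0 r x) + total_orbit_integral f (\<phi> r x)"
proof -
  note [measurable] = observable_measurable_orbit[OF f x, unfolded measurable_lborel1]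
  have "total_orbit_integral f (\<phi> r x) =
      (\<integral>\<^sup>+t. ennreal (f (\<phi> (r + 1 * t) x)) * indicator {r..} (r + 1 * t) \<partial>lborel)"
    unfolding total_orbit_integral_def
    by (intro nn_integral_cong)
       (auto simp: flow_add[OF x, symmetric] add.commute indicator_def)
  also have "\<dots> = (\<integral>\<^sup>+t. ennreal (f (\<phi> t x)) * indicator {r..} t \<partial>lborel)"
    by (subst nn_integral_real_affine[where c=1 and t=r]) auto
  finally have "ennreal (orbit_integral f 0 r x) + total_orbit_integral f (\<phi> r x) =
      (\<integral>\<^sup>+t. ennreal (f (\<phi> t x)) * indicator {0..r} t + ennreal (f (\<phi> t x)) * indicator {r..} t \<partial>lborel)"
    unfolding nn_integral_orbit[OF x, symmetric] by (subst nn_integral_add) auto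
  also have "\<dots> = total_orbit_integral f x"
    unfolding total_orbit_integral_def
    by (rule nn_integral_cong_AE, rule AE_mp[OF AE_lborel_singleton[of r]])
       (use r in \<open>auto simp: indicator_def intro!: AE_I2\<close>)
  finally show ?thesis ..
qed

lemma total_orbit_integral_antimono:
  assumes "x \<in> space N" "t \<le> r"
  shows "total_orbit_integral f (\<phi> r x) \<le> total_orbit_integral f (\<phi> t x)"
  using total_orbit_integral_flow[OF flow_space[OF assms(1), of t], of "r - t"] assms
    flow_add[OF assms(1), of "r - t" t] by (simp add: add_increasing)

lemma total_orbit_integral_finite:
  assumes x: "x \<in> space N" and C: "\<And>T. T \<ge> 0 \<Longrightarrow> orbit_integral f 0 T x \<le> C"
  shows "total_orbit_integral f x < \<infinity>"
proof -
  note [measurable] = observable_measurable_orbit[OF f x, unfolded measurable_lborel1]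
  have lim: "(\<lambda>n. ennreal (f (\<phi> t x)) * indicator {0..real n} t) \<longlonglongrightarrow> ennreal (f (\<phi> t x)) * indicator {0..} t" for t
  proof (rule tendsto_eventually)
    obtain m :: nat where "real m \<ge> t" using real_arch_simple by blast
    then show "\<forall>\<^sub>F n in sequentially. ennreal (f (\<phi> t x)) * indicator {0..real n} t = ennreal (f (\<phi> t x)) * indicator {0..} t"
      unfolding eventually_sequentially by (intro exI[of _ m]) (auto simp: indicator_def)
  qed
  have "(\<lambda>n::nat. \<integral>\<^sup>+t. ennreal (f (\<phi> t x)) * indicator {0..real n} t \<partial>lborel) \<longlonglongrightarrow> total_orbit_integral f x"
    unfolding total_orbit_integral_def
  proof (rule nn_integral_LIMSEQ)
    show "incseq (\<lambda>n t. ennreal (f (\<phi> t x)) * indicator {0..real n} t)"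
      by (auto simp: incseq_def le_fun_def indicator_def)
  qed (auto intro: lim)
  moreover have "(\<integral>\<^sup>+t. ennreal (f (\<phi> t x)) * indicator {0..real n} t \<partial>lborel) \<le> ennreal C" for n :: nat
    unfolding nn_integral_orbit[OF x] using C by (intro ennreal_leI) simp
  ultimately have "total_orbit_integral f x \<le> ennreal C" by (intro LIMSEQ_le_const2) auto
  then show ?thesis using order_le_less_trans[OF _ ennreal_less_top] by simp
qed

text \<open>This lets a countable union over rational times replace an uncountable one, as
  measurability requires. Shortly after \<open>t\<close> the value at \<open>x\<close> is still
  below \<open>a\<close> by monotonicity, while the value at \<open>y\<close> has dropped by at most
  \<open>c\<close> times the elapsed time.\<close>

lemma total_orbit_integral_crossing_rational:
  assumes x: "x \<in> space N" and y: "y \<in> space N"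
    and t: "total_orbit_integral f (\<phi> t x) < a" "a < total_orbit_integral f (\<phi> t y)"
  shows "\<exists>q::rat. total_orbit_integral f (\<phi> (of_rat q) x) < a \<and> a < total_orbit_integral f (\<phi> (of_rat q) y)"
proof (rule ccontr)
  assume neg: "\<not> ?thesis"
  have c: "c \<ge> 0" using nonneg[of x] bounded[of x] by simp
  have "total_orbit_integral f (\<phi> t y) \<le> a"
  proof (rule ennreal_le_epsilon)
    fix e :: real assume e: "e > 0"
    \<comment> \<open>Within this time the value at \<open>y\<close> drops by at most
      \<open>e\<close>; the denominator is \<open>c + 1\<close> because \<open>c\<close> may be
      0.\<close>
    have "t < t + e / (c + 1)" using e c by (simp add: divide_pos_pos)
    then obtain q where q: "t < of_rat q" "of_rat q < t + e / (c + 1)" using of_rat_dense by blast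
    have "total_orbit_integral f (\<phi> (of_rat q) x) < a"
      using total_orbit_integral_antimono[OF x, of t "of_rat q"] q t by auto
    then have le: "total_orbit_integral f (\<phi> (of_rat q) y) \<le> a" using neg by auto
    have "orbit_integral f 0 (of_rat q - t) (\<phi> t y) \<le> c * (of_rat q - t)"
      using orbit_integral_bound[OF f abs_bounded flow_space[OF y], of 0 "of_rat q - t" t] q by auto
    also have "\<dots> \<le> c * (e / (c + 1))" using q c by (intro mult_left_mono) auto
    also have "\<dots> \<le> e" using c e by (simp add: field_simps)
    finally have "ennreal (orbit_integral f 0 (of_rat q - t) (\<phi> t y)) \<le> ennreal e"
      by (rule ennreal_leI)
    then show "total_orbit_integral f (\<phi> t y) \<le> a + ennreal e"
      using total_orbit_integral_flow[OF flow_space[OF y, of t], of "of_rat q - t"] q le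
        flow_add[OF y, of "of_rat q - t" t] by (simp add: add.commute add_mono)
  qed
  then show False using t by simp
qed

text \<open>The set of pairs whose remaining orbit integrals are separated by the level \<open>a\<close> at some
  common time is invariant and disjoint from its mirror image, so that one of them is null.\<close>

lemma total_orbit_integral_level:
  assumes erg2: doubly_ergodic
  shows "(AE x in N. \<not> total_orbit_integral f x < a) \<or> (AE x in N. \<not> a < total_orbit_integral f x)"
proof -
  let ?U = "total_orbit_integral f"
  note [measurable] = total_orbit_integral_measurable[OF f]
  define C where "C = {z\<in>space (N \<Otimes>\<^sub>M N). \<exists>q::rat. ?U (\<phi> (of_rat q) (fst z)) < a \<and> a < ?U (\<phi> (of_rat q) (snd z))}"
  have C [measurable]: "C \<in> sets (N \<Otimes>\<^sub>M N)" unfolding C_def by measurable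
  \<comment> \<open>The rational form of \<open>C\<close> gives measurability; the equivalent form
    with real times gives invariance under every map of the flow.\<close>
  have C_iff: "(x, y) \<in> C \<longleftrightarrow> (\<exists>t. ?U (\<phi> t x) < a \<and> a < ?U (\<phi> t y))"
    if "x \<in> space N" "y \<in> space N" for x y
    using total_orbit_integral_crossing_rational[OF that] that
    unfolding C_def by (auto simp: space_pair_measure)
  have inv: "(\<phi> t x, \<phi> t y) \<in> C \<longleftrightarrow> (x, y) \<in> C" if x: "x \<in> space N" and y: "y \<in> space N" for t x y
  proof -
    have "(\<phi> t x, \<phi> t y) \<in> C \<longleftrightarrow> (\<exists>r. ?U (\<phi> (r + t) x) < a \<and> a < ?U (\<phi> (r + t) y))"
      by (simp add: C_iff flow_space x y flow_add)
    also have "\<dots> \<longleftrightarrow> (\<exists>r. ?U (\<phi> r x) < a \<and> a < ?U (\<phi> r y))"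
      by (metis diff_add_cancel)
    finally show ?thesis by (simp add: C_iff x y)
  qed
  define P where "P = {x\<in>space N. ?U x < a}"
  define Q where "Q = {x\<in>space N. a < ?U x}"
  have [measurable]: "P \<in> sets N" "Q \<in> sets N" unfolding P_def Q_def by measurable
  have "\<forall>t. \<forall>x\<in>space N. \<forall>y\<in>space N. (\<phi> t x, \<phi> t y) \<in> C \<longleftrightarrow> (x, y) \<in> C"
    using inv by simp
  then have "(AE z in N \<Otimes>\<^sub>M N. z \<notin> C) \<or> (AE z in N \<Otimes>\<^sub>M N. z \<in> C)"
    by (rule bspec[OF erg2[unfolded doubly_ergodic_def] C, THEN mp])
  then consider "AE z in N \<Otimes>\<^sub>M N. z \<notin> C" | "AE z in N \<Otimes>\<^sub>M N. z \<in> C" ..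
  then have "(AE x in N. x \<notin> P) \<or> (AE x in N. x \<notin> Q)"
  proof cases
    case 1
    have "AE z in N \<Otimes>\<^sub>M N. \<not> (fst z \<in> P \<and> snd z \<in> Q)"
      using 1
    proof eventually_elim
      case (elim z)
      show ?case
      proof
        assume PQ: "fst z \<in> P \<and> snd z \<in> Q"
        then have "(fst z, snd z) \<in> C"
          by (subst C_iff) (auto simp: P_def Q_def flow_zero intro!: exI[of _ 0])
        then show False using elim by simp
      qed
    qed
    then show ?thesis by (intro AE_pair_rectangle) auto
  next
    case 2
    have "AE z in N \<Otimes>\<^sub>M N. \<not> (fst z \<in> Q \<and> snd z \<in> P)"
      using 2
    proof eventually_elim
      case (elim z)
      show ?case
      proof
        assume PQ: "fst z \<in> Q \<and> snd z \<in> P"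
        then have z: "fst z \<in> space N" "snd z \<in> space N" by (auto simp: P_def Q_def)
        from elim have "(fst z, snd z) \<in> C" by simp
        then obtain t where t: "?U (\<phi> t (fst z)) < a" "a < ?U (\<phi> t (snd z))"
          using C_iff z by blast
        \<comment> \<open>Monotonicity decides by the sign of \<open>t\<close>: for
          \<open>t \<le> 0\<close> the first point was already below the level and has to be so at
          time 0, and for \<open>t > 0\<close> the second point starts below the level and cannot
          rise above it.\<close>
        show False
          using total_orbit_integral_antimono[OF z(1), of t 0]
            total_orbit_integral_antimono[OF z(2), of 0 t] t PQ
          by (cases "t \<le> 0") (auto simp: P_def Q_def flow_zero)
      qed
    qed
    then show ?thesis using AE_pair_rectangle[of Q P] by auto
  qed
  then show ?thesis unfolding P_def Q_def by auto
qed

text \<open>If orbit integrals were bounded, \<open>?U\<close> would be finite and could not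
  decrease over one unit of time. The decrease is the orbit integral over that unit, which would
  then vanish almost everywhere and make the space integral 0.\<close>

lemma orbit_integral_at_top:
  assumes erg: ergodic and erg2: doubly_ergodic
    and int: "integrable N f" and pos: "(\<integral>x. f x \<partial>N) > 0"
  shows "AE x in N. filterlim (\<lambda>T. orbit_integral f 0 T x) at_top at_top"
proof -
  let ?U = "total_orbit_integral f"
  have "\<not> (AE x in N. \<exists>C. \<forall>T\<ge>0. orbit_integral f 0 T x \<le> C)"
  proof
    assume bdd: "AE x in N. \<exists>C. \<forall>T\<ge>0. orbit_integral f 0 T x \<le> C"
    \<comment> \<open>Constancy of \<open>?U\<close> is used in this form: no rational level
      separates its values at \<open>x\<close> and at \<open>\<phi> 1 x\<close>. Of the two
      alternatives at a level, one is applied at \<open>x\<close> and the other is carried to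
      \<open>\<phi> 1 x\<close>.\<close>
    have "AE x in N. \<forall>q::rat. \<not> (?U (\<phi> 1 x) < ennreal (of_rat q) \<and> ennreal (of_rat q) < ?U x)"
    proof (subst AE_all_countable, intro allI)
      fix q :: rat
      show "AE x in N. \<not> (?U (\<phi> 1 x) < ennreal (of_rat q) \<and> ennreal (of_rat q) < ?U x)"
        using total_orbit_integral_level[OF erg2, of "ennreal (of_rat q)"]
      proof
        assume "AE x in N. \<not> ?U x < ennreal (of_rat q)"
        from AE_flow[OF this, of 1] show ?thesis by eventually_elim simp
      next
        assume "AE x in N. \<not> ennreal (of_rat q) < ?U x"
        then show ?thesis by eventually_elim simp
      qed
    qed
    with bdd have "AE x in N. orbit_integral f 0 1 x = 0"
    proof (rule AE_mp[OF _ AE_mp], intro AE_I2 impI)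
      fix x assume x: "x \<in> space N" and "\<exists>C. \<forall>T\<ge>0. orbit_integral f 0 T x \<le> C"
        and q: "\<forall>q::rat. \<not> (?U (\<phi> 1 x) < ennreal (of_rat q) \<and> ennreal (of_rat q) < ?U x)"
      then have "?U x < \<infinity>" using total_orbit_integral_finite[OF x] by blast
      moreover have "?U x \<le> ?U (\<phi> 1 x)"
      proof (rule ccontr)
        assume "\<not> ?U x \<le> ?U (\<phi> 1 x)"
        then have "?U (\<phi> 1 x) < ?U x" by simp
        from ennreal_rat_dense[OF this] q show False by blast
      qed
      ultimately show "orbit_integral f 0 1 x = 0"
        using total_orbit_integral_flow[OF x, of 1] orbit_integral_nonneg[of 0 1 x]
        by (cases "?U x"; cases "?U (\<phi> 1 x)") (auto simp: ennreal_plus[symmetric] simp del: ennreal_plus)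
    qed
    then have "(\<integral>x. orbit_integral f 0 1 x \<partial>N) = 0" by (rule integral_eq_zero_AE)
    then show False using integral_orbit_integral[OF f int] pos by simp
  qed
  then have "AE x in N. \<forall>m::nat. \<exists>n::nat. real m < orbit_integral f 0 (real n) x"
    using orbit_integral_dichotomy[OF erg f abs_bounded] by blast
  then show ?thesis
  proof (rule AE_mp, intro AE_I2 impI)
    fix x assume x: "x \<in> space N" and *: "\<forall>m::nat. \<exists>n::nat. real m < orbit_integral f 0 (real n) x"
    show "filterlim (\<lambda>T. orbit_integral f 0 T x) at_top at_top"
      unfolding filterlim_at_top
    proof
      fix Z :: real
      obtain m :: nat where m: "real m \<ge> Z" using real_arch_simple by blast
      obtain n :: nat where n: "real m < orbit_integral f 0 (real n) x" using * by blast
      have "Z \<le> orbit_integral f 0 T x" if "T \<ge> real n" for T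
        using orbit_integral_mono[OF x, of "real n" T] that n m by simp
      then show "\<forall>\<^sub>F T in at_top. Z \<le> orbit_integral f 0 T x"
        unfolding eventually_at_top_linorder by blast
    qed
  qed
qed

end

section \<open>The ratio ergodic theorem\<close>

lemma orbit_integral_linear:
  assumes "observable f" "\<And>x. \<bar>f x\<bar> \<le> c" "observable h" "\<And>x. \<bar>h x\<bar> \<le> d" "x \<in> space N"
  shows "orbit_integral (\<lambda>x. p * f x + q * h x) a b x = p * orbit_integral f a b x + q * orbit_integral h a b x"
  using orbit_set_integrable[OF assms(1,2,5)] orbit_set_integrable[OF assms(3,4,5)]
  unfolding orbit_integral_def by simp

text \<open>For \<open>q\<close> above the limit, \<open>f - q h\<close> has negative integral, so
  its orbit integrals stay below some \<open>C\<close>; division by the diverging integral of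
  \<open>h\<close> bounds the ratio by \<open>q\<close> in the limit. Values of \<open>q\<close>
  below the limit are treated with the signs reversed. Rational \<open>q\<close> keep the number of
  exceptional null sets countable.\<close>

theorem hopf_ratio_ergodic:
  assumes erg: ergodic and erg2: doubly_ergodic
    and f: "observable f" "integrable N f" "\<And>x. \<bar>f x\<bar> \<le> c"
    and h: "observable h" "integrable N h" "\<And>x. 0 \<le> h x" "\<And>x. h x \<le> d"
    and pos: "(\<integral>x. h x \<partial>N) > 0"
  shows "AE x in N. ((\<lambda>T. orbit_integral f 0 T x / orbit_integral h 0 T x) \<longlongrightarrow>
    (\<integral>x. f x \<partial>N) / (\<integral>x. h x \<partial>N)) at_top"
proof -
  let ?\<rho> = "(\<integral>x. f x \<partial>N) / (\<integral>x. h x \<partial>N)"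
  have d: "\<bar>h x\<bar> \<le> d" for x using h(3,4)[of x] by simp
  have bound: "AE x in N. \<exists>C. \<forall>T\<ge>0. p * orbit_integral f 0 T x + q * orbit_integral h 0 T x \<le> C"
    if neg: "p * (\<integral>x. f x \<partial>N) + q * (\<integral>x. h x \<partial>N) < 0" for p q
  proof -
    have "\<bar>p * f x + q * h x\<bar> \<le> \<bar>p\<bar> * c + \<bar>q\<bar> * d" for x
    proof -
      have "\<bar>p * f x + q * h x\<bar> \<le> \<bar>p\<bar> * \<bar>f x\<bar> + \<bar>q\<bar> * \<bar>h x\<bar>"
        by (metis abs_mult abs_triangle_ineq)
      also have "\<dots> \<le> \<bar>p\<bar> * c + \<bar>q\<bar> * d" using f(3) d by (intro add_mono mult_left_mono) auto
      finally show ?thesis .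
    qed
    moreover have "(\<integral>x. p * f x + q * h x \<partial>N) < 0" using neg f(2) h(2) by simp
    ultimately have "AE x in N. \<exists>C. \<forall>T\<ge>0. orbit_integral (\<lambda>x. p * f x + q * h x) 0 T x \<le> C"
      using f(2) h(2)
      by (intro orbit_integral_bdd_above[OF erg observable_linear[OF f(1) h(1)]]) auto
    then show ?thesis
      by (rule AE_mp) (auto intro!: AE_I2 simp: orbit_integral_linear[OF f(1,3) h(1) d])
  qed
  have "AE x in N. \<forall>q::rat. of_rat q > ?\<rho> \<longrightarrow>
      (\<exists>C. \<forall>T\<ge>0. orbit_integral f 0 T x - of_rat q * orbit_integral h 0 T x \<le> C)"
  proof (subst AE_all_countable, intro allI)
    fix q :: rat
    show "AE x in N. of_rat q > ?\<rho> \<longrightarrow>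
        (\<exists>C. \<forall>T\<ge>0. orbit_integral f 0 T x - of_rat q * orbit_integral h 0 T x \<le> C)"
      using bound[of 1 "- of_rat q"] pos by (cases "of_rat q > ?\<rho>") (auto simp: field_simps)
  qed
  moreover have "AE x in N. \<forall>q::rat. of_rat q < ?\<rho> \<longrightarrow>
      (\<exists>C. \<forall>T\<ge>0. of_rat q * orbit_integral h 0 T x - orbit_integral f 0 T x \<le> C)"
  proof (subst AE_all_countable, intro allI)
    fix q :: rat
    show "AE x in N. of_rat q < ?\<rho> \<longrightarrow>
        (\<exists>C. \<forall>T\<ge>0. of_rat q * orbit_integral h 0 T x - orbit_integral f 0 T x \<le> C)"
      using bound[of "- 1" "of_rat q"] pos by (cases "of_rat q < ?\<rho>") (auto simp: field_simps)
  qed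
  moreover note orbit_integral_at_top[OF h(1,3,4) erg erg2 h(2) pos]
  ultimately show ?thesis
  proof eventually_elim
    case (elim x)
    let ?F = "\<lambda>T. orbit_integral f 0 T x" and ?H = "\<lambda>T. orbit_integral h 0 T x"
    have small: "((\<lambda>T. C / ?H T) \<longlongrightarrow> 0) at_top" for C
      by (rule tendsto_divide_0[OF tendsto_const]) (use elim in \<open>auto intro: filterlim_at_top_imp_at_infinity\<close>)
    have H: "\<forall>\<^sub>F T in at_top. ?H T > 0" using elim by (auto simp: filterlim_at_top_dense)
    show ?case
    proof (rule order_tendstoI)
      fix a assume "?\<rho> < a"
      then obtain q where q: "?\<rho> < of_rat q" "of_rat q < a" using of_rat_dense by blast
      with elim obtain C where C: "\<And>T. T \<ge> 0 \<Longrightarrow> ?F T - of_rat q * ?H T \<le> C" by blast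
      have "\<forall>\<^sub>F T in at_top. C / ?H T < a - of_rat q"
        using small[of C] q by (intro order_tendstoD) auto
      with H eventually_ge_at_top[of 0] show "\<forall>\<^sub>F T in at_top. ?F T / ?H T < a"
      proof eventually_elim
        case (elim T)
        then have "?F T < a * ?H T" using C[of T] by (simp add: field_simps)
        then show ?case using elim by (simp add: field_simps)
      qed
    next
      fix a assume "a < ?\<rho>"
      then obtain q where q: "a < of_rat q" "of_rat q < ?\<rho>" using of_rat_dense by blast
      with elim obtain C where C: "\<And>T. T \<ge> 0 \<Longrightarrow> of_rat q * ?H T - ?F T \<le> C" by blast
      have "\<forall>\<^sub>F T in at_top. C / ?H T < of_rat q - a"
        using small[of C] q by (intro order_tendstoD) auto
      with H eventually_ge_at_top[of 0] show "\<forall>\<^sub>F T in at_top. a < ?F T / ?H T"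
      proof eventually_elim
        case (elim T)
        then have "a * ?H T < ?F T" using C[of T] by (simp add: field_simps)
        then show ?case using elim by (simp add: field_simps)
      qed
    qed
  qed
qed

end

section \<open>Partial flows of infinite ergodic index\<close>

lemma sigma_finite_completion:
  assumes "sigma_finite_measure M"
  shows "sigma_finite_measure (completion M)"
proof -
  interpret sigma_finite_measure M by fact
  obtain A where "countable A" "A \<subseteq> sets M" "\<Union>A = space M" "\<And>a. a \<in> A \<Longrightarrow> emeasure M a \<noteq> \<infinity>"
    using sigma_finite_countable by blast
  then show ?thesis by unfold_locales (intro exI[of _ A], auto)
qed

text \<open>\<open>F\<close> is the pointwise limit of functions that depend on time only through a
  grid point to the right of \<open>t\<close>; each of these is measurable, being pieced together
  from countably many functions of the state.\<close>

lemma borel_measurable_right_continuous: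
  fixes F :: "real \<Rightarrow> 'a \<Rightarrow> 'b::metric_space"
  assumes meas: "\<And>t. F t \<in> borel_measurable N"
    and right: "\<And>t x. x \<in> space N \<Longrightarrow> ((\<lambda>r. F r x) \<longlongrightarrow> F t x) (at_right t)"
  shows "(\<lambda>(t, x). F t x) \<in> borel_measurable (lborel \<Otimes>\<^sub>M N)"
proof -
  \<comment> \<open>Adding 1 after rounding down puts the grid point strictly to the right of
    \<open>t\<close>, as the filter \<open>at_right t\<close> demands, and at distance at most
    \<open>1 / real (Suc n)\<close>.\<close>
  define r :: "nat \<Rightarrow> real \<Rightarrow> real" where "r n t = (of_int \<lfloor>real (Suc n) * t\<rfloor> + 1) / real (Suc n)" for n t
  show ?thesis
  proof (rule borel_measurable_LIMSEQ_metric)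
    fix n :: nat
    have "(\<lambda>z. F ((of_int \<lfloor>real (Suc n) * fst z\<rfloor> + 1) / real (Suc n)) (snd z)) \<in> borel_measurable (lborel \<Otimes>\<^sub>M N)"
    proof (rule measurable_compose_countable[where f="\<lambda>i z. F ((of_int i + 1) / real (Suc n)) (snd z)"
          and g="\<lambda>z. \<lfloor>real (Suc n) * fst z\<rfloor>"])
      show "(\<lambda>z. F ((of_int i + 1) / real (Suc n)) (snd z)) \<in> borel_measurable (lborel \<Otimes>\<^sub>M N)" for i :: int
        by (rule measurable_compose[OF measurable_snd meas])
      have "(\<lambda>z. real (Suc n) * fst z) \<in> borel_measurable (lborel \<Otimes>\<^sub>M N)" by measurable
      then show "(\<lambda>z. \<lfloor>real (Suc n) * fst z\<rfloor>) \<in> lborel \<Otimes>\<^sub>M N \<rightarrow>\<^sub>M count_space UNIV"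
        by (rule measurable_compose) measurable
    qed
    then show "(\<lambda>z :: real \<times> 'a. F (r n (fst z)) (snd z)) \<in> borel_measurable (lborel \<Otimes>\<^sub>M N)"
      by (simp add: r_def)
  next
    fix z :: "real \<times> 'a" assume z: "z \<in> space (lborel \<Otimes>\<^sub>M N)"
    have "filterlim (\<lambda>n. r n t) (at_right t) sequentially" for t
    proof (rule tendsto_imp_filterlim_at_right)
      have gt: "t < r n t" and le: "r n t \<le> t + 1 / real (Suc n)" for n
      proof -
        have "real (Suc n) * t < of_int \<lfloor>real (Suc n) * t\<rfloor> + 1" "of_int \<lfloor>real (Suc n) * t\<rfloor> \<le> real (Suc n) * t"
          by linarith+
        then show "t < r n t" "r n t \<le> t + 1 / real (Suc n)"
          by (simp_all add: r_def field_simps del: of_nat_Suc)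
      qed
      show "\<forall>\<^sub>F n in sequentially. t < r n t" using gt by simp
      have "(\<lambda>n. t + 1 / real (Suc n)) \<longlonglongrightarrow> t + 0"
        by (intro tendsto_intros LIMSEQ_Suc[OF lim_1_over_n])
      then show "(\<lambda>n. r n t) \<longlonglongrightarrow> t"
        by (intro tendsto_sandwich[of "\<lambda>_. t" "\<lambda>n. r n t" sequentially "\<lambda>n. t + 1 / real (Suc n)"])
           (use gt le in \<open>auto intro!: always_eventually less_imp_le\<close>)
    qed
    moreover have "snd z \<in> space N" using z by (auto simp: space_pair_measure)
    ultimately have "(\<lambda>n. F (r n (fst z)) (snd z)) \<longlonglongrightarrow> F (fst z) (snd z)"
      using filterlim_compose[OF right[of "snd z" "fst z"]] by blast
    then show "(\<lambda>n. F (r n (fst z)) (snd z)) \<longlonglongrightarrow> (case z of (t, x) \<Rightarrow> F t x)"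
      by (simp add: case_prod_beta)
  qed
qed

text \<open>The everywhere defined flow \<open>\<phi>\<close> agrees with the partial flow \<open>\<psi>\<close> on \<open>\<Omega>\<close>; only the completion of
  \<open>M\<close> makes \<open>\<phi>\<close> measurable, because \<open>preserves_measure\<close> speaks of images up to null sets.\<close>

locale almost_complete_flow = sigma_finite_measure M for M :: "'a measure" +
  fixes \<psi> :: "real \<Rightarrow> 'a \<Rightarrow> 'a option" and \<phi> :: "real \<Rightarrow> 'a \<Rightarrow> 'a" and \<Omega> :: "'a set"
  assumes zero: "x \<in> space M \<Longrightarrow> \<phi> 0 x = x"
    and add: "x \<in> space M \<Longrightarrow> \<phi> (t + r) x = \<phi> t (\<phi> r x)"
    and in_space: "x \<in> space M \<Longrightarrow> \<phi> t x \<in> space M"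
    and AE_complete: "AE x in M. x \<in> \<Omega>"
    and complete_Some: "x \<in> \<Omega> \<Longrightarrow> \<psi> t x = Some (\<phi> t x)"
    and complete_invariant: "x \<in> \<Omega> \<Longrightarrow> \<phi> t x \<in> \<Omega>"
    and complete_preimage: "x \<in> space M \<Longrightarrow> \<psi> t x = Some y \<Longrightarrow> y \<in> \<Omega> \<Longrightarrow> x \<in> \<Omega>"
    and preserves: "preserves_measure M \<psi>"
begin

text \<open>Translates images under the partial flow, in which the hypotheses are phrased, into
  preimages under the total one. \<open>complete_preimage\<close> excludes that an incomplete point
  is mapped to a complete one.\<close>

lemma flow_image_iff:
  assumes "x \<in> \<Omega>" "x \<in> space M" "B \<subseteq> space M"
  shows "x \<in> flow_image \<psi> t B \<longleftrightarrow> \<phi> (- t) x \<in> B"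
proof
  assume "x \<in> flow_image \<psi> t B"
  then obtain y where y: "y \<in> B" "\<psi> t y = Some x" by (auto simp: flow_image_def)
  then have "y \<in> \<Omega>" "y \<in> space M" using complete_preimage[of y t x] assms by auto
  then have "x = \<phi> t y" "\<phi> (- t) (\<phi> t y) = y"
    using complete_Some[of y t] y add[of y "- t" t] zero[of y] by auto
  then show "\<phi> (- t) x \<in> B" using y by simp
next
  assume B: "\<phi> (- t) x \<in> B"
  have "\<psi> t (\<phi> (- t) x) = Some (\<phi> t (\<phi> (- t) x))"
    using complete_Some[OF complete_invariant[OF assms(1)]] .
  moreover have "\<phi> t (\<phi> (- t) x) = x" using add[of x t "- t"] zero[of x] assms by simp
  ultimately show "x \<in> flow_image \<psi> t B" using B by (auto simp: flow_image_def)
qed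

text \<open>The preimage under \<open>\<phi> t\<close> agrees almost everywhere with the image under
  the partial flow at time \<open>- t\<close>, and inherits its measurability and measure in the
  completion.\<close>

lemma preimage:
  assumes B: "B \<in> sets M"
  shows "\<phi> t -` B \<inter> space M \<in> sets (completion M)"
    and "emeasure (completion M) (\<phi> t -` B \<inter> space M) = emeasure M B"
proof -
  let ?S = "flow_image \<psi> (- t) B"
  have S: "?S \<in> sets (completion M)" "emeasure (completion M) ?S = emeasure M B"
    using preserves B unfolding preserves_measure_def by blast+
  have "AE x in M. x \<in> ?S \<longleftrightarrow> x \<in> \<phi> t -` B \<inter> space M"
    using AE_complete AE_space
    by eventually_elim (use flow_image_iff[of _ B "- t"] sets.sets_into_space[OF B] in auto)
  then have ae: "AE x in completion M. x \<in> ?S \<longleftrightarrow> x \<in> \<phi> t -` B \<inter> space M" by (rule AE_completion)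
  show meas: "\<phi> t -` B \<inter> space M \<in> sets (completion M)"
    by (rule completion.in_sets_AE[OF ae S(1)]) auto
  show "emeasure (completion M) (\<phi> t -` B \<inter> space M) = emeasure M B"
    using emeasure_eq_AE[OF ae S(1) meas] S(2) by simp
qed

lemma measurable_completion_flow: "\<phi> t \<in> completion M \<rightarrow>\<^sub>M M"
  using preimage(1) in_space by (intro measurableI) auto

lemma distr_completion_flow: "distr (completion M) M (\<phi> t) = M"
  using preimage(2)[of _ t] measurable_completion_flow by (intro measure_eqI) (auto simp: emeasure_distr)

sublocale completed: measure_preserving_flow "completion M" \<phi>
proof (intro measure_preserving_flow.intro measure_preserving_flow_axioms.intro)
  show "sigma_finite_measure (completion M)"
    by (rule sigma_finite_completion) (rule sigma_finite_measure_axioms)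
  show "\<phi> t \<in> completion M \<rightarrow>\<^sub>M completion M" for t
    by (rule completion.measurable_completion2[OF measurable_completion_flow])
       (simp add: distr_completion_flow)
  show "distr (completion M) (completion M) (\<phi> t) = completion M" for t
    using completion.completion_distr_eq[OF measurable_completion_flow, of t] distr_completion_flow[of t] by simp
qed (simp_all add: zero add)

text \<open>\<open>ergodic_flow\<close> tests sets of \<open>M\<close>, whereas \<open>B\<close> is
  measurable only in the completion. Its main part differs from \<open>B\<close> by a null set, so
  exact invariance of \<open>B\<close> becomes the almost everywhere invariance that the hypothesis
  admits.\<close>

lemma completed_ergodic:
  assumes erg: "ergodic_flow M \<psi>"
  shows completed.ergodic
  unfolding completed.ergodic_def
proof (intro ballI impI)
  fix B assume B: "B \<in> sets (completion M)"
    and inv: "\<forall>t. \<forall>x\<in>space (completion M). (\<phi> t x \<in> B) = (x \<in> B)"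
  let ?B = "main_part M B"
  have ae: "AE x in completion M. x \<in> ?B \<longleftrightarrow> x \<in> B"
    by (rule AE_completion[OF AE_in_main_part[OF B]])
  have B0: "?B \<in> sets M" using B by simp
  have "sym_diff (flow_image \<psi> t ?B) ?B \<in> null_sets (completion M)" for t
    unfolding completion.null_sets_iff_AE
  proof
    show "AE x in completion M. x \<notin> sym_diff (flow_image \<psi> t ?B) ?B"
      using ae completed.AE_flow[OF ae, of "- t"] AE_completion[OF AE_complete] AE_space
    proof eventually_elim
      case (elim x)
      then have "x \<in> flow_image \<psi> t ?B \<longleftrightarrow> x \<in> ?B"
        using flow_image_iff[of x ?B t] sets.sets_into_space[OF B0] inv by auto
      then show ?case by auto
    qed
    have "flow_image \<psi> t ?B \<in> sets (completion M)"
      using preserves B0 unfolding preserves_measure_def by blast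
    then show "sym_diff (flow_image \<psi> t ?B) ?B \<subseteq> space (completion M)"
      using sets.sets_into_space[of _ "completion M"] sets.sets_into_space[OF B0] by auto
  qed
  then have "emeasure M ?B = 0 \<or> emeasure M (space M - ?B) = 0"
    using erg B0 unfolding ergodic_flow_def by blast
  then have "(AE x in completion M. x \<notin> ?B) \<or> (AE x in completion M. x \<in> ?B)"
  proof
    assume "emeasure M ?B = 0"
    then have "?B \<in> null_sets M" using B0 by auto
    then show ?thesis using AE_completion[OF AE_not_in] by blast
  next
    assume "emeasure M (space M - ?B) = 0"
    then have "space M - ?B \<in> null_sets M" using B0 by auto
    from AE_completion[OF AE_not_in[OF this]] AE_space
    have "AE x in completion M. x \<in> ?B" by eventually_elim auto
    then show ?thesis by blast
  qed
  then show "(AE x in completion M. x \<notin> B) \<or> (AE x in completion M. x \<in> B)"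
  proof
    assume "AE x in completion M. x \<notin> ?B"
    with ae have "AE x in completion M. x \<notin> B" by eventually_elim auto
    then show ?thesis ..
  next
    assume "AE x in completion M. x \<in> ?B"
    with ae have "AE x in completion M. x \<in> B" by eventually_elim auto
    then show ?thesis ..
  qed
qed

end

section \<open>Powers of a flow of infinite ergodic index\<close>

lemma prod_lessThan_add: "(\<Prod>k<m + n. f k) = (\<Prod>k<m. f k) * (\<Prod>k<n. f (k + m :: nat))"
  by (induction n) (simp_all add: ac_simps)

text \<open>\<open>completeI\<close> asks for integer times only: the partial flow is defined almost
  everywhere at each single time, and countably many such statements can be combined.\<close>

locale infinitely_ergodic_flow = sigma_finite_measure m for m :: "'a measure" +
  fixes \<psi> :: "real \<Rightarrow> 'a \<Rightarrow> 'a option" and \<phi> :: "real \<Rightarrow> 'a \<Rightarrow> 'a" and \<Omega> :: "'a set"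
  assumes zero: "\<phi> 0 x = x"
    and add: "\<phi> (t + r) x = \<phi> t (\<phi> r x)"
    and in_space: "x \<in> space m \<Longrightarrow> \<phi> t x \<in> space m"
    and complete_Some: "x \<in> \<Omega> \<Longrightarrow> \<psi> t x = Some (\<phi> t x)"
    and complete_invariant: "x \<in> \<Omega> \<Longrightarrow> \<phi> t x \<in> \<Omega>"
    and complete_preimage: "\<psi> t x = Some y \<Longrightarrow> y \<in> \<Omega> \<Longrightarrow> x \<in> \<Omega>"
    and completeI: "(\<And>n::nat. \<psi> (real n) x \<noteq> None) \<Longrightarrow> (\<And>n::nat. \<psi> (- real n) x \<noteq> None) \<Longrightarrow> x \<in> \<Omega>"
    and index: "infinite_ergodic_index m \<psi>"
begin

sublocale product_sigma_finite "\<lambda>_::nat. m"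
  by (simp add: product_sigma_finite_def sigma_finite_measure_axioms)

abbreviation power_measure :: "nat \<Rightarrow> (nat \<Rightarrow> 'a) measure" where
  "power_measure K \<equiv> Pi\<^sub>M {..<K} (\<lambda>_. m)"

definition power_flow :: "nat \<Rightarrow> real \<Rightarrow> (nat \<Rightarrow> 'a) \<Rightarrow> nat \<Rightarrow> 'a" where
  "power_flow K t x = (\<lambda>k\<in>{..<K}. \<phi> t (x k))"

definition power_complete :: "nat \<Rightarrow> (nat \<Rightarrow> 'a) set" where
  "power_complete K = {x. \<forall>k<K. x k \<in> \<Omega>}"

lemma product_flow_complete:
  assumes "x \<in> power_complete K"
  shows "product_flow K \<psi> t x = Some (power_flow K t x)"
  using assms complete_Some by (auto simp: product_flow_def power_complete_def power_flow_def intro!: restrict_ext)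

lemma almost_complete_flow_power:
  assumes K: "K \<ge> 1"
  shows "almost_complete_flow (power_measure K) (product_flow K \<psi>) (power_flow K) (power_complete K)"
proof (intro almost_complete_flow.intro almost_complete_flow_axioms.intro)
  show "sigma_finite_measure (power_measure K)" by (rule sigma_finite) simp
  show pres: "preserves_measure (power_measure K) (product_flow K \<psi>)"
    using index K unfolding infinite_ergodic_index_def ergodic_flow_def by blast
  fix x t r assume x: "x \<in> space (power_measure K)"
  then have ext: "x \<in> extensional {..<K}" by (auto simp: space_PiM PiE_def)
  show "power_flow K 0 x = x"
    using ext by (auto simp: power_flow_def zero restrict_def extensional_def)
  show "power_flow K (t + r) x = power_flow K t (power_flow K r x)"
    by (auto simp: power_flow_def add restrict_def)
  show "power_flow K t x \<in> space (power_measure K)"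
    using x in_space by (auto simp: power_flow_def space_PiM PiE_def)
next
  have pres: "AE x in power_measure K. product_flow K \<psi> t x \<noteq> None" for t
    using index K unfolding infinite_ergodic_index_def ergodic_flow_def preserves_measure_def by blast
  have "AE x in power_measure K. \<forall>n::nat. product_flow K \<psi> (real n) x \<noteq> None \<and> product_flow K \<psi> (- real n) x \<noteq> None"
    by (subst AE_all_countable) (use pres in auto)
  then show "AE x in power_measure K. x \<in> power_complete K"
  proof eventually_elim
    case (elim x)
    then have "\<psi> (real n) (x k) \<noteq> None" "\<psi> (- real n) (x k) \<noteq> None" if "k < K" for k and n :: nat
      using that by (auto simp: product_flow_def split: if_splits) (metis option.distinct(1))+
    then show ?case by (auto simp: power_complete_def intro!: completeI)
  qed
next
  fix x t assume x: "x \<in> power_complete K"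
  show "product_flow K \<psi> t x = Some (power_flow K t x)" by (rule product_flow_complete[OF x])
  show "power_flow K t x \<in> power_complete K"
    using x complete_invariant by (auto simp: power_complete_def power_flow_def)
next
  fix x t y assume "product_flow K \<psi> t x = Some y" "y \<in> power_complete K"
  then have "\<psi> t (x k) = Some (y k)" "y k \<in> \<Omega>" if "k < K" for k
    using that by (auto simp: product_flow_def power_complete_def split: if_splits)
  then have "x k \<in> \<Omega>" if "k < K" for k using complete_preimage[of t "x k" "y k"] that by blast
  then show "x \<in> power_complete K" by (auto simp: power_complete_def)
qed

lemma power_ergodic:
  assumes K: "K \<ge> 1"
  shows "measure_preserving_flow.ergodic (completion (power_measure K)) (power_flow K)"
  using almost_complete_flow.completed_ergodic[OF almost_complete_flow_power[OF K]] index K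
  unfolding infinite_ergodic_index_def by blast

section \<open>The 2K-fold power as a product of two K-fold powers\<close>

definition split_power :: "nat \<Rightarrow> (nat \<Rightarrow> 'a) \<Rightarrow> (nat \<Rightarrow> 'a) \<times> (nat \<Rightarrow> 'a)" where
  "split_power K z = ((\<lambda>k\<in>{..<K}. z k), (\<lambda>k\<in>{..<K}. z (k + K)))"

definition join_power :: "nat \<Rightarrow> (nat \<Rightarrow> 'a) \<times> (nat \<Rightarrow> 'a) \<Rightarrow> nat \<Rightarrow> 'a" where
  "join_power K w = (\<lambda>k\<in>{..<K + K}. if k < K then fst w k else snd w (k - K))"

lemma measurable_split_power [measurable]:
  "split_power K \<in> power_measure (K + K) \<rightarrow>\<^sub>M power_measure K \<Otimes>\<^sub>M power_measure K"
  unfolding split_power_def[abs_def]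
  by (intro measurable_Pair measurable_restrict measurable_component_singleton) auto

lemma measurable_join_power [measurable]:
  "join_power K \<in> power_measure K \<Otimes>\<^sub>M power_measure K \<rightarrow>\<^sub>M power_measure (K + K)"
  unfolding join_power_def[abs_def]
proof (intro measurable_restrict)
  fix k assume k: "k \<in> {..<K + K}"
  show "(\<lambda>w. if k < K then fst w k else snd w (k - K)) \<in> power_measure K \<Otimes>\<^sub>M power_measure K \<rightarrow>\<^sub>M m"
  proof (cases "k < K")
    case True
    have "(\<lambda>w. fst w k) \<in> power_measure K \<Otimes>\<^sub>M power_measure K \<rightarrow>\<^sub>M m"
      by (rule measurable_compose[OF measurable_fst measurable_component_singleton]) (use True in auto)
    then show ?thesis using True by simp
  next
    case False
    have "(\<lambda>w. snd w (k - K)) \<in> power_measure K \<Otimes>\<^sub>M power_measure K \<rightarrow>\<^sub>M m"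
      by (rule measurable_compose[OF measurable_snd measurable_component_singleton]) (use False k in auto)
    then show ?thesis using False by simp
  qed
qed

lemma sigma_finite_power: "sigma_finite_measure (power_measure K)"
  by (rule sigma_finite) simp

text \<open>A product measure is determined by its values on boxes, and the preimage of a box is a
  rectangle of two boxes.\<close>

lemma distr_join_power:
  "distr (power_measure K \<Otimes>\<^sub>M power_measure K) (power_measure (K + K)) (join_power K) = power_measure (K + K)"
proof (rule PiM_eqI)
  interpret K: sigma_finite_measure "power_measure K" by (rule sigma_finite_power)
  fix A :: "nat \<Rightarrow> 'a set" assume A: "\<And>i. i \<in> {..<K + K} \<Longrightarrow> A i \<in> sets m"
  have box: "Pi\<^sub>E {..<K} A \<in> sets (power_measure K)" "Pi\<^sub>E {..<K} (\<lambda>k. A (k + K)) \<in> sets (power_measure K)"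
    using A by (auto intro!: sets_PiM_I_finite)
  have "join_power K -` Pi\<^sub>E {..<K + K} A \<inter> space (power_measure K \<Otimes>\<^sub>M power_measure K) =
      Pi\<^sub>E {..<K} A \<times> Pi\<^sub>E {..<K} (\<lambda>k. A (k + K))" (is "?L = ?R")
  proof (intro equalityI subsetI)
    fix w assume w: "w \<in> ?L"
    then have ext: "fst w \<in> extensional {..<K}" "snd w \<in> extensional {..<K}"
      by (auto simp: space_pair_measure space_PiM PiE_def)
    have mem: "join_power K w k \<in> A k" if "k < K + K" for k using w that by (auto simp: PiE_def)
    have "fst w k \<in> A k" "snd w k \<in> A (k + K)" if "k < K" for k
      using mem[of k] mem[of "k + K"] that by (auto simp: join_power_def)
    then show "w \<in> ?R" using ext by (auto simp: mem_Times_iff PiE_def)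
  next
    fix w assume w: "w \<in> ?R"
    then have "w \<in> space (power_measure K \<Otimes>\<^sub>M power_measure K)"
      using box[THEN sets.sets_into_space] by (auto simp: space_pair_measure)
    moreover have "join_power K w k \<in> A k" if "k < K + K" for k
    proof (cases "k < K")
      case False
      then have "k - K < K" "k - K + K = k" using that by auto
      then have "snd w (k - K) \<in> A (k - K + K)" using w Pi_mem[of "snd w" "{..<K}" "\<lambda>k. A (k + K)" "k - K"] by (auto simp: mem_Times_iff PiE_def)
      then have "snd w (k - K) \<in> A k" using \<open>k - K + K = k\<close> by simp
      then show ?thesis using False that by (simp add: join_power_def)
    next
      case True
      then have "fst w k \<in> A k" using w by (auto simp: mem_Times_iff)
      then show ?thesis using True that by (simp add: join_power_def)
    qed
    moreover have "join_power K w \<in> extensional {..<K + K}" by (simp add: join_power_def)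
    ultimately show "w \<in> ?L" by (auto simp: PiE_def)
  qed
  then have "emeasure (distr (power_measure K \<Otimes>\<^sub>M power_measure K) (power_measure (K + K)) (join_power K)) (Pi\<^sub>E {..<K + K} A) =
      emeasure (power_measure K) (Pi\<^sub>E {..<K} A) * emeasure (power_measure K) (Pi\<^sub>E {..<K} (\<lambda>k. A (k + K)))"
    using A box by (subst emeasure_distr) (auto simp: K.emeasure_pair_measure_Times intro!: sets_PiM_I_finite)
  also have "\<dots> = (\<Prod>k<K. emeasure m (A k)) * (\<Prod>k<K. emeasure m (A (k + K)))"
    using A by (intro arg_cong2[where f="(*)"] emeasure_PiM) auto
  also have "\<dots> = (\<Prod>k<K + K. emeasure m (A k))" by (simp only: prod_lessThan_add)
  finally show "emeasure (distr (power_measure K \<Otimes>\<^sub>M power_measure K) (power_measure (K + K)) (join_power K)) (Pi\<^sub>E {..<K + K} A) =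
      (\<Prod>k\<in>{..<K + K}. emeasure m (A k))" .
qed auto

text \<open>Follows from \<open>distr_join_power\<close>, since splitting undoes joining.\<close>

lemma distr_split_power:
  "distr (power_measure (K + K)) (power_measure K \<Otimes>\<^sub>M power_measure K) (split_power K) = power_measure K \<Otimes>\<^sub>M power_measure K"
proof -
  let ?P = "power_measure K \<Otimes>\<^sub>M power_measure K"
  have "distr (power_measure (K + K)) ?P (split_power K) = distr ?P ?P (split_power K \<circ> join_power K)"
    by (subst distr_join_power[symmetric]) (simp add: distr_distr)
  also have "\<dots> = distr ?P ?P (\<lambda>w. w)"
  proof (rule distr_cong)
    fix w assume "w \<in> space ?P"
    then have ext: "fst w \<in> extensional {..<K}" "snd w \<in> extensional {..<K}"
      by (auto simp: space_pair_measure space_PiM PiE_def)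
    then have "(\<lambda>k\<in>{..<K}. join_power K w k) = fst w" "(\<lambda>k\<in>{..<K}. join_power K w (k + K)) = snd w"
      by (auto simp: join_power_def restrict_def extensional_def fun_eq_iff)
    then show "(split_power K \<circ> join_power K) w = w" by (simp add: split_power_def prod_eq_iff)
  qed auto
  finally show ?thesis by (simp add: distr_id)
qed

lemma split_power_null:
  assumes Z: "Z \<in> null_sets (power_measure K)"
  shows "AE z in power_measure (K + K). fst (split_power K z) \<notin> Z \<and> snd (split_power K z) \<notin> Z"
proof (rule AE_distrD[OF measurable_split_power], unfold distr_split_power)
  interpret K: sigma_finite_measure "power_measure K" by (rule sigma_finite_power)
  let ?P = "power_measure K \<Otimes>\<^sub>M power_measure K"
  let ?S = "space (power_measure K)"
  have "Z \<times> ?S \<in> null_sets ?P" "?S \<times> Z \<in> null_sets ?P"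
    using Z by (auto simp: null_sets_def K.emeasure_pair_measure_Times)
  from AE_not_in[OF this(1)] AE_not_in[OF this(2)] AE_space
  show "AE w in ?P. fst w \<notin> Z \<and> snd w \<notin> Z"
    by eventually_elim (auto simp: space_pair_measure)
qed

lemma split_power_AE:
  assumes "AE x in power_measure K. Q x"
  shows "AE z in power_measure (K + K). Q (fst (split_power K z)) \<and> Q (snd (split_power K z))"
proof -
  obtain Z where Z: "{x\<in>space (power_measure K). \<not> Q x} \<subseteq> Z" "Z \<in> null_sets (power_measure K)"
    using AE_E[OF assms] by (metis (no_types, lifting) null_setsI)
  have "split_power K z \<in> space (power_measure K \<Otimes>\<^sub>M power_measure K)" if "z \<in> space (power_measure (K + K))" for z
    using measurable_space[OF measurable_split_power that] .
  with split_power_null[OF Z(2)] AE_space show ?thesis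
    by (elim AE_mp, elim AE_mp, intro AE_I2 impI) (use Z(1) in \<open>fastforce simp: space_pair_measure mem_Times_iff\<close>)
qed

text \<open>The target carries the product of the completions, which has more measurable sets than
  the product of the powers. The extra sets are harmless because each half of the splitting pulls
  null sets back to null sets.\<close>

lemma measurable_split_power_completion:
  "split_power K \<in> completion (power_measure (K + K)) \<rightarrow>\<^sub>M completion (power_measure K) \<Otimes>\<^sub>M completion (power_measure K)"
proof -
  let ?P = "power_measure K" and ?P2 = "power_measure (K + K)"
  have [measurable]: "(\<lambda>z. fst (split_power K z)) \<in> ?P2 \<rightarrow>\<^sub>M ?P" "(\<lambda>z. snd (split_power K z)) \<in> ?P2 \<rightarrow>\<^sub>M ?P"
    by measurable
  have null: "null_sets ?P \<subseteq> null_sets (distr (completion ?P2) ?P q)"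
    if q: "q \<in> ?P2 \<rightarrow>\<^sub>M ?P" and "\<And>Z. Z \<in> null_sets ?P \<Longrightarrow> AE z in ?P2. q z \<notin> Z" for q
  proof
    fix Z assume Z: "Z \<in> null_sets ?P"
    then have "q -` Z \<inter> space ?P2 \<in> null_sets ?P2"
      using that(2)[OF Z] q by (subst AE_iff_null_sets) (auto intro: measurable_sets)
    then show "Z \<in> null_sets (distr (completion ?P2) ?P q)"
      using Z q by (auto simp: distr_completion null_sets_def emeasure_distr)
  qed
  have "(\<lambda>z. fst (split_power K z)) \<in> completion ?P2 \<rightarrow>\<^sub>M completion ?P"
    by (intro completion.measurable_completion2 measurable_completion null)
       (auto dest: split_power_null)
  moreover have "(\<lambda>z. snd (split_power K z)) \<in> completion ?P2 \<rightarrow>\<^sub>M completion ?P"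
    by (intro completion.measurable_completion2 measurable_completion null)
       (auto dest: split_power_null)
  ultimately show ?thesis by (simp add: measurable_pair_iff comp_def)
qed

text \<open>It suffices to compare rectangles. Replacing the sides by their main parts changes the
  preimage by a null set only and reduces the claim to \<open>distr_split_power\<close>.\<close>

lemma distr_split_power_completion:
  "distr (completion (power_measure (K + K))) (completion (power_measure K) \<Otimes>\<^sub>M completion (power_measure K)) (split_power K) =
    completion (power_measure K) \<Otimes>\<^sub>M completion (power_measure K)"
proof (rule sym, rule pair_measure_eqI)
  let ?P = "power_measure K" and ?P2 = "power_measure (K + K)"
  interpret K: sigma_finite_measure ?P by (rule sigma_finite_power)
  show "sigma_finite_measure (completion ?P)" "sigma_finite_measure (completion ?P)"
    by (intro sigma_finite_completion sigma_finite_power)+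
  fix A B assume A: "A \<in> sets (completion ?P)" and B: "B \<in> sets (completion ?P)"
  let ?A = "main_part ?P A" and ?B = "main_part ?P B"
  have "emeasure (distr (completion ?P2) (completion ?P \<Otimes>\<^sub>M completion ?P) (split_power K)) (A \<times> B) =
      emeasure (completion ?P2) (split_power K -` (A \<times> B) \<inter> space (completion ?P2))"
    using A B by (intro emeasure_distr measurable_split_power_completion) auto
  also have "\<dots> = emeasure (completion ?P2) (split_power K -` (?A \<times> ?B) \<inter> space (completion ?P2))"
  proof (rule emeasure_eq_AE)
    show "AE z in completion ?P2. z \<in> split_power K -` (A \<times> B) \<inter> space (completion ?P2) \<longleftrightarrow>
        z \<in> split_power K -` (?A \<times> ?B) \<inter> space (completion ?P2)"
      using split_power_AE[OF AE_in_main_part[OF A], THEN AE_completion] split_power_AE[OF AE_in_main_part[OF B], THEN AE_completion]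
      by eventually_elim (auto simp: mem_Times_iff)
  qed (use A B in \<open>intro measurable_sets[OF measurable_split_power_completion] pair_measureI; simp\<close>)+
  also have "\<dots> = emeasure ?P2 (split_power K -` (?A \<times> ?B) \<inter> space ?P2)"
    using A B measurable_sets[OF measurable_split_power, of "?A \<times> ?B" K] by simp
  also have "\<dots> = emeasure (distr ?P2 (?P \<Otimes>\<^sub>M ?P) (split_power K)) (?A \<times> ?B)"
    using A B by (subst emeasure_distr) auto
  also have "\<dots> = emeasure ?P ?A * emeasure ?P ?B"
    using A B by (simp add: distr_split_power K.emeasure_pair_measure_Times)
  finally show "emeasure (completion ?P) A * emeasure (completion ?P) B =
      emeasure (distr (completion ?P2) (completion ?P \<Otimes>\<^sub>M completion ?P) (split_power K)) (A \<times> B)"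
    using A B by (simp only: emeasure_completion)
qed simp

text \<open>Splitting intertwines the flow of 2K particles with the diagonal flow on pairs, so an
  invariant set of pairs pulls back to an exactly invariant set, to which ergodicity of the 2K-fold
  power applies.\<close>

lemma power_doubly_ergodic:
  assumes K: "K \<ge> 1"
  shows "measure_preserving_flow.doubly_ergodic (completion (power_measure K)) (power_flow K)"
proof -
  let ?P = "power_measure K" and ?P2 = "power_measure (K + K)"
  interpret P: almost_complete_flow ?P "product_flow K \<psi>" "power_flow K" "power_complete K"
    by (rule almost_complete_flow_power[OF K])
  interpret P2: almost_complete_flow ?P2 "product_flow (K + K) \<psi>" "power_flow (K + K)" "power_complete (K + K)"
    by (rule almost_complete_flow_power) (use K in simp)
  show ?thesis
    unfolding P.completed.doubly_ergodic_def
  proof (intro ballI impI)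
    fix C assume C: "C \<in> sets (completion ?P \<Otimes>\<^sub>M completion ?P)"
      and inv: "\<forall>t. \<forall>x\<in>space (completion ?P). \<forall>y\<in>space (completion ?P).
        (power_flow K t x, power_flow K t y) \<in> C \<longleftrightarrow> (x, y) \<in> C"
    let ?D = "split_power K -` C \<inter> space (completion ?P2)"
    have D: "?D \<in> sets (completion ?P2)"
      by (rule measurable_sets[OF measurable_split_power_completion C])
    have inv_D: "power_flow (K + K) t z \<in> ?D \<longleftrightarrow> z \<in> ?D" if z: "z \<in> space (completion ?P2)" for t z
    proof -
      have "split_power K (power_flow (K + K) t z) =
          (power_flow K t (fst (split_power K z)), power_flow K t (snd (split_power K z)))"
        by (auto simp: split_power_def power_flow_def restrict_def fun_eq_iff)
      moreover have "split_power K z \<in> space (completion ?P \<Otimes>\<^sub>M completion ?P)"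
        using measurable_space[OF measurable_split_power_completion z] .
      ultimately show ?thesis
        using inv z P2.completed.flow_space[OF z, of t] by (auto simp: space_pair_measure mem_Times_iff)
    qed
    have erg: P2.completed.ergodic using power_ergodic[of "K + K"] K by simp
    have "\<forall>t. \<forall>z\<in>space (completion ?P2). power_flow (K + K) t z \<in> ?D \<longleftrightarrow> z \<in> ?D"
      using inv_D by blast
    then have "(AE z in completion ?P2. z \<notin> ?D) \<or> (AE z in completion ?P2. z \<in> ?D)"
      by (rule bspec[OF erg[unfolded P2.completed.ergodic_def] D, THEN mp])
    then consider "AE z in completion ?P2. z \<notin> ?D" | "AE z in completion ?P2. z \<in> ?D" ..
    then show "(AE w in completion ?P \<Otimes>\<^sub>M completion ?P. w \<notin> C) \<or> (AE w in completion ?P \<Otimes>\<^sub>M completion ?P. w \<in> C)"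
    proof cases
      case 1
      then have "AE z in completion ?P2. split_power K z \<notin> C"
        using AE_space by eventually_elim auto
      then have "AE w in distr (completion ?P2) (completion ?P \<Otimes>\<^sub>M completion ?P) (split_power K). w \<notin> C"
        using C by (subst AE_distr_iff[OF measurable_split_power_completion]) auto
      then have "AE w in completion ?P \<Otimes>\<^sub>M completion ?P. w \<notin> C"
        by (simp only: distr_split_power_completion)
      then show ?thesis ..
    next
      case 2
      then have "AE z in completion ?P2. split_power K z \<in> C"
        by eventually_elim auto
      then have "AE w in distr (completion ?P2) (completion ?P \<Otimes>\<^sub>M completion ?P) (split_power K). w \<in> C"
        using C by (subst AE_distr_iff[OF measurable_split_power_completion]) auto
      then have "AE w in completion ?P \<Otimes>\<^sub>M completion ?P. w \<in> C"
        by (simp only: distr_split_power_completion)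
      then show ?thesis ..
    qed
  qed
qed

end

section \<open>Billiard orbits\<close>

lemma closed_tree: "closed (tree s z)"
  unfolding tree_def dist_L1_def by (intro closed_Collect_le continuous_intros)

lemma interior_tree_superset: "dist_L1 w z < s / 2 \<Longrightarrow> w \<in> interior (tree s z)"
proof -
  have "open {w. dist_L1 w z < s / 2}"
    unfolding dist_L1_def by (intro open_Collect_less continuous_intros)
  then show "dist_L1 w z < s / 2 \<Longrightarrow> w \<in> interior (tree s z)"
    by (intro interiorI[of "{w. dist_L1 w z < s / 2}"]) (auto simp: tree_def)
qed

lemma frontier_tree_dist:
  assumes "p \<in> frontier (tree s z)"
  shows "dist_L1 p z = s / 2"
proof -
  have "p \<in> tree s z" "p \<notin> interior (tree s z)"
    using assms by (auto simp: frontier_def closure_closed[OF closed_tree])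
  then show ?thesis using interior_tree_superset[of p z s] by (force simp: tree_def)
qed

lemma closed_table: "closed (table s g)"
  unfolding table_def by (intro closed_Compl open_UN) auto

text \<open>Moving from \<open>p\<close> towards the centre \<open>z\<close> scales the distance to
  \<open>z\<close> by a factor below 1 and enters the tree at once. Free motion and reflection are
  therefore mutually exclusive at a point.\<close>

lemma frontier_tree_not_interior_table:
  assumes "s > 0" "z \<in> g" "p \<in> frontier (tree s z)"
  shows "p \<notin> interior (table s g)"
proof
  assume "p \<in> interior (table s g)"
  then obtain e where e: "e > 0" "ball p e \<subseteq> interior (table s g)"
    using openE[OF open_interior] by blast
  have d: "dist_L1 p z = s / 2" using frontier_tree_dist[OF assms(3)] .
  \<comment> \<open>The first bound keeps the scaling factor positive, the second keeps
    \<open>q\<close> within \<open>e\<close> of \<open>p\<close>; the added 1 keeps the denominator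
    positive.\<close>
  define \<delta> where "\<delta> = min (1/2) (e / (2 * (cmod (z - p) + 1)))"
  have \<delta>: "0 < \<delta>" "\<delta> < 1" using e by (auto simp: \<delta>_def intro!: divide_pos_pos add_nonneg_pos)
  define q where "q = p + \<delta> *\<^sub>R (z - p)"
  have "dist p q = \<delta> * cmod (z - p)" using \<delta> by (simp add: q_def dist_norm)
  also have "\<dots> \<le> e / (2 * (cmod (z - p) + 1)) * cmod (z - p)"
    by (intro mult_right_mono) (auto simp: \<delta>_def)
  also have "\<dots> < e" using e norm_ge_zero[of "z - p"]
    by (simp add: divide_simps) (smt (verit, best) mult_nonneg_nonneg mult_pos_pos distrib_left norm_ge_zero)
  finally have "q \<in> table s g" using e interior_subset[of "table s g"] by auto
  moreover have "dist_L1 q z = (1 - \<delta>) * dist_L1 p z"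
  proof -
    have "Re q - Re z = (1 - \<delta>) * (Re p - Re z)" "Im q - Im z = (1 - \<delta>) * (Im p - Im z)"
      by (simp_all add: q_def algebra_simps)
    then show ?thesis using \<delta> by (simp add: dist_L1_def abs_mult distrib_left)
  qed
  then have "dist_L1 q z < s / 2" using d \<delta> mult_pos_pos[OF \<delta>(1) assms(1)] by (simp add: left_diff_distrib)
  then have "q \<in> interior (tree s z)" by (rule interior_tree_superset)
  ultimately show False using assms(2) by (auto simp: table_def)
qed

text \<open>The corners are the boundary points on the two axes through the centre. Away from them
  both signs in \<open>outer_normal\<close> are nonzero, so that it is a unit vector.\<close>

lemma not_corner_components:
  assumes "dist_L1 p z = s / 2" "s > 0" "p \<notin> corners s z"
  shows "Re (p - z) \<noteq> 0" "Im (p - z) \<noteq> 0"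
  using assms by (auto simp: dist_L1_def corners_def complex_eq_iff abs_if split: if_splits)

lemma outer_normal_unit:
  assumes "Re (p - z) \<noteq> 0" "Im (p - z) \<noteq> 0"
  shows "outer_normal z p \<bullet> outer_normal z p = 1"
  using assms by (auto simp: outer_normal_def inner_complex_def sgn_if Re_divide_of_real Im_divide_of_real)

text \<open>Two trees can share a boundary point only along a common side, where their normals are
  opposite; the reflection does not see the sign.\<close>

lemma outer_normal_unique:
  assumes g: "g \<in> Conf s" and s: "s > 0" and "z \<in> g" "z' \<in> g"
    and z: "dist_L1 p z = s / 2" "p \<notin> corners s z" and z': "dist_L1 p z' = s / 2" "p \<notin> corners s z'"
  shows "outer_normal z' p = outer_normal z p \<or> outer_normal z' p = - outer_normal z p"
proof (cases "z = z'")
  case False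
  with g assms have far: "dist_L1 z z' \<ge> s" by (auto simp: Conf_def)
  define a b c d where "a = Re (p - z)" "b = Im (p - z)" "c = Re (p - z')" "d = Im (p - z')"
  note abcd = this
  have nz: "a \<noteq> 0" "b \<noteq> 0" "c \<noteq> 0" "d \<noteq> 0"
    using not_corner_components[OF z(1) s z(2)] not_corner_components[OF z'(1) s z'(2)] by (auto simp: abcd)
  have sums: "\<bar>a\<bar> + \<bar>b\<bar> = s / 2" "\<bar>c\<bar> + \<bar>d\<bar> = s / 2" "\<bar>c - a\<bar> + \<bar>d - b\<bar> \<ge> s"
    using z z' far by (auto simp: dist_L1_def abcd)
  have "sgn c = - sgn a" "sgn d = - sgn b"
    using nz sums by (auto simp: sgn_if split: if_splits)
  then have "Complex (sgn c) (sgn d) = - Complex (sgn a) (sgn b)" by (simp add: complex_eq_iff)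
  then show ?thesis unfolding outer_normal_def abcd[symmetric] by simp
qed simp

section \<open>Reflection and uniqueness of orbits\<close>

lemma velocity_inject: "velocity u = velocity v \<longleftrightarrow> u = v"
  by (simp add: velocity_def)

text \<open>A reflection is an involution, hence injective, and \<open>n\<close> and
  \<open>- n\<close> define the same one.\<close>

lemma reflection_cancel:
  assumes n: "n \<bullet> n = 1" and m: "m = n \<or> m = - n" and x: "x = v - (2 * (v \<bullet> n)) *\<^sub>R n"
    and y: "y = w - (2 * (w \<bullet> m)) *\<^sub>R m"
  shows "x = y \<longleftrightarrow> v = w"
proof
  have y': "y = w - (2 * (w \<bullet> n)) *\<^sub>R n" using m y by auto
  have *: "v = x - (2 * (x \<bullet> n)) *\<^sub>R n" if "x = v - (2 * (v \<bullet> n)) *\<^sub>R n" for x v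
    using n by (simp add: that inner_diff_left algebra_simps)
  assume "x = y"
  then show "v = w" using *[OF x] *[OF y'] by simp
next
  assume "v = w"
  then show "x = y" using m x y by auto
qed

definition incoming :: "real \<Rightarrow> complex set \<Rightarrow> complex \<times> complex \<Rightarrow> complex \<Rightarrow> bool" where
  "incoming s g x u \<longleftrightarrow> fst x \<in> interior (table s g) \<and> u = snd x \<or> elastic_reflection s g (fst x) u (snd x)"

text \<open>At a common position the incoming and the outgoing direction determine each other,
  whichever tree is held responsible for the reflection. This makes orbits unique both forwards and
  backwards in time.\<close>

lemma incoming_unique:
  assumes g: "g \<in> Conf s" and s: "s > 0" and x: "x \<in> phase_space s g \<theta>" and y: "y \<in> phase_space s g \<theta>"
    and p: "fst x = fst y" and u: "incoming s g x u" and v: "incoming s g y v"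
  shows "u = v \<longleftrightarrow> snd x = snd y"
proof (cases "fst x \<in> interior (table s g)")
  case True
  then have "\<not> elastic_reflection s g (fst x) w w'" for w w'
    using frontier_tree_not_interior_table[OF s] unfolding elastic_reflection_def by blast
  then show ?thesis using u v p unfolding incoming_def by auto
next
  case False
  with u v p obtain z z' where z: "z \<in> g" "fst x \<in> frontier (tree s z)"
      "velocity (snd x) = velocity u - (2 * (velocity u \<bullet> outer_normal z (fst x))) *\<^sub>R outer_normal z (fst x)"
    and z': "z' \<in> g" "fst x \<in> frontier (tree s z')"
      "velocity (snd y) = velocity v - (2 * (velocity v \<bullet> outer_normal z' (fst x))) *\<^sub>R outer_normal z' (fst x)"
    unfolding incoming_def elastic_reflection_def by auto
  have nc: "fst x \<notin> corners s z" "fst x \<notin> corners s z'"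
    using x z z' unfolding phase_space_def by (auto simp: case_prod_beta)
  note d = frontier_tree_dist[OF z(2)] frontier_tree_dist[OF z'(2)]
  have "velocity (snd x) = velocity (snd y) \<longleftrightarrow> velocity u = velocity v"
    using reflection_cancel[OF outer_normal_unit[OF not_corner_components[OF d(1) s nc(1)]]
      outer_normal_unique[OF g s z(1) z'(1) d(1) nc(1) d(2) nc(2)] z(3) z'(3)] .
  then show ?thesis by (auto simp: velocity_inject)
qed

lemma billiard_orbit_incoming:
  "billiard_orbit s g \<theta> I \<gamma> \<longleftrightarrow> (\<forall>t\<in>I. \<gamma> t \<in> phase_space s g \<theta> \<and> (\<exists>u. \<exists>\<epsilon>>0. incoming s g (\<gamma> t) u \<and>
     (\<forall>t'\<in>I. t \<le> t' \<and> t' < t + \<epsilon> \<longrightarrow> \<gamma> t' = (fst (\<gamma> t) + (t' - t) *\<^sub>R velocity (snd (\<gamma> t)), snd (\<gamma> t))) \<and>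
     (\<forall>t'\<in>I. t - \<epsilon> < t' \<and> t' < t \<longrightarrow> \<gamma> t' = (fst (\<gamma> t) + (t' - t) *\<^sub>R velocity u, u))))"
  unfolding billiard_orbit_def incoming_def ..

lemma billiard_orbit_phase_space: "billiard_orbit s g \<theta> I \<gamma> \<Longrightarrow> t \<in> I \<Longrightarrow> \<gamma> t \<in> phase_space s g \<theta>"
  unfolding billiard_orbit_def by blast

lemma billiard_orbit_germ:
  assumes "billiard_orbit s g \<theta> I \<gamma>" "t \<in> I"
  shows "\<exists>u. \<exists>\<epsilon>>0. incoming s g (\<gamma> t) u \<and>
    (\<forall>t'. t' \<in> I \<longrightarrow> t \<le> t' \<longrightarrow> t' < t + \<epsilon> \<longrightarrow> \<gamma> t' = (fst (\<gamma> t) + (t' - t) *\<^sub>R velocity (snd (\<gamma> t)), snd (\<gamma> t))) \<and>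
    (\<forall>t'. t' \<in> I \<longrightarrow> t - \<epsilon> < t' \<longrightarrow> t' < t \<longrightarrow> \<gamma> t' = (fst (\<gamma> t) + (t' - t) *\<^sub>R velocity u, u))"
  using assms unfolding billiard_orbit_incoming by blast

lemma billiard_orbit_past:
  assumes "billiard_orbit s g \<theta> I \<gamma>" "t \<in> I"
  shows "\<exists>u. \<exists>\<epsilon>>0. incoming s g (\<gamma> t) u \<and>
    (\<forall>t'. t' \<in> I \<longrightarrow> t - \<epsilon> < t' \<longrightarrow> t' < t \<longrightarrow> \<gamma> t' = (fst (\<gamma> t) + (t' - t) *\<^sub>R velocity u, u))"
  using billiard_orbit_germ[OF assms] by blast

lemma billiard_orbit_future:
  assumes "billiard_orbit s g \<theta> I \<gamma>" "t \<in> I"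
  shows "\<exists>\<epsilon>>0. \<forall>t'. t' \<in> I \<longrightarrow> t \<le> t' \<longrightarrow> t' < t + \<epsilon> \<longrightarrow>
    \<gamma> t' = (fst (\<gamma> t) + (t' - t) *\<^sub>R velocity (snd (\<gamma> t)), snd (\<gamma> t))"
  using billiard_orbit_germ[OF assms] by blast

lemma billiard_orbitI:
  assumes "\<And>t. t \<in> I \<Longrightarrow> \<gamma> t \<in> phase_space s g \<theta>"
    and past: "\<And>t. t \<in> I \<Longrightarrow> \<exists>u. \<exists>e>0. incoming s g (\<gamma> t) u \<and>
      (\<forall>t'\<in>I. t - e < t' \<and> t' < t \<longrightarrow> \<gamma> t' = (fst (\<gamma> t) + (t' - t) *\<^sub>R velocity u, u))"
    and future: "\<And>t. t \<in> I \<Longrightarrow> \<exists>e>0. \<forall>t'\<in>I. t \<le> t' \<and> t' < t + e \<longrightarrow>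
      \<gamma> t' = (fst (\<gamma> t) + (t' - t) *\<^sub>R velocity (snd (\<gamma> t)), snd (\<gamma> t))"
  shows "billiard_orbit s g \<theta> I \<gamma>"
  unfolding billiard_orbit_incoming
proof
  fix t assume t: "t \<in> I"
  obtain u e where "e > 0" "incoming s g (\<gamma> t) u"
    "\<forall>t'\<in>I. t - e < t' \<and> t' < t \<longrightarrow> \<gamma> t' = (fst (\<gamma> t) + (t' - t) *\<^sub>R velocity u, u)"
    using past[OF t] by blast
  moreover obtain d where "d > 0"
    "\<forall>t'\<in>I. t \<le> t' \<and> t' < t + d \<longrightarrow> \<gamma> t' = (fst (\<gamma> t) + (t' - t) *\<^sub>R velocity (snd (\<gamma> t)), snd (\<gamma> t))"
    using future[OF t] by blast
  ultimately show "\<gamma> t \<in> phase_space s g \<theta> \<and> (\<exists>u. \<exists>\<epsilon>>0. incoming s g (\<gamma> t) u \<and>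
     (\<forall>t'\<in>I. t \<le> t' \<and> t' < t + \<epsilon> \<longrightarrow> \<gamma> t' = (fst (\<gamma> t) + (t' - t) *\<^sub>R velocity (snd (\<gamma> t)), snd (\<gamma> t))) \<and>
     (\<forall>t'\<in>I. t - \<epsilon> < t' \<and> t' < t \<longrightarrow> \<gamma> t' = (fst (\<gamma> t) + (t' - t) *\<^sub>R velocity u, u)))"
    using assms(1)[OF t] by (intro conjI exI[of _ u] exI[of _ "min e d"]) auto
qed

text \<open>Near each time \<open>t\<close> both orbits consist of one straight piece before and one
  after \<open>t\<close>. Agreement anywhere nearby forces agreement at \<open>t\<close>, and then
  on the whole neighbourhood; connectedness of \<open>I\<close> spreads it.\<close>

lemma billiard_orbit_unique:
  assumes g: "g \<in> Conf s" and s: "s > 0" and I: "connected I"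
    and \<gamma>: "billiard_orbit s g \<theta> I \<gamma>" and \<delta>: "billiard_orbit s g \<theta> I \<delta>"
    and "a \<in> I" "b \<in> I" "\<gamma> a = \<delta> a"
  shows "\<gamma> b = \<delta> b"
proof (rule connected_induction_simple[OF I \<open>a \<in> I\<close> \<open>b \<in> I\<close>, where P="\<lambda>t. \<gamma> t = \<delta> t"])
  show "\<gamma> a = \<delta> a" by fact
next
  fix t assume t: "t \<in> I"
  obtain u e where u: "e > 0" "incoming s g (\<gamma> t) u"
    "\<forall>t'. t' \<in> I \<longrightarrow> t - e < t' \<longrightarrow> t' < t \<longrightarrow> \<gamma> t' = (fst (\<gamma> t) + (t' - t) *\<^sub>R velocity u, u)"
    using billiard_orbit_past[OF \<gamma> t] by blast
  note u = u(1,2) u(3)[rule_format]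
  obtain e' where u': "e' > 0"
    "\<forall>t'. t' \<in> I \<longrightarrow> t \<le> t' \<longrightarrow> t' < t + e' \<longrightarrow> \<gamma> t' = (fst (\<gamma> t) + (t' - t) *\<^sub>R velocity (snd (\<gamma> t)), snd (\<gamma> t))"
    using billiard_orbit_future[OF \<gamma> t] by blast
  note u' = u'(1) u'(2)[rule_format]
  obtain v d where v: "d > 0" "incoming s g (\<delta> t) v"
    "\<forall>t'. t' \<in> I \<longrightarrow> t - d < t' \<longrightarrow> t' < t \<longrightarrow> \<delta> t' = (fst (\<delta> t) + (t' - t) *\<^sub>R velocity v, v)"
    using billiard_orbit_past[OF \<delta> t] by blast
  note v = v(1,2) v(3)[rule_format]
  obtain d' where v': "d' > 0"
    "\<forall>t'. t' \<in> I \<longrightarrow> t \<le> t' \<longrightarrow> t' < t + d' \<longrightarrow> \<delta> t' = (fst (\<delta> t) + (t' - t) *\<^sub>R velocity (snd (\<delta> t)), snd (\<delta> t))"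
    using billiard_orbit_future[OF \<delta> t] by blast
  note v' = v'(1) v'(2)[rule_format]
  note uniq = incoming_unique[OF g s billiard_orbit_phase_space[OF \<gamma> t] billiard_orbit_phase_space[OF \<delta> t] _ u(2) v(2)]
  define T where "T = I \<inter> ball t (Min {e, e', d, d'})"
  have T: "x \<in> I" "\<bar>x - t\<bar> < e" "\<bar>x - t\<bar> < d" "\<bar>x - t\<bar> < e'" "\<bar>x - t\<bar> < d'" if "x \<in> T" for x
    using that by (auto simp: T_def dist_real_def abs_minus_commute)
  \<comment> \<open>A common state before \<open>t\<close> fixes the position at \<open>t\<close>
    and the incoming direction, one at or after \<open>t\<close> the position and the outgoing
    direction; \<open>incoming_unique\<close> supplies the missing direction in either case.\<close>
  have centre: "\<gamma> t = \<delta> t \<and> u = v" if "x \<in> T" "\<gamma> x = \<delta> x" for x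
  proof (cases "x < t")
    case True
    then have "u = v \<and> fst (\<gamma> t) = fst (\<delta> t)"
      using u(3)[of x] v(3)[of x] T[OF that(1)] that(2) by auto
    then show ?thesis using uniq by (simp add: prod_eq_iff)
  next
    case False
    then have "snd (\<gamma> t) = snd (\<delta> t) \<and> fst (\<gamma> t) = fst (\<delta> t)"
      using u'(2)[of x] v'(2)[of x] T[OF that(1)] that(2) by auto
    then show ?thesis using uniq by (simp add: prod_eq_iff)
  qed
  have "\<gamma> y = \<delta> y" if "x \<in> T" "y \<in> T" "\<gamma> x = \<delta> x" for x y
    using centre[OF that(1,3)] u(3)[of y] v(3)[of y] u'(2)[of y] v'(2)[of y] T[OF that(2)] by (cases "y < t") auto
  moreover have "openin (top_of_set I) T" by (auto simp: T_def)
  moreover have "t \<in> T" using t u(1) v(1) u'(1) v'(1) by (auto simp: T_def)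
  ultimately show "\<exists>T. openin (top_of_set I) T \<and> t \<in> T \<and> (\<forall>x\<in>T. \<forall>y\<in>T. \<gamma> x = \<delta> x \<longrightarrow> \<gamma> y = \<delta> y)"
    by blast
qed

section \<open>Shifting, restricting and gluing orbits\<close>

lemma billiard_orbit_shift:
  assumes "billiard_orbit s g \<theta> I \<gamma>" "\<And>t. t \<in> J \<Longrightarrow> t + r \<in> I"
  shows "billiard_orbit s g \<theta> J (\<lambda>t. \<gamma> (t + r))"
  unfolding billiard_orbit_incoming
proof (intro ballI conjI)
  fix t assume t: "t \<in> J"
  show "\<gamma> (t + r) \<in> phase_space s g \<theta>" using billiard_orbit_phase_space[OF assms(1) assms(2)[OF t]] .
  obtain u e where u: "e > 0" "incoming s g (\<gamma> (t + r)) u"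
    "\<forall>t'. t' \<in> I \<longrightarrow> t + r \<le> t' \<longrightarrow> t' < t + r + e \<longrightarrow>
       \<gamma> t' = (fst (\<gamma> (t + r)) + (t' - (t + r)) *\<^sub>R velocity (snd (\<gamma> (t + r))), snd (\<gamma> (t + r)))"
    "\<forall>t'. t' \<in> I \<longrightarrow> t + r - e < t' \<longrightarrow> t' < t + r \<longrightarrow>
       \<gamma> t' = (fst (\<gamma> (t + r)) + (t' - (t + r)) *\<^sub>R velocity u, u)"
    using billiard_orbit_germ[OF assms(1) assms(2)[OF t]] by blast
  note u = u(1,2) u(3,4)[rule_format]
  show "\<exists>u. \<exists>\<epsilon>>0. incoming s g (\<gamma> (t + r)) u \<and>
     (\<forall>t'\<in>J. t \<le> t' \<and> t' < t + \<epsilon> \<longrightarrow>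
        \<gamma> (t' + r) = (fst (\<gamma> (t + r)) + (t' - t) *\<^sub>R velocity (snd (\<gamma> (t + r))), snd (\<gamma> (t + r)))) \<and>
     (\<forall>t'\<in>J. t - \<epsilon> < t' \<and> t' < t \<longrightarrow> \<gamma> (t' + r) = (fst (\<gamma> (t + r)) + (t' - t) *\<^sub>R velocity u, u))"
    using u(1,2) u(3,4)[OF assms(2)] by (intro exI[of _ u] exI[of _ e]) auto
qed

lemma billiard_orbit_subset:
  assumes "billiard_orbit s g \<theta> I \<gamma>" "J \<subseteq> I"
  shows "billiard_orbit s g \<theta> J \<gamma>"
  using billiard_orbit_shift[OF assms(1), of J 0] assms(2) by auto

lemma billiard_orbit_local:
  assumes "\<And>t. t \<in> I \<Longrightarrow> \<exists>\<delta>>0. \<exists>\<eta>. billiard_orbit s g \<theta> (I \<inter> {t - \<delta><..<t + \<delta>}) \<eta> \<and>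
    (\<forall>t'\<in>I. t - \<delta> < t' \<and> t' < t + \<delta> \<longrightarrow> \<gamma> t' = \<eta> t')"
  shows "billiard_orbit s g \<theta> I \<gamma>"
  unfolding billiard_orbit_incoming
proof
  fix t assume t: "t \<in> I"
  obtain d \<eta> where d: "d > 0" and \<eta>: "billiard_orbit s g \<theta> (I \<inter> {t - d<..<t + d}) \<eta>"
    and eq: "\<And>t'. t' \<in> I \<Longrightarrow> t - d < t' \<Longrightarrow> t' < t + d \<Longrightarrow> \<gamma> t' = \<eta> t'"
    using assms[OF t] by blast
  have t': "t \<in> I \<inter> {t - d<..<t + d}" using t d by auto
  obtain u e where u: "e > 0" "incoming s g (\<eta> t) u"
    "\<forall>t'. t' \<in> I \<inter> {t - d<..<t + d} \<longrightarrow> t \<le> t' \<longrightarrow> t' < t + e \<longrightarrow> \<eta> t' = (fst (\<eta> t) + (t' - t) *\<^sub>R velocity (snd (\<eta> t)), snd (\<eta> t))"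
    "\<forall>t'. t' \<in> I \<inter> {t - d<..<t + d} \<longrightarrow> t - e < t' \<longrightarrow> t' < t \<longrightarrow> \<eta> t' = (fst (\<eta> t) + (t' - t) *\<^sub>R velocity u, u)"
    using billiard_orbit_germ[OF \<eta> t'] by blast
  note u = u(1,2) u(3,4)[rule_format]
  have t_eq: "\<gamma> t = \<eta> t" using eq[OF t] d by simp
  show "\<gamma> t \<in> phase_space s g \<theta> \<and> (\<exists>u. \<exists>\<epsilon>>0. incoming s g (\<gamma> t) u \<and>
     (\<forall>t'\<in>I. t \<le> t' \<and> t' < t + \<epsilon> \<longrightarrow> \<gamma> t' = (fst (\<gamma> t) + (t' - t) *\<^sub>R velocity (snd (\<gamma> t)), snd (\<gamma> t))) \<and>
     (\<forall>t'\<in>I. t - \<epsilon> < t' \<and> t' < t \<longrightarrow> \<gamma> t' = (fst (\<gamma> t) + (t' - t) *\<^sub>R velocity u, u)))"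
    using billiard_orbit_phase_space[OF \<eta> t'] u(1,2) d unfolding t_eq
    by (intro conjI exI[of _ u] exI[of _ "min e d"]) (auto simp: eq u(3,4))
qed

text \<open>At the joint \<open>b\<close> the incoming direction is taken from the first orbit and
  the motion afterwards from the second; they fit because both have the same state there.\<close>

lemma billiard_orbit_glue:
  assumes \<gamma>: "billiard_orbit s g \<theta> {a..b} \<gamma>" and \<delta>: "billiard_orbit s g \<theta> {b..c} \<delta>"
    and eq: "\<gamma> b = \<delta> b" and "a \<le> b" "b \<le> c"
  shows "billiard_orbit s g \<theta> {a..c} (\<lambda>t. if t \<le> b then \<gamma> t else \<delta> t)"
proof (rule billiard_orbitI)
  let ?\<eta> = "\<lambda>t. if t \<le> b then \<gamma> t else \<delta> t"
  fix t assume t: "t \<in> {a..c}"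
  show "\<exists>u. \<exists>e>0. incoming s g (?\<eta> t) u \<and> (\<forall>t'\<in>{a..c}. t - e < t' \<and> t' < t \<longrightarrow> ?\<eta> t' = (fst (?\<eta> t) + (t' - t) *\<^sub>R velocity u, u))"
  proof (cases "t \<le> b")
    case True
    then have "t \<in> {a..b}" using t by auto
    from billiard_orbit_past[OF \<gamma> this] obtain u e where ue: "e > 0" "incoming s g (\<gamma> t) u"
      "\<forall>t'. t' \<in> {a..b} \<longrightarrow> t - e < t' \<longrightarrow> t' < t \<longrightarrow> \<gamma> t' = (fst (\<gamma> t) + (t' - t) *\<^sub>R velocity u, u)"
      by blast
    note ue = ue(1,2) ue(3)[rule_format]
    then show ?thesis using ue True by (intro exI[of _ u] exI[of _ e]) auto
  next
    case False
    then have "t \<in> {b..c}" using t by auto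
    from billiard_orbit_past[OF \<delta> this] obtain u e where ue: "e > 0" "incoming s g (\<delta> t) u"
      "\<forall>t'. t' \<in> {b..c} \<longrightarrow> t - e < t' \<longrightarrow> t' < t \<longrightarrow> \<delta> t' = (fst (\<delta> t) + (t' - t) *\<^sub>R velocity u, u)"
      by blast
    note ue = ue(1,2) ue(3)[rule_format]
    have eq: "?\<eta> t' = \<delta> t'" if "t - min e (t - b) < t'" for t' using that False by auto
    have "0 < min e (t - b)" using ue False by simp
    moreover have "?\<eta> t = \<delta> t" using False by simp
    moreover have "?\<eta> t' = (fst (\<delta> t) + (t' - t) *\<^sub>R velocity u, u)"
      if "t' \<in> {a..c}" "t - min e (t - b) < t' \<and> t' < t" for t'
      using ue(3)[of t'] eq[of t'] that by auto
    ultimately show ?thesis using ue(2) by (intro exI[of _ u] exI[of _ "min e (t - b)"]) (simp del: atLeastAtMost_iff)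
  qed
  show "\<exists>e>0. \<forall>t'\<in>{a..c}. t \<le> t' \<and> t' < t + e \<longrightarrow> ?\<eta> t' = (fst (?\<eta> t) + (t' - t) *\<^sub>R velocity (snd (?\<eta> t)), snd (?\<eta> t))"
  proof (cases "t < b")
    case True
    then have "t \<in> {a..b}" using t by auto
    from billiard_orbit_future[OF \<gamma> this] obtain e where e: "e > 0"
      "\<forall>t'. t' \<in> {a..b} \<longrightarrow> t \<le> t' \<longrightarrow> t' < t + e \<longrightarrow> \<gamma> t' = (fst (\<gamma> t) + (t' - t) *\<^sub>R velocity (snd (\<gamma> t)), snd (\<gamma> t))"
      by blast
    note e = e(1) e(2)[rule_format]
    have "0 < min e (b - t)" using True e by simp
    moreover have "?\<eta> t' = (fst (\<gamma> t) + (t' - t) *\<^sub>R velocity (snd (\<gamma> t)), snd (\<gamma> t))"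
      if "t' \<in> {a..c}" "t \<le> t' \<and> t' < t + min e (b - t)" for t'
      using e(2)[of t'] that by auto
    moreover have "?\<eta> t = \<gamma> t" using True by simp
    ultimately show ?thesis by (intro exI[of _ "min e (b - t)"]) (simp del: atLeastAtMost_iff)
  next
    case False
    then have "t \<in> {b..c}" using t by auto
    from billiard_orbit_future[OF \<delta> this] obtain e where e: "e > 0"
      "\<forall>t'. t' \<in> {b..c} \<longrightarrow> t \<le> t' \<longrightarrow> t' < t + e \<longrightarrow> \<delta> t' = (fst (\<delta> t) + (t' - t) *\<^sub>R velocity (snd (\<delta> t)), snd (\<delta> t))"
      by blast
    note e = e(1) e(2)[rule_format]
    have "?\<eta> t' = \<delta> t'" if "t' \<ge> t" for t' using False that eq by (cases "t' = b") auto
    then have "?\<eta> t' = (fst (?\<eta> t) + (t' - t) *\<^sub>R velocity (snd (?\<eta> t)), snd (?\<eta> t))"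
      if "t' \<in> {a..c}" "t \<le> t' \<and> t' < t + e" for t'
      using e(2)[of t'] that False eq by auto
    then show ?thesis using e(1) by blast
  qed
  show "?\<eta> t \<in> phase_space s g \<theta>"
    using billiard_orbit_phase_space[OF \<gamma>, of t] billiard_orbit_phase_space[OF \<delta>, of t] t by auto
qed

section \<open>The total flow\<close>

definition complete_states :: "real \<Rightarrow> complex set \<Rightarrow> complex \<Rightarrow> (complex \<times> complex) set" where
  "complete_states s g \<theta> = {x. \<exists>\<gamma>. billiard_orbit s g \<theta> UNIV \<gamma> \<and> \<gamma> 0 = x}"

text \<open>Incomplete states are frozen, which makes the group law hold at every point. On complete
  states the partial flow is always defined, so \<open>the\<close> yields its proper value.\<close>

definition complete_flow ::
    "real \<Rightarrow> complex set \<Rightarrow> complex \<Rightarrow> real \<Rightarrow> complex \<times> complex \<Rightarrow> complex \<times> complex" where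
  "complete_flow s g \<theta> t x = (if x \<in> complete_states s g \<theta> then the (billiard_flow s g \<theta> t x) else x)"

context
  fixes s :: real and g :: "complex set" and \<theta> :: complex
  assumes g: "g \<in> Conf s" and s: "s > 0"
begin

text \<open>Uniqueness of orbits makes the definite description in \<open>billiard_flow\<close>
  meaningful.\<close>

lemma billiard_flow_Some_iff:
  "billiard_flow s g \<theta> t x = Some y \<longleftrightarrow>
     (\<exists>\<gamma>. billiard_orbit s g \<theta> (closed_segment 0 t) \<gamma> \<and> \<gamma> 0 = x \<and> \<gamma> t = y)"
proof -
  have uniq: "\<gamma> t = \<delta> t" if "billiard_orbit s g \<theta> (closed_segment 0 t) \<gamma>"
    "billiard_orbit s g \<theta> (closed_segment 0 t) \<delta>" "\<gamma> 0 = \<delta> 0" for \<gamma> \<delta>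
    using billiard_orbit_unique[OF g s connected_segment(1) that(1,2), of 0 t] that(3) by simp
  let ?P = "\<lambda>\<gamma>. billiard_orbit s g \<theta> (closed_segment 0 t) \<gamma> \<and> \<gamma> 0 = x"
  show ?thesis
  proof (cases "\<exists>\<gamma>. ?P \<gamma>")
    case True
    then obtain \<gamma> where \<gamma>: "?P \<gamma>" ..
    then have eq: "\<delta> t = \<gamma> t" if "?P \<delta>" for \<delta> using uniq[of \<delta> \<gamma>] that by simp
    have "(THE y. \<exists>\<gamma>. billiard_orbit s g \<theta> (closed_segment 0 t) \<gamma> \<and> \<gamma> 0 = x \<and> \<gamma> t = y) = \<gamma> t"
    proof (rule the_equality)
      fix y assume "\<exists>\<delta>. billiard_orbit s g \<theta> (closed_segment 0 t) \<delta> \<and> \<delta> 0 = x \<and> \<delta> t = y"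
      then obtain \<delta> where "?P \<delta>" "\<delta> t = y" by blast
      then show "y = \<gamma> t" using eq[of \<delta>] by simp
    qed (use \<gamma> in blast)
    then have "billiard_flow s g \<theta> t x = Some (\<gamma> t)" unfolding billiard_flow_def by (simp only: if_P[OF True])
    moreover have "\<gamma> t = y \<longleftrightarrow> (\<exists>\<delta>. ?P \<delta> \<and> \<delta> t = y)"
    proof
      assume "\<gamma> t = y"
      then show "\<exists>\<delta>. ?P \<delta> \<and> \<delta> t = y" using \<gamma> by (intro exI[of _ \<gamma>]) simp
    next
      assume "\<exists>\<delta>. ?P \<delta> \<and> \<delta> t = y"
      then obtain \<delta> where "?P \<delta>" "\<delta> t = y" by blast
      then show "\<gamma> t = y" using eq[of \<delta>] by simp
    qed
    ultimately show ?thesis by simp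
  next
    case False
    then have "billiard_flow s g \<theta> t x = None" unfolding billiard_flow_def by (rule if_not_P)
    moreover have "\<not> (\<exists>\<gamma>. billiard_orbit s g \<theta> (closed_segment 0 t) \<gamma> \<and> \<gamma> 0 = x \<and> \<gamma> t = y)"
      using False by blast
    ultimately show ?thesis by simp
  qed
qed

lemma billiard_flow_orbit:
  assumes "billiard_orbit s g \<theta> UNIV \<gamma>"
  shows "billiard_flow s g \<theta> t (\<gamma> r) = Some (\<gamma> (t + r))"
  unfolding billiard_flow_Some_iff
  by (rule exI[of _ "\<lambda>t. \<gamma> (t + r)"]) (auto intro: billiard_orbit_shift[OF assms])

lemma complete_statesI: "billiard_orbit s g \<theta> UNIV \<gamma> \<Longrightarrow> \<gamma> r \<in> complete_states s g \<theta>"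
  unfolding complete_states_def
  by (auto intro!: exI[of _ "\<lambda>t. \<gamma> (t + r)"] billiard_orbit_shift)

lemma complete_flow_orbit:
  assumes "billiard_orbit s g \<theta> UNIV \<gamma>"
  shows "complete_flow s g \<theta> t (\<gamma> r) = \<gamma> (t + r)"
  by (simp add: complete_flow_def complete_statesI[OF assms] billiard_flow_orbit[OF assms])

lemma complete_states_flow:
  assumes "x \<in> complete_states s g \<theta>"
  shows "billiard_flow s g \<theta> t x = Some (complete_flow s g \<theta> t x)"
    "complete_flow s g \<theta> t x \<in> complete_states s g \<theta>"
proof -
  obtain \<gamma> where \<gamma>: "billiard_orbit s g \<theta> UNIV \<gamma>" "x = \<gamma> 0"
    using assms unfolding complete_states_def by blast
  show "billiard_flow s g \<theta> t x = Some (complete_flow s g \<theta> t x)"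
    "complete_flow s g \<theta> t x \<in> complete_states s g \<theta>"
    using billiard_flow_orbit[OF \<gamma>(1), of t 0] complete_flow_orbit[OF \<gamma>(1), of t 0]
      complete_statesI[OF \<gamma>(1), of t] \<gamma>(2) by auto
qed

lemma complete_flow_zero: "complete_flow s g \<theta> 0 x = x"
proof (cases "x \<in> complete_states s g \<theta>")
  case True
  then obtain \<gamma> where \<gamma>: "billiard_orbit s g \<theta> UNIV \<gamma>" "x = \<gamma> 0"
    unfolding complete_states_def by blast
  then show ?thesis using complete_flow_orbit[OF \<gamma>(1), of 0 0] by simp
qed (simp add: complete_flow_def)

lemma complete_flow_add: "complete_flow s g \<theta> (t + r) x = complete_flow s g \<theta> t (complete_flow s g \<theta> r x)"
proof (cases "x \<in> complete_states s g \<theta>")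
  case True
  then obtain \<gamma> where \<gamma>: "billiard_orbit s g \<theta> UNIV \<gamma>" "x = \<gamma> 0"
    unfolding complete_states_def by blast
  then show ?thesis
    using complete_flow_orbit[OF \<gamma>(1), of "t + r" 0] complete_flow_orbit[OF \<gamma>(1), of r 0]
      complete_flow_orbit[OF \<gamma>(1), of t r] by simp
qed (simp add: complete_flow_def)

lemma complete_states_phase_space:
  assumes "x \<in> complete_states s g \<theta>"
  shows "x \<in> phase_space s g \<theta>"
  using assms billiard_orbit_phase_space unfolding complete_states_def by blast

text \<open>By uniqueness the orbit from \<open>x\<close> to \<open>y\<close> is a piece of the full
  orbit through \<open>y\<close>.\<close>

lemma complete_states_preimage:
  assumes "billiard_flow s g \<theta> t x = Some y" "y \<in> complete_states s g \<theta>"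
  shows "x \<in> complete_states s g \<theta>"
proof -
  obtain \<gamma> where \<gamma>: "billiard_orbit s g \<theta> (closed_segment 0 t) \<gamma>" "\<gamma> 0 = x" "\<gamma> t = y"
    using assms(1) unfolding billiard_flow_Some_iff by blast
  obtain \<delta> where \<delta>: "billiard_orbit s g \<theta> UNIV \<delta>" "\<delta> 0 = y"
    using assms(2) unfolding complete_states_def by blast
  have "billiard_orbit s g \<theta> (closed_segment 0 t) (\<lambda>r. \<delta> (r + - t))"
    by (rule billiard_orbit_shift[OF \<delta>(1)]) simp
  from billiard_orbit_unique[OF g s connected_segment(1) \<gamma>(1) this, of t 0] \<gamma> \<delta>
  have "x = \<delta> (- t)" by simp
  then show ?thesis using complete_statesI[OF \<delta>(1)] by simp
qed

text \<open>Forward and backward orbits glue to orbits on \<open>{- real n..real n}\<close>.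
  Uniqueness makes these compatible for different \<open>n\<close>, and being an orbit is a local
  property, so together they form an orbit on the whole line.\<close>

lemma complete_statesI_integer_times:
  assumes "\<And>n::nat. billiard_flow s g \<theta> (real n) x \<noteq> None" "\<And>n::nat. billiard_flow s g \<theta> (- real n) x \<noteq> None"
  shows "x \<in> complete_states s g \<theta>"
proof -
  have "\<exists>\<gamma>. billiard_orbit s g \<theta> {- real n..real n} \<gamma> \<and> \<gamma> 0 = x" for n
  proof -
    have seg: "closed_segment 0 (real n) = {0..real n}" "closed_segment 0 (- real n) = {- real n..0}"
      by (auto simp: closed_segment_eq_real_ivl)
    obtain \<gamma> where \<gamma>: "billiard_orbit s g \<theta> {0..real n} \<gamma>" "\<gamma> 0 = x"
      using assms(1)[of n] by (fastforce simp: billiard_flow_Some_iff seg)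
    obtain \<delta> where \<delta>: "billiard_orbit s g \<theta> {- real n..0} \<delta>" "\<delta> 0 = x"
      using assms(2)[of n] by (fastforce simp: billiard_flow_Some_iff seg)
    show ?thesis using billiard_orbit_glue[OF \<delta>(1) \<gamma>(1)] \<gamma>(2) \<delta>(2)
      by (intro exI[of _ "\<lambda>t. if t \<le> 0 then \<delta> t else \<gamma> t"]) auto
  qed
  then obtain \<eta> where \<eta>: "\<And>n. billiard_orbit s g \<theta> {- real n..real n} (\<eta> n)" "\<And>n. \<eta> n 0 = x" by metis
  define \<gamma> where "\<gamma> t = \<eta> (nat \<lceil>\<bar>t\<bar>\<rceil>) t" for t
  have \<gamma>_eq: "\<gamma> t = \<eta> n t" if "\<bar>t\<bar> \<le> real n" for t n
  proof -
    define m where "m = nat \<lceil>\<bar>t\<bar>\<rceil>"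
    have "\<bar>t\<bar> \<le> real m" "m \<le> n" using that unfolding m_def by linarith+
    then have m: "\<bar>t\<bar> \<le> real m" "real m \<le> real n" by auto
    have sub: "billiard_orbit s g \<theta> {- real m..real m} (\<eta> n)"
      using m by (intro billiard_orbit_subset[OF \<eta>(1)[of n]]) auto
    have "\<eta> m t = \<eta> n t"
      by (rule billiard_orbit_unique[OF g s _ \<eta>(1) sub, of 0 t]) (use m \<eta>(2) in auto)
    then show ?thesis by (simp add: \<gamma>_def m_def)
  qed
  have "billiard_orbit s g \<theta> UNIV \<gamma>"
  proof (rule billiard_orbit_local)
    fix t :: real
    obtain n :: nat where n: "real n \<ge> \<bar>t\<bar> + 1" using real_arch_simple by blast
    have "billiard_orbit s g \<theta> (UNIV \<inter> {t - 1<..<t + 1}) (\<eta> n)"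
      by (rule billiard_orbit_subset[OF \<eta>(1)[of n]]) (use n in auto)
    moreover have "\<forall>t'\<in>UNIV. t - 1 < t' \<and> t' < t + 1 \<longrightarrow> \<gamma> t' = \<eta> n t'"
      using n by (auto intro!: \<gamma>_eq)
    ultimately show "\<exists>\<delta>>0. \<exists>\<eta>. billiard_orbit s g \<theta> (UNIV \<inter> {t - \<delta><..<t + \<delta>}) \<eta> \<and>
      (\<forall>t'\<in>UNIV. t - \<delta> < t' \<and> t' < t + \<delta> \<longrightarrow> \<gamma> t' = \<eta> t')"
      by (intro exI[of _ 1] conjI exI[of _ "\<eta> n"]) auto
  qed
  moreover have "\<gamma> 0 = x" using \<gamma>_eq[of 0 0] \<eta>(2) by simp
  ultimately show ?thesis unfolding complete_states_def by blast
qed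

text \<open>Two-sided continuity fails because the direction jumps at a reflection; from the right
  it holds since a state records the direction from its time on.\<close>

lemma complete_flow_right_continuous:
  "((\<lambda>r. complete_flow s g \<theta> r x) \<longlongrightarrow> complete_flow s g \<theta> t x) (at_right t)"
proof (cases "x \<in> complete_states s g \<theta>")
  case True
  then obtain \<gamma> where \<gamma>: "billiard_orbit s g \<theta> UNIV \<gamma>" "x = \<gamma> 0"
    unfolding complete_states_def by blast
  have \<gamma>_eq: "complete_flow s g \<theta> r x = \<gamma> r" for r
    using complete_flow_orbit[OF \<gamma>(1), of r 0] \<gamma>(2) by simp
  obtain e where e: "e > 0"
    "\<forall>t'. t' \<in> UNIV \<longrightarrow> t \<le> t' \<longrightarrow> t' < t + e \<longrightarrow> \<gamma> t' = (fst (\<gamma> t) + (t' - t) *\<^sub>R velocity (snd (\<gamma> t)), snd (\<gamma> t))"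
    using billiard_orbit_future[OF \<gamma>(1) UNIV_I[of t]] by (elim exE conjE) (rule that)
  note e = e(1) e(2)[rule_format, OF UNIV_I]
  have "((\<lambda>r. (fst (\<gamma> t) + (r - t) *\<^sub>R velocity (snd (\<gamma> t)), snd (\<gamma> t))) \<longlongrightarrow>
      (fst (\<gamma> t) + (t - t) *\<^sub>R velocity (snd (\<gamma> t)), snd (\<gamma> t))) (at_right t)"
    by (intro tendsto_intros)
  moreover have "\<forall>\<^sub>F r in at_right t. (fst (\<gamma> t) + (r - t) *\<^sub>R velocity (snd (\<gamma> t)), snd (\<gamma> t)) = \<gamma> r"
  proof (rule eventually_at_rightI[of t "t + e"])
    fix r assume "r \<in> {t<..<t + e}"
    then show "(fst (\<gamma> t) + (r - t) *\<^sub>R velocity (snd (\<gamma> t)), snd (\<gamma> t)) = \<gamma> r"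
      by (intro e(2)[symmetric]) auto
  qed (use e(1) in simp)
  ultimately have "(\<gamma> \<longlongrightarrow> (fst (\<gamma> t) + (t - t) *\<^sub>R velocity (snd (\<gamma> t)), snd (\<gamma> t))) (at_right t)"
    by (rule Lim_transform_eventually)
  then show ?thesis by (simp add: \<gamma>_eq)
qed (simp add: complete_flow_def)

end

section \<open>The billiard flow of K particles\<close>

lemma finite_directions: "finite (directions \<theta>)"
  by (simp add: directions_def)

lemma space_billiard_measure: "space (billiard_measure s g \<theta>) = table s g \<times> directions \<theta>"
  by (simp add: billiard_measure_def space_pair_measure space_restrict_space)

lemma sigma_finite_billiard_measure: "sigma_finite_measure (billiard_measure s g \<theta>)"
  unfolding billiard_measure_def
  by (intro sigma_finite_pair_measure sigma_finite_measure_restrict_space sigma_finite_lborel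
      sigma_finite_measure_count_space_finite finite_directions)
     (simp add: closed_table)

lemma billiard_measure_rectangle:
  assumes "B \<in> sets borel" "B \<subseteq> table s g" "D \<subseteq> directions \<theta>"
  shows "B \<times> D \<in> sets (billiard_measure s g \<theta>)"
    and "emeasure (billiard_measure s g \<theta>) (B \<times> D) = emeasure lborel B * of_nat (card D)"
proof -
  interpret D: sigma_finite_measure "count_space (directions \<theta>)"
    by (rule sigma_finite_measure_count_space_finite[OF finite_directions])
  have T: "table s g \<in> sets lborel" by (simp add: closed_table)
  have B: "B \<in> sets (restrict_space lborel (table s g))"
    using assms T by (subst sets_restrict_space_iff) auto
  then show "B \<times> D \<in> sets (billiard_measure s g \<theta>)"
    using assms(3) unfolding billiard_measure_def by (intro pair_measureI) auto
  have "finite D" using finite_directions finite_subset assms(3) by blast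
  then show "emeasure (billiard_measure s g \<theta>) (B \<times> D) = emeasure lborel B * of_nat (card D)"
    using assms B T unfolding billiard_measure_def
    by (subst D.emeasure_pair_measure_Times) (auto simp: emeasure_restrict_space emeasure_count_space)
qed

lemma measurable_fst_billiard_measure: "fst \<in> borel_measurable (billiard_measure s g \<theta>)"
proof -
  have "(\<lambda>z. z) \<in> restrict_space lborel (table s g) \<rightarrow>\<^sub>M borel"
    by (intro measurable_restrict_space1) simp
  from measurable_compose[OF measurable_fst this] show ?thesis
    by (simp add: billiard_measure_def)
qed

lemma measurable_snd_billiard_measure: "snd \<in> borel_measurable (billiard_measure s g \<theta>)"
  using measurable_compose[OF measurable_snd, of "\<lambda>z. z" "count_space (directions \<theta>)" borel]
  by (simp add: billiard_measure_def)

lemma measurable_into_billiard_measure: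
  assumes f: "(\<lambda>x. fst (f x)) \<in> borel_measurable M" "(\<lambda>x. snd (f x)) \<in> borel_measurable M"
    and space: "\<And>x. x \<in> space M \<Longrightarrow> f x \<in> table s g \<times> directions \<theta>"
  shows "f \<in> M \<rightarrow>\<^sub>M billiard_measure s g \<theta>"
  unfolding billiard_measure_def
proof (rule measurable_pair)
  show "fst \<circ> f \<in> M \<rightarrow>\<^sub>M restrict_space lborel (table s g)"
    using f(1) space by (intro measurable_restrict_space2) (auto simp: comp_def mem_Times_iff)
  have "(\<lambda>x. snd (f x)) -` {a} \<inter> space M \<in> sets M" for a
    by (rule measurable_sets[OF f(2)]) simp
  then show "snd \<circ> f \<in> M \<rightarrow>\<^sub>M count_space (directions \<theta>)"
    using space by (auto simp: measurable_count_space_eq2[OF finite_directions] comp_def mem_Times_iff)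
qed

text \<open>Meant for integrands along orbits when \<open>A\<close> is only Lebesgue measurable:
  they equal Borel functions at almost all times.\<close>

lemma borel_measurable_completion_cong_AE:
  assumes f: "f \<in> borel_measurable (completion M)" and ae: "AE x in M. f x = h x"
  shows "h \<in> borel_measurable (completion M)"
proof (rule measurableI)
  fix S :: "'b set" assume "S \<in> sets borel"
  then have S: "f -` S \<inter> space (completion M) \<in> sets (completion M)" by (rule measurable_sets[OF f])
  have "AE x in completion M. x \<in> f -` S \<inter> space (completion M) \<longleftrightarrow> x \<in> h -` S \<inter> space (completion M)"
    using AE_completion[OF ae] by eventually_elim auto
  then show "h -` S \<inter> space (completion M) \<in> sets (completion M)"
    by (rule completion.in_sets_AE[OF _ S]) blast
qed simp

section \<open>Counting functions and their space integrals\<close>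

lemma num_in_direction_within_le: "num_in_direction_within K A i x \<le> K"
proof -
  have "card {k. k < K \<and> snd (x k) = i} \<le> card {..<K}" by (intro card_mono) auto
  then show ?thesis by (simp add: num_in_direction_within_def num_in_direction_def)
qed

text \<open>The event that particle \<open>k\<close> points in direction \<open>i\<close> while all
  particles lie in \<open>B\<close>. The counting function is the sum of the indicators of these
  boxes, which yields its measurability and its integral together.\<close>

definition direction_box :: "complex \<Rightarrow> nat \<Rightarrow> complex set \<Rightarrow> complex \<Rightarrow> nat \<Rightarrow> (nat \<Rightarrow> complex \<times> complex) set" where
  "direction_box \<theta> K B i k = (\<Pi>\<^sub>E l\<in>{..<K}. B \<times> (if l = k then {i} else directions \<theta>))"

lemma num_in_direction_within_eq_sum:
  assumes x: "x \<in> space (Pi\<^sub>M {..<K} (\<lambda>_. billiard_measure s g \<theta>))"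
  shows "real (num_in_direction_within K B i x) = (\<Sum>k<K. indicator (direction_box \<theta> K B i k) x)"
proof -
  have ext: "x \<in> extensional {..<K}" and snd: "\<And>l. l < K \<Longrightarrow> snd (x l) \<in> directions \<theta>"
    using x by (auto simp: space_PiM space_billiard_measure PiE_iff mem_Times_iff)
  have box: "x \<in> direction_box \<theta> K B i k \<longleftrightarrow> (\<forall>l<K. fst (x l) \<in> B) \<and> snd (x k) = i" if "k < K" for k
    using that ext snd unfolding direction_box_def PiE_iff by (auto simp: mem_Times_iff)
  show ?thesis
  proof (cases "\<forall>l<K. fst (x l) \<in> B")
    case True
    have "(\<Sum>k<K. indicator (direction_box \<theta> K B i k) x) = (\<Sum>k<K. if snd (x k) = i then 1 else 0 :: real)"
      using box True by (intro sum.cong) (auto simp: indicator_def)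
    also have "\<dots> = real (card {k. k < K \<and> snd (x k) = i})"
      by (simp add: sum.If_cases Int_def lessThan_def)
    finally show ?thesis using True by (simp add: num_in_direction_within_def num_in_direction_def)
  next
    case False
    then have "(\<Sum>k<K. indicator (direction_box \<theta> K B i k) x) = (0 :: real)"
      using box by (intro sum.neutral) (auto simp: indicator_def)
    moreover have "num_in_direction_within K B i x = 0"
      using False by (auto simp: num_in_direction_within_def)
    ultimately show ?thesis by simp
  qed
qed

context
  fixes s :: real and g :: "complex set" and \<theta> :: complex
  assumes g: "g \<in> Conf s" and s: "s > 0"
    and index: "infinite_ergodic_index (billiard_measure s g \<theta>) (billiard_flow s g \<theta>)"
begin

interpretation billiard: infinitely_ergodic_flow "billiard_measure s g \<theta>" "billiard_flow s g \<theta>"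
  "complete_flow s g \<theta>" "complete_states s g \<theta>"
proof (intro infinitely_ergodic_flow.intro infinitely_ergodic_flow_axioms.intro)
  show "sigma_finite_measure (billiard_measure s g \<theta>)" by (rule sigma_finite_billiard_measure)
  show "complete_flow s g \<theta> 0 x = x" for x by (rule complete_flow_zero[OF g s])
  show "complete_flow s g \<theta> (t + r) x = complete_flow s g \<theta> t (complete_flow s g \<theta> r x)" for t r x
    by (rule complete_flow_add[OF g s])
  show "billiard_flow s g \<theta> t x = Some (complete_flow s g \<theta> t x)" "complete_flow s g \<theta> t x \<in> complete_states s g \<theta>"
    if "x \<in> complete_states s g \<theta>" for t x
    using complete_states_flow[OF g s that] by auto
  show "complete_flow s g \<theta> t x \<in> space (billiard_measure s g \<theta>)"
    if "x \<in> space (billiard_measure s g \<theta>)" for t x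
  proof (cases "x \<in> complete_states s g \<theta>")
    case True
    from complete_states_phase_space[OF g s complete_states_flow(2)[OF g s True]] show ?thesis
      by (auto simp: phase_space_def space_billiard_measure mem_Times_iff case_prod_beta)
  qed (use that in \<open>simp add: complete_flow_def\<close>)
  show "x \<in> complete_states s g \<theta>" if "billiard_flow s g \<theta> t x = Some y" "y \<in> complete_states s g \<theta>" for t x y
    by (rule complete_states_preimage[OF g s that])
  show "x \<in> complete_states s g \<theta>"
    if "\<And>n::nat. billiard_flow s g \<theta> (real n) x \<noteq> None" "\<And>n::nat. billiard_flow s g \<theta> (- real n) x \<noteq> None" for x
    by (rule complete_statesI_integer_times[OF g s that])
qed (rule index)

abbreviation (input) "P K \<equiv> billiard.power_measure K"
abbreviation (input) "\<Phi> K \<equiv> billiard.power_flow K"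

text \<open>Coordinatewise, position and direction are measurable in the state for the completed
  measure and right continuous in time, so \<open>borel_measurable_right_continuous\<close> applies
  to each.\<close>

lemma measurable_power_flow:
  assumes K: "K \<ge> 1"
  shows "(\<lambda>(t, x). \<Phi> K t x) \<in> lborel \<Otimes>\<^sub>M completion (P K) \<rightarrow>\<^sub>M P K"
proof -
  interpret A: almost_complete_flow "P K" "product_flow K (billiard_flow s g \<theta>)" "\<Phi> K" "billiard.power_complete K"
    by (rule billiard.almost_complete_flow_power[OF K])
  let ?\<phi> = "complete_flow s g \<theta>"
  have "(\<lambda>z. \<lambda>k\<in>{..<K}. ?\<phi> (fst z) (snd z k)) \<in> lborel \<Otimes>\<^sub>M completion (P K) \<rightarrow>\<^sub>M P K"
  proof (rule measurable_restrict)
    fix k assume k: "k \<in> {..<K}"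
    have eq: "\<Phi> K t x k = ?\<phi> t (x k)" for t x using k by (simp add: billiard.power_flow_def)
    have coord: "(\<lambda>x. h (?\<phi> t (x k))) \<in> borel_measurable (completion (P K))"
      if h: "h \<in> borel_measurable (billiard_measure s g \<theta>)" for t and h :: "_ \<Rightarrow> complex"
      using measurable_compose[OF measurable_compose[OF A.measurable_completion_flow measurable_component_singleton[OF k]] h]
      by (simp add: eq)
    have joint: "(\<lambda>z. h (?\<phi> (fst z) (snd z k))) \<in> borel_measurable (lborel \<Otimes>\<^sub>M completion (P K))"
      if h: "h \<in> borel_measurable (billiard_measure s g \<theta>)"
        and lim: "\<And>t x. ((\<lambda>r. h (?\<phi> r x)) \<longlongrightarrow> h (?\<phi> t x)) (at_right t)" for h :: "_ \<Rightarrow> complex"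
      using borel_measurable_right_continuous[of "\<lambda>t x. h (?\<phi> t (x k))" "completion (P K)"] coord[OF h] lim
      by (simp add: case_prod_beta)
    show "(\<lambda>z. ?\<phi> (fst z) (snd z k)) \<in> lborel \<Otimes>\<^sub>M completion (P K) \<rightarrow>\<^sub>M billiard_measure s g \<theta>"
    proof (rule measurable_into_billiard_measure)
      show "(\<lambda>z. fst (?\<phi> (fst z) (snd z k))) \<in> borel_measurable (lborel \<Otimes>\<^sub>M completion (P K))"
        by (rule joint[OF measurable_fst_billiard_measure tendsto_fst[OF complete_flow_right_continuous[OF g s]]])
      show "(\<lambda>z. snd (?\<phi> (fst z) (snd z k))) \<in> borel_measurable (lborel \<Otimes>\<^sub>M completion (P K))"
        by (rule joint[OF measurable_snd_billiard_measure tendsto_snd[OF complete_flow_right_continuous[OF g s]]])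
      fix z :: "real \<times> (nat \<Rightarrow> complex \<times> complex)" assume "z \<in> space (lborel \<Otimes>\<^sub>M completion (P K))"
      then have "snd z \<in> space (P K)" by (simp add: space_pair_measure mem_Times_iff)
      then have "snd z k \<in> space (billiard_measure s g \<theta>)"
        using k by (auto simp: space_PiM)
      from billiard.in_space[OF this] show "?\<phi> (fst z) (snd z k) \<in> table s g \<times> directions \<theta>"
        by (simp add: space_billiard_measure)
    qed
  qed
  then show ?thesis by (simp add: billiard.power_flow_def case_prod_beta)
qed

text \<open>At each fixed time almost every state avoids \<open>Z\<close>, because the flow
  preserves the measure; Fubini exchanges "every time, almost every state" for "almost every state,
  almost every time".\<close>

lemma AE_orbit_avoids_null_set:
  assumes K: "K \<ge> 1" and Z: "Z \<in> null_sets lborel"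
  shows "AE x in P K. AE t in lborel. \<forall>k<K. fst (\<Phi> K t x k) \<notin> Z"
proof -
  interpret A: almost_complete_flow "P K" "product_flow K (billiard_flow s g \<theta>)" "\<Phi> K" "billiard.power_complete K"
    by (rule billiard.almost_complete_flow_power[OF K])
  interpret L: pair_sigma_finite lborel "completion (P K)"
    by (rule A.completed.pair_sigma_finite_lborel)
  let ?m = "billiard_measure s g \<theta>"
  let ?Z = "\<lambda>k. \<Pi>\<^sub>E l\<in>{..<K}. (if l = k then Z \<inter> table s g else table s g) \<times> directions \<theta>"
  have Z': "Z \<inter> table s g \<in> null_sets lborel" and ZB: "Z \<inter> table s g \<in> sets borel"
    using Z by (auto simp: closed_table intro: null_set_Int2)
  have T: "table s g \<in> sets borel" by (simp add: closed_table)
  have rect: "(if l = k then Z \<inter> table s g else table s g) \<times> directions \<theta> \<in> sets ?m" for l k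
    using ZB T by (auto intro!: billiard_measure_rectangle)
  have null: "?Z k \<in> null_sets (P K)" if "k < K" for k
  proof
    show "?Z k \<in> sets (P K)" by (intro sets_PiM_I_finite rect) simp
    have "emeasure (P K) (?Z k) = (\<Prod>l<K. emeasure ?m ((if l = k then Z \<inter> table s g else table s g) \<times> directions \<theta>))"
      by (intro billiard.emeasure_PiM rect) simp
    also have "\<dots> = 0"
    \<comment> \<open>The other factors may be infinite; in \<open>ennreal\<close> a single factor 0
      still makes the product 0.\<close>
    proof (rule prod_zero)
      show "\<exists>l\<in>{..<K}. emeasure ?m ((if l = k then Z \<inter> table s g else table s g) \<times> directions \<theta>) = 0"
        using that Z' billiard_measure_rectangle(2)[OF ZB, of s g "directions \<theta>" \<theta>] by (intro bexI[of _ k]) auto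
    qed simp
    finally show "emeasure (P K) (?Z k) = 0" .
  qed
  let ?B = "{x\<in>space (P K). \<forall>k<K. fst (x k) \<notin> Z}"
  have B_eq: "?B = space (P K) - (\<Union>k<K. ?Z k)"
  proof -
    have "x \<in> ?Z k \<longleftrightarrow> fst (x k) \<in> Z" if x: "x \<in> space (P K)" and k: "k < K" for x k
    proof -
      have ext: "x \<in> extensional {..<K}"
        and mem: "\<And>l. l < K \<Longrightarrow> fst (x l) \<in> table s g" "\<And>l. l < K \<Longrightarrow> snd (x l) \<in> directions \<theta>"
        using x by (auto simp: space_PiM space_billiard_measure PiE_iff mem_Times_iff)
      have "x \<in> ?Z k \<longleftrightarrow> (\<forall>l<K. fst (x l) \<in> (if l = k then Z \<inter> table s g else table s g))"
        using ext mem(2) by (auto simp: PiE_iff mem_Times_iff)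
      also have "\<dots> \<longleftrightarrow> fst (x k) \<in> Z"
        using mem(1) k by (metis IntD1 IntI)
      finally show ?thesis .
    qed
    then show ?thesis by blast
  qed
  have B: "?B \<in> sets (P K)" unfolding B_eq using null by (intro sets.Diff sets.finite_UN) auto
  have "(\<Union>k<K. ?Z k) \<in> null_sets (P K)" using null by (intro null_sets_UN') auto
  from AE_not_in[OF this] AE_space have "AE x in P K. x \<in> ?B"
    unfolding B_eq by eventually_elim auto
  then have "AE x in completion (P K). x \<in> ?B" by (rule AE_completion)
  from A.completed.AE_flow[OF this] have "AE t in lborel. AE x in completion (P K). \<Phi> K t x \<in> ?B"
    by (rule AE_I2)
  \<comment> \<open>Exchanging the two almost-everywhere quantifiers requires the set of good pairs
    of time and state to be jointly measurable.\<close>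
  moreover have "{z \<in> space (lborel \<Otimes>\<^sub>M completion (P K)). \<Phi> K (fst z) (snd z) \<in> ?B} \<in> sets (lborel \<Otimes>\<^sub>M completion (P K))"
    using measurable_sets[OF measurable_power_flow[OF K] B] by (simp add: vimage_def Int_def case_prod_beta conj_commute)
  ultimately have "AE x in completion (P K). AE t in lborel. \<Phi> K t x \<in> ?B"
    using L.AE_commute[of "\<lambda>t x. \<Phi> K t x \<in> ?B"] by blast
  then have "AE x in completion (P K). AE t in lborel. \<forall>k<K. fst (\<Phi> K t x k) \<notin> Z"
    by (rule AE_mp) (auto intro!: AE_I2)
  then show ?thesis unfolding AE_completion_iff .
qed

text \<open>The value does not involve \<open>i\<close>, which is why the limiting ratio is 1. The
  cardinality stays symbolic because directions coincide when \<open>\<theta>\<close> is real or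
  purely imaginary.\<close>

lemma direction_box_measure:
  assumes B: "B \<in> sets borel" "B \<subseteq> table s g" and i: "i \<in> directions \<theta>"
  shows "direction_box \<theta> K B i k \<in> sets (P K)"
    and "emeasure (P K) (direction_box \<theta> K B i k) =
      (\<Prod>l<K. emeasure lborel B * of_nat (if l = k then 1 else card (directions \<theta>)))"
proof -
  have sub: "(if l = k then {i} else directions \<theta>) \<subseteq> directions \<theta>" for l using i by auto
  note rect = billiard_measure_rectangle[OF B sub]
  show "direction_box \<theta> K B i k \<in> sets (P K)"
    unfolding direction_box_def by (intro sets_PiM_I_finite rect(1)) simp
  have "emeasure (P K) (direction_box \<theta> K B i k) =
      (\<Prod>l<K. emeasure (billiard_measure s g \<theta>) (B \<times> (if l = k then {i} else directions \<theta>)))"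
    unfolding direction_box_def by (intro billiard.emeasure_PiM rect(1)) simp
  also have "\<dots> = (\<Prod>l<K. emeasure lborel B * of_nat (if l = k then 1 else card (directions \<theta>)))"
    by (intro prod.cong) (auto simp: rect(2))
  finally show "emeasure (P K) (direction_box \<theta> K B i k) =
      (\<Prod>l<K. emeasure lborel B * of_nat (if l = k then 1 else card (directions \<theta>)))" .
qed

lemma integral_num_in_direction_within:
  assumes B: "B \<in> sets borel" "B \<subseteq> table s g" and i: "i \<in> directions \<theta>"
    and fin: "emeasure lborel B < \<infinity>"
  shows "integrable (P K) (\<lambda>x. real (num_in_direction_within K B i x))"
    and "(\<integral>x. real (num_in_direction_within K B i x) \<partial>P K) =
      (\<Sum>k<K. enn2real (\<Prod>l<K. emeasure lborel B * of_nat (if l = k then 1 else card (directions \<theta>))))"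
proof -
  note box = direction_box_measure[OF B i]
  have less: "emeasure (P K) (direction_box \<theta> K B i k) < \<infinity>" for k
    unfolding box(2) using fin
    by (auto simp: less_top[symmetric] ennreal_prod_eq_top ennreal_mult_eq_top_iff)
  have int: "integrable (P K) (indicator (direction_box \<theta> K B i k) :: _ \<Rightarrow> real)" for k
    using box(1) less by (intro integrable_real_indicator) auto
  have "integrable (P K) (\<lambda>x. \<Sum>k<K. indicator (direction_box \<theta> K B i k) x :: real)"
    using int by (intro Bochner_Integration.integrable_sum) auto
  then show "integrable (P K) (\<lambda>x. real (num_in_direction_within K B i x))"
    by (rule Bochner_Integration.integrable_cong[THEN iffD1, rotated 2])
       (simp_all add: num_in_direction_within_eq_sum)
  have "(\<integral>x. real (num_in_direction_within K B i x) \<partial>P K) =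
      (\<integral>x. (\<Sum>k<K. indicator (direction_box \<theta> K B i k) x) \<partial>P K)"
    by (intro Bochner_Integration.integral_cong) (simp_all add: num_in_direction_within_eq_sum)
  also have "\<dots> = (\<Sum>k<K. measure (P K) (direction_box \<theta> K B i k))"
    using int box(1) by (subst Bochner_Integration.integral_sum) (auto simp: sets.Int_space_eq2)
  finally show "(\<integral>x. real (num_in_direction_within K B i x) \<partial>P K) =
      (\<Sum>k<K. enn2real (\<Prod>l<K. emeasure lborel B * of_nat (if l = k then 1 else card (directions \<theta>))))"
    by (simp only: measure_def box(2))
qed

text \<open>The ratio theorem with the counting functions as observables, bounded by
  \<open>K\<close>. The measurability along orbits is recorded for the passage to Lebesgue
  sets.\<close>

lemma direction_ratio_borel:
  assumes K: "K \<ge> 1" and B: "B \<in> sets borel" "B \<subseteq> table s g"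
    and pos: "0 < emeasure lborel B" "emeasure lborel B < \<infinity>"
    and i: "i \<in> directions \<theta>" and j: "j \<in> directions \<theta>"
  shows "AE x in P K. ((\<lambda>T. (LBINT t:{0..T}. real (num_in_direction_within K B i (\<Phi> K t x))) /
      (LBINT t:{0..T}. real (num_in_direction_within K B j (\<Phi> K t x)))) \<longlongrightarrow> 1) at_top"
    and "\<And>x i. x \<in> space (P K) \<Longrightarrow> i \<in> directions \<theta> \<Longrightarrow>
      (\<lambda>t. real (num_in_direction_within K B i (\<Phi> K t x))) \<in> borel_measurable lborel"
proof -
  interpret A: almost_complete_flow "P K" "product_flow K (billiard_flow s g \<theta>)" "\<Phi> K" "billiard.power_complete K"
    by (rule billiard.almost_complete_flow_power[OF K])
  let ?f = "\<lambda>i x. real (num_in_direction_within K B i x)"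
  note int = integral_num_in_direction_within[OF B _ pos(2)]
  have meas: "?f i \<in> borel_measurable (P K)" if "i \<in> directions \<theta>" for i
    by (rule borel_measurable_integrable[OF int(1)[OF that]])
  have obs: "A.completed.observable (?f i)" if "i \<in> directions \<theta>" for i
    unfolding A.completed.observable_def
    using measurable_compose[OF measurable_power_flow[OF K] meas[OF that]] by (simp add: case_prod_beta)
  show "(\<lambda>t. ?f i (\<Phi> K t x)) \<in> borel_measurable lborel" if "x \<in> space (P K)" "i \<in> directions \<theta>" for x i
    using A.completed.observable_measurable_orbit[OF obs[OF that(2)]] that(1) by simp
  have integrable: "integrable (completion (P K)) (?f i)" if "i \<in> directions \<theta>" for i
    using int(1)[OF that] by (simp add: integrable_completion[OF meas[OF that]])
  have integral: "(\<integral>x. ?f i x \<partial>completion (P K)) =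
      (\<Sum>k<K. enn2real (\<Prod>l<K. emeasure lborel B * of_nat (if l = k then 1 else card (directions \<theta>))))"
    if "i \<in> directions \<theta>" for i
    using int(2)[OF that] by (simp add: integral_completion[OF meas[OF that]])
  have card: "card (directions \<theta>) \<noteq> 0"
    using i finite_directions[of \<theta>] by (auto simp: card_eq_0_iff)
  have "0 < enn2real (\<Prod>l<K. emeasure lborel B * of_nat (if l = k then 1 else card (directions \<theta>)))" for k
  proof -
    have "emeasure lborel B \<noteq> 0" "emeasure lborel B \<noteq> top" using pos by auto
    then have "(\<Prod>l<K. emeasure lborel B * of_nat (if l = k then 1 else card (directions \<theta>))) \<noteq> 0"
      "(\<Prod>l<K. emeasure lborel B * of_nat (if l = k then 1 else card (directions \<theta>))) \<noteq> top"
      using card by (simp_all add: ennreal_prod_eq_top ennreal_mult_eq_top_iff)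
    then show ?thesis
      by (intro enn2real_positive_iff[THEN iffD2] conjI zero_less_iff_neq_zero[THEN iffD2] top.not_eq_extremum[THEN iffD1])
  qed
  then have integral_pos: "0 < (\<integral>x. ?f j x \<partial>completion (P K))"
    unfolding integral[OF j] using K by (intro sum_pos) (auto simp: lessThan_empty_iff bot_nat_def)
  have "AE x in completion (P K). ((\<lambda>T. A.completed.orbit_integral (?f i) 0 T x / A.completed.orbit_integral (?f j) 0 T x) \<longlongrightarrow>
      (\<integral>x. ?f i x \<partial>completion (P K)) / (\<integral>x. ?f j x \<partial>completion (P K))) at_top"
    by (rule A.completed.hopf_ratio_ergodic[where c="real K" and d="real K"])
       (use billiard.power_ergodic[OF K] billiard.power_doubly_ergodic[OF K] obs integrable i j integral_pos
         num_in_direction_within_le in auto)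
  moreover have "(\<integral>x. ?f i x \<partial>completion (P K)) / (\<integral>x. ?f j x \<partial>completion (P K)) = 1"
    using integral[OF i] integral[OF j] integral_pos by simp
  ultimately show "AE x in P K. ((\<lambda>T. (LBINT t:{0..T}. ?f i (\<Phi> K t x)) / (LBINT t:{0..T}. ?f j (\<Phi> K t x))) \<longlongrightarrow> 1) at_top"
    by (simp add: AE_completion_iff A.completed.orbit_integral_def)
qed

lemma direction_ratio:
  assumes K: "K \<ge> 1" and A: "A \<in> sets lebesgue" "A \<subseteq> table s g"
    and pos: "0 < emeasure lebesgue A" "emeasure lebesgue A < \<infinity>"
    and i: "i \<in> directions \<theta>" and j: "j \<in> directions \<theta>"
  shows "AE x in P K. (\<forall>t\<ge>0. product_flow K (billiard_flow s g \<theta>) t x \<noteq> None) \<and>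
    ((\<lambda>T. (LINT t:{0..T}|lebesgue. real (num_in_direction_within K A i
             (the (product_flow K (billiard_flow s g \<theta>) t x)))) /
          (LINT t:{0..T}|lebesgue. real (num_in_direction_within K A j
             (the (product_flow K (billiard_flow s g \<theta>) t x))))) \<longlongrightarrow> 1) at_top"
proof -
  interpret A: almost_complete_flow "P K" "product_flow K (billiard_flow s g \<theta>)" "\<Phi> K" "billiard.power_complete K"
    by (rule billiard.almost_complete_flow_power[OF K])
  \<comment> \<open>\<open>A\<close> is a Borel set \<open>B\<close> enlarged by part of a null set
    \<open>Z\<close>; in particular \<open>B\<close> lies in the table.\<close>
  obtain B Y Z where AB: "A = B \<union> Y" "Y \<subseteq> Z" and Z: "Z \<in> null_sets lborel" and B: "B \<in> sets lborel"
    using A(1) by (rule sets_completionE)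
  have ae: "AE x in lborel. x \<in> B \<longleftrightarrow> x \<in> A"
    using AE_not_in[OF Z] by eventually_elim (use AB in auto)
  have "emeasure lebesgue A = emeasure lborel B"
    using emeasure_eq_AE[OF AE_completion[OF ae]] A(1) B by simp
  with pos have pos': "0 < emeasure lborel B" "emeasure lborel B < \<infinity>" by simp_all
  have B': "B \<in> sets borel" "B \<subseteq> table s g" using A(2) AB B by auto
  note borel = direction_ratio_borel[OF K B' pos']
  \<comment> \<open>If the orbit avoids \<open>Z\<close> at almost all times, \<open>A\<close> and
    \<open>B\<close> give the same integrand almost everywhere, so the integrals agree for every
    \<open>T\<close>.\<close>
  have eq: "(LINT t:{0..T}|lebesgue. real (num_in_direction_within K A n (the (product_flow K (billiard_flow s g \<theta>) t x)))) =
      (LBINT t:{0..T}. real (num_in_direction_within K B n (\<Phi> K t x)))"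
    if x: "x \<in> space (P K)" "x \<in> billiard.power_complete K" and n: "n \<in> directions \<theta>"
      and avoid: "AE t in lborel. \<forall>k<K. fst (\<Phi> K t x k) \<notin> Z" for x n T
  proof -
    let ?a = "\<lambda>t. indicator {0..T} t *\<^sub>R real (num_in_direction_within K A n (\<Phi> K t x))"
    let ?b = "\<lambda>t. indicator {0..T} t *\<^sub>R real (num_in_direction_within K B n (\<Phi> K t x))"
    have [measurable]: "(\<lambda>t. real (num_in_direction_within K B n (\<Phi> K t x))) \<in> borel_measurable borel"
      using borel(2)[OF i j x(1) n] by simp
    have b: "?b \<in> borel_measurable lborel" by measurable
    have ab: "AE t in lborel. ?b t = ?a t"
      using avoid
    proof eventually_elim
      case (elim t)
      then have "fst (\<Phi> K t x k) \<in> A \<longleftrightarrow> fst (\<Phi> K t x k) \<in> B" if "k < K" for k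
        using AB that by auto
      then show ?case by (auto simp: num_in_direction_within_def)
    qed
    have a: "?a \<in> borel_measurable lebesgue"
      by (rule borel_measurable_completion_cong_AE[OF measurable_completion[OF b] ab])
    have "(LINT t:{0..T}|lebesgue. real (num_in_direction_within K A n (the (product_flow K (billiard_flow s g \<theta>) t x)))) =
        (\<integral>t. ?a t \<partial>lebesgue)"
      using billiard.product_flow_complete[OF x(2)] by (simp add: set_lebesgue_integral_def)
    also have "\<dots> = (\<integral>t. ?b t \<partial>lebesgue)"
      using a measurable_completion[OF b] AE_completion[OF ab] by (intro integral_cong_AE) auto
    also have "\<dots> = (\<integral>t. ?b t \<partial>lborel)" by (rule integral_completion[OF b])
    finally show ?thesis by (simp add: set_lebesgue_integral_def)
  qed
  show ?thesis
    using borel(1)[OF i j] A.AE_complete AE_orbit_avoids_null_set[OF K Z] AE_space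
  proof eventually_elim
    case (elim x)
    then show ?case
      using eq[OF elim(4,2) i elim(3)] eq[OF elim(4,2) j elim(3)]
        billiard.product_flow_complete[OF elim(2)] by simp
  qed
qed

end

section \<open>The metric on configurations\<close>

text \<open>The defining equation of \<open>Metric_space.mtopology\<close> is available for metrics only, so that even
  \<open>G \<subseteq> Conf s\<close> requires \<open>conf_dist\<close> to be one.\<close>

lemma arccos_inner_triangle:
  fixes x y z :: "'a::real_inner"
  assumes "norm x = 1" "norm y = 1" "norm z = 1"
  shows "arccos (x \<bullet> y) \<le> arccos (x \<bullet> z) + arccos (z \<bullet> y)"
proof -
  have bounds: "- 1 \<le> v \<bullet> w" "v \<bullet> w \<le> 1" if "norm v = 1" "norm w = 1" for v w :: 'a
    using Cauchy_Schwarz_ineq2[of v w] that by auto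
  define a b where "a = arccos (x \<bullet> z)" and "b = arccos (z \<bullet> y)"
  have cos: "cos a = x \<bullet> z" "cos b = z \<bullet> y" and range: "0 \<le> a" "a \<le> pi" "0 \<le> b" "b \<le> pi"
    using bounds[OF assms(1,3)] bounds[OF assms(3,2)]
    by (auto simp: a_def b_def intro: arccos_lbound arccos_ubound)
  show ?thesis
  proof (cases "a + b \<le> pi")
    case True
    \<comment> \<open>The components of \<open>x\<close> and \<open>y\<close> orthogonal to
      \<open>z\<close>, with norms \<open>sin a\<close> and \<open>sin b\<close>; the Cauchy-Schwarz
      inequality for them becomes \<open>cos (a + b) \<le> x \<bullet> y\<close>.\<close>
    define u v where "u = x - (x \<bullet> z) *\<^sub>R z" and "v = y - (z \<bullet> y) *\<^sub>R z"
    have unit: "x \<bullet> x = 1" "y \<bullet> y = 1" "z \<bullet> z = 1"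
      using assms by (simp_all add: dot_square_norm)
    have "u \<bullet> u = 1 - (cos a)\<^sup>2" "v \<bullet> v = 1 - (cos b)\<^sup>2"
      unfolding cos u_def v_def by (simp_all add: inner_diff_left inner_diff_right unit inner_commute power2_eq_square)
    then have "(norm u)\<^sup>2 = 1 - (cos a)\<^sup>2" "(norm v)\<^sup>2 = 1 - (cos b)\<^sup>2"
      by (simp_all only: power2_norm_eq_inner)
    then have "(norm u)\<^sup>2 = (sin a)\<^sup>2" "(norm v)\<^sup>2 = (sin b)\<^sup>2"
      by (simp_all add: sin_squared_eq)
    then have "norm u = sin a" "norm v = sin b"
      using range sin_ge_zero by (auto simp: power2_eq_iff_nonneg)
    then have "- (sin a * sin b) \<le> u \<bullet> v"
      using Cauchy_Schwarz_ineq2[of u v] by auto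
    moreover have "u \<bullet> v = x \<bullet> y - cos a * cos b"
      unfolding cos by (simp add: u_def v_def inner_diff_left inner_diff_right unit inner_commute)
    ultimately have "cos (a + b) \<le> x \<bullet> y" by (simp add: cos_add)
    then have "arccos (x \<bullet> y) \<le> arccos (cos (a + b))"
      using bounds[OF assms(1,2)] by (intro arccos_le_arccos) auto
    also have "\<dots> = a + b" using True range by (intro arccos_cos) auto
    finally show ?thesis by (simp add: a_def b_def)
  next
    case False
    then show ?thesis using arccos_ubound[of "x \<bullet> y"] bounds[OF assms(1,2)] by (simp add: a_def b_def)
  qed
qed

section \<open>The Hausdorff distance on the sphere\<close>

lemma geodesic_dist_commute: "geodesic_dist x y = geodesic_dist y x"
  by (simp add: geodesic_dist_def inner_commute)

lemma geodesic_dist_range: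
  assumes "norm x = 1" "norm y = 1"
  shows "0 \<le> geodesic_dist x y" "geodesic_dist x y \<le> pi"
  using Cauchy_Schwarz_ineq2[of x y] assms by (auto simp: geodesic_dist_def intro: arccos_lbound arccos_ubound)

lemma geodesic_dist_self: "norm x = 1 \<Longrightarrow> geodesic_dist x x = 0"
  by (simp add: geodesic_dist_def dot_square_norm)

text \<open>The bound \<open>c\<close> makes the suprema in the Hausdorff distance suprema of
  bounded sets of reals.\<close>

locale bounded_pseudometric =
  fixes S :: "'a set" and d :: "'a \<Rightarrow> 'a \<Rightarrow> real" and c :: real
  assumes nonneg: "x \<in> S \<Longrightarrow> y \<in> S \<Longrightarrow> 0 \<le> d x y"
    and bounded: "x \<in> S \<Longrightarrow> y \<in> S \<Longrightarrow> d x y \<le> c"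
    and commute: "x \<in> S \<Longrightarrow> y \<in> S \<Longrightarrow> d x y = d y x"
    and triangle: "x \<in> S \<Longrightarrow> y \<in> S \<Longrightarrow> z \<in> S \<Longrightarrow> d x y \<le> d x z + d z y"
    and self: "x \<in> S \<Longrightarrow> d x x = 0"
begin

text \<open>The one-sided, or directed, Hausdorff distance.\<close>

definition excess :: "'a set \<Rightarrow> 'a set \<Rightarrow> real" where
  "excess A B = (SUP x\<in>A. INF y\<in>B. d x y)"

lemma bdd_below: "x \<in> S \<Longrightarrow> B \<subseteq> S \<Longrightarrow> bdd_below (d x ` B)"
  using nonneg by (intro bdd_belowI2[of _ 0]) auto

lemma INF_le: "x \<in> S \<Longrightarrow> B \<subseteq> S \<Longrightarrow> y \<in> B \<Longrightarrow> (INF y\<in>B. d x y) \<le> d x y"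
  by (intro cINF_lower bdd_below)

lemma INF_nonneg: "x \<in> S \<Longrightarrow> B \<subseteq> S \<Longrightarrow> B \<noteq> {} \<Longrightarrow> 0 \<le> (INF y\<in>B. d x y)"
  using nonneg by (intro cINF_greatest) auto

lemma INF_le_excess:
  assumes "A \<subseteq> S" "B \<subseteq> S" "B \<noteq> {}" "x \<in> A"
  shows "(INF y\<in>B. d x y) \<le> excess A B"
  unfolding excess_def
proof (rule cSUP_upper[OF assms(4)], rule bdd_aboveI2[of _ _ c])
  fix x assume "x \<in> A"
  obtain y where "y \<in> B" using assms by blast
  then show "(INF y\<in>B. d x y) \<le> c"
    using INF_le[of x B y] bounded[of x y] assms \<open>x \<in> A\<close> by force
qed

lemma excess_nonneg:
  assumes "A \<subseteq> S" "B \<subseteq> S" "A \<noteq> {}" "B \<noteq> {}"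
  shows "0 \<le> excess A B"
proof -
  obtain x where "x \<in> A" using assms by blast
  then show ?thesis using INF_le_excess[OF assms(1,2,4)] INF_nonneg[of x B] assms by force
qed

lemma excess_triangle:
  assumes A: "A \<subseteq> S" "A \<noteq> {}" and B: "B \<subseteq> S" "B \<noteq> {}" and C: "C \<subseteq> S" "C \<noteq> {}"
  shows "excess A C \<le> excess A B + excess B C"
  unfolding excess_def[of A C]
proof (rule cSUP_least[OF A(2)])
  fix x assume x: "x \<in> A"
  have "(INF z\<in>C. d x z) - excess B C \<le> d x y" if y: "y \<in> B" for y
  proof -
    have "(INF z\<in>C. d x z) - d x y \<le> (INF z\<in>C. d y z)"
    proof (rule cINF_greatest[OF C(2)])
      fix z assume z: "z \<in> C"
      have "(INF z\<in>C. d x z) \<le> d x z" using INF_le[of x C z] x z A C by blast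
      also have "\<dots> \<le> d x y + d y z" using triangle[of x z y] x y z A B C by blast
      finally show "(INF z\<in>C. d x z) - d x y \<le> d y z" by simp
    qed
    also have "\<dots> \<le> excess B C" by (rule INF_le_excess[OF B(1) C y])
    finally show ?thesis by simp
  qed
  then have "(INF z\<in>C. d x z) - excess B C \<le> (INF y\<in>B. d x y)" using B by (intro cINF_greatest) auto
  also have "\<dots> \<le> excess A B" by (rule INF_le_excess[OF A(1) B x])
  finally show "(INF z\<in>C. d x z) \<le> excess A B + excess B C" by simp
qed

lemma hausdorff_dist_eq_excess:
  assumes "A \<subseteq> S" "B \<subseteq> S"
  shows "hausdorff_dist d A B = max (excess A B) (excess B A)"
proof -
  have "(INF x\<in>A. d x y) = (INF x\<in>A. d y x)" if "y \<in> B" for y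
    using assms that commute by (intro arg_cong[where f=Inf] image_cong) auto
  then have "(SUP y\<in>B. INF x\<in>A. d x y) = excess B A"
    unfolding excess_def by (intro arg_cong[where f=Sup] image_cong) auto
  then show ?thesis by (simp add: hausdorff_dist_def excess_def)
qed

lemma excess_self:
  assumes "A \<subseteq> S" "A \<noteq> {}"
  shows "excess A A = 0"
proof (rule antisym)
  show "excess A A \<le> 0"
    unfolding excess_def using assms INF_le[of _ A] self
    by (intro cSUP_least) (auto, metis subsetD)
qed (use assms excess_nonneg in auto)

end

interpretation geodesic: bounded_pseudometric "sphere 0 1" geodesic_dist pi
proof
  fix x y z :: "complex \<times> real"
  assume "x \<in> sphere 0 1" "y \<in> sphere 0 1" "z \<in> sphere 0 1"
  then show "geodesic_dist x y \<le> geodesic_dist x z + geodesic_dist z y"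
    unfolding geodesic_dist_def by (intro arccos_inner_triangle) (simp_all only: mem_sphere_0)
qed (simp_all only: mem_sphere_0 geodesic_dist_range geodesic_dist_self geodesic_dist_commute)

section \<open>Stereographic projection and separation of configurations\<close>

definition stereographic :: "complex \<times> real \<Rightarrow> complex" where
  "stereographic x = fst x / of_real (1 - snd x)"

text \<open>The double-angle formulas at \<open>arctan (cmod z)\<close> turn the spherical
  coordinates into rational functions, from which the norm and the inverse are computed
  algebraically.\<close>

lemma inv_stereographic_eq:
  "inv_stereographic z = (of_real (2 / (1 + (cmod z)\<^sup>2)) * z, ((cmod z)\<^sup>2 - 1) / ((cmod z)\<^sup>2 + 1))"
proof -
  define a where "a = arctan (cmod z)"
  have pos: "1 + (cmod z)\<^sup>2 > 0" by (simp add: add_pos_nonneg)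
  have ca: "cos a = 1 / sqrt (1 + (cmod z)\<^sup>2)" and sa: "sin a = cmod z / sqrt (1 + (cmod z)\<^sup>2)"
    by (simp_all add: a_def cos_arctan sin_arctan)
  have "sin (pi - 2 * a) = 2 * sin a * cos a" by (simp add: sin_double)
  also have "\<dots> = 2 * cmod z / (1 + (cmod z)\<^sup>2)"
  proof -
    define r where "r = sqrt (1 + (cmod z)\<^sup>2)"
    have "r * r = 1 + (cmod z)\<^sup>2" using pos by (simp add: r_def)
    moreover have "2 * sin a * cos a = 2 * cmod z / (r * r)" by (simp add: ca sa r_def[symmetric])
    ultimately show ?thesis by simp
  qed
  finally have s: "sin (pi - 2 * a) = 2 * cmod z / (1 + (cmod z)\<^sup>2)" .
  have "cos (pi - 2 * a) = (sin a)\<^sup>2 - (cos a)\<^sup>2" by (simp add: cos_double)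
  also have "\<dots> = ((cmod z)\<^sup>2 - 1) / ((cmod z)\<^sup>2 + 1)"
    using pos unfolding ca sa by (simp add: power_divide diff_divide_distrib add.commute)
  finally have c: "cos (pi - 2 * a) = ((cmod z)\<^sup>2 - 1) / ((cmod z)\<^sup>2 + 1)" .
  have "of_real (2 * cmod z / (1 + (cmod z)\<^sup>2)) * sgn z = of_real (2 / (1 + (cmod z)\<^sup>2)) * z"
    by (cases "z = 0") (simp_all add: sgn_eq)
  moreover have "inv_stereographic z = (of_real (sin (pi - 2 * a)) * sgn z, cos (pi - 2 * a))"
    by (simp only: inv_stereographic_def Let_def a_def)
  ultimately show ?thesis by (simp only: s c)
qed

lemma norm_inv_stereographic: "norm (inv_stereographic z) = 1"
proof -
  have "(norm (fst (inv_stereographic z)))\<^sup>2 + (norm (snd (inv_stereographic z)))\<^sup>2 = 1"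
  proof -
    define q where "q = (cmod z)\<^sup>2"
    have q: "1 + q \<noteq> 0" by (simp add: q_def add_nonneg_eq_0_iff)
    have "(2 / (1 + q))\<^sup>2 * q + ((q - 1) / (q + 1))\<^sup>2 = 1"
      using q by (simp add: power_divide divide_simps) (simp add: power2_eq_square algebra_simps)
    moreover have "norm (fst (inv_stereographic z)) = \<bar>2 / (1 + q)\<bar> * cmod z"
      by (simp only: inv_stereographic_eq fst_conv norm_mult norm_of_real q_def)
    moreover have "norm (snd (inv_stereographic z)) = \<bar>(q - 1) / (q + 1)\<bar>"
      by (simp only: inv_stereographic_eq snd_conv real_norm_def q_def)
    ultimately show ?thesis by (simp only: power_mult_distrib power2_abs q_def)
  qed
  then show ?thesis by (simp add: norm_prod_def)
qed

lemma norm_north_pole: "norm north_pole = 1"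
  by (simp add: north_pole_def norm_prod_def)

lemma snd_inv_stereographic: "snd (inv_stereographic z) \<noteq> 1"
proof -
  have "(cmod z)\<^sup>2 + 1 \<noteq> 0" by (simp add: add_nonneg_eq_0_iff)
  then show ?thesis by (simp add: inv_stereographic_eq)
qed

lemma inv_stereographic_not_pole: "inv_stereographic z \<noteq> north_pole"
  using snd_inv_stereographic[of z] by (auto simp: north_pole_def)

lemma stereographic_inverse: "stereographic (inv_stereographic z) = z"
proof -
  define q where "q = (cmod z)\<^sup>2"
  have q: "1 + q \<noteq> 0" by (simp add: q_def add_nonneg_eq_0_iff)
  have "1 - (q - 1) / (q + 1) = 2 / (1 + q)" using q by (simp add: field_simps)
  moreover have "1 + complex_of_real q \<noteq> 0" using q by (metis of_real_1 of_real_add of_real_eq_0_iff)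
  ultimately show ?thesis by (simp add: stereographic_def inv_stereographic_eq q_def[symmetric])
qed

definition sphere_image :: "complex set \<Rightarrow> (complex \<times> real) set" where
  "sphere_image g = insert north_pole (inv_stereographic ` g)"

lemma sphere_image_subset: "sphere_image g \<subseteq> sphere 0 1"
  by (auto simp: sphere_image_def norm_north_pole norm_inv_stereographic)

lemma sphere_image_nonempty: "sphere_image g \<noteq> {}"
  by (simp add: sphere_image_def)

lemma dist_L1_le: "dist_L1 z w \<le> 2 * cmod (z - w)"
  using abs_Re_le_cmod[of "z - w"] abs_Im_le_cmod[of "z - w"] by (simp add: dist_L1_def)

text \<open>The Hausdorff distance separates only closed sets. A configuration is closed because its
  points keep a definite distance, so a convergent sequence in it is eventually constant; on the
  sphere its points can accumulate only at the pole, which differs from the image of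
  \<open>z\<close>.\<close>

lemma sphere_image_closed:
  assumes g: "g \<in> Conf s" and s: "s > 0" and inf: "(INF y\<in>sphere_image g. geodesic_dist (inv_stereographic z) y) \<le> 0"
  shows "z \<in> g"
proof -
  let ?x = "inv_stereographic z"
  have "\<exists>y\<in>sphere_image g. geodesic_dist ?x y < 1 / real (Suc n)" for n
  proof (rule ccontr)
    assume "\<not> ?thesis"
    then have "1 / real (Suc n) \<le> (INF y\<in>sphere_image g. geodesic_dist ?x y)"
      using sphere_image_nonempty by (intro cINF_greatest) (auto simp: not_less)
    moreover have "0 < 1 / real (Suc n)" by simp
    ultimately show False using inf by linarith
  qed
  then obtain y where y: "\<And>n. y n \<in> sphere_image g" "\<And>n. geodesic_dist ?x (y n) < 1 / real (Suc n)" by metis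
  have norm_y: "norm (y n) = 1" for n using subsetD[OF sphere_image_subset y(1)[of n]] by simp
  \<comment> \<open>Convergence of angles becomes convergence in norm: the cosine of the angle is
    the inner product, which determines the distance of unit vectors.\<close>
  have "(\<lambda>n. geodesic_dist ?x (y n)) \<longlonglongrightarrow> 0"
    using y(2) geodesic_dist_range(1)[OF norm_inv_stereographic norm_y]
    by (intro tendsto_sandwich[OF _ _ tendsto_const LIMSEQ_Suc[OF lim_1_over_n]])
       (auto intro!: always_eventually less_imp_le)
  then have "(\<lambda>n. cos (geodesic_dist ?x (y n))) \<longlonglongrightarrow> cos 0" by (rule tendsto_cos)
  moreover have "cos (geodesic_dist ?x (y n)) = ?x \<bullet> y n" for n
    using Cauchy_Schwarz_ineq2[of ?x "y n"] norm_y[of n] norm_inv_stereographic[of z]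
    by (auto simp: geodesic_dist_def intro!: cos_arccos)
  ultimately have "(\<lambda>n. sqrt (2 - 2 * (?x \<bullet> y n))) \<longlonglongrightarrow> sqrt (2 - 2 * 1)"
    by (intro tendsto_intros) simp
  moreover have "norm (y n - ?x) = sqrt (2 - 2 * (?x \<bullet> y n))" for n
  proof -
    have "y n \<bullet> y n = 1" "?x \<bullet> ?x = 1"
      using norm_y[of n] norm_inv_stereographic[of z] by (simp_all only: dot_square_norm power_one)
    then have "(y n - ?x) \<bullet> (y n - ?x) = 2 - 2 * (?x \<bullet> y n)"
      unfolding inner_diff_left inner_diff_right inner_commute[of "y n" ?x] by linarith
    then show ?thesis unfolding norm_eq_sqrt_inner[of "y n - ?x"] by (rule arg_cong)
  qed
  ultimately have "(\<lambda>n. norm (y n - ?x)) \<longlonglongrightarrow> 0" by simp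
  then have lim: "y \<longlonglongrightarrow> ?x" by (rule LIM_zero_cancel[OF tendsto_norm_zero_cancel])
  have "(\<lambda>n. stereographic (y n)) \<longlonglongrightarrow> stereographic ?x"
    unfolding stereographic_def using lim snd_inv_stereographic[of z]
    by (intro tendsto_intros) auto
  then have lim': "(\<lambda>n. stereographic (y n)) \<longlonglongrightarrow> z" by (simp add: stereographic_inverse)
  have "\<forall>\<^sub>F n in sequentially. y n \<in> - {north_pole}"
    using topological_tendstoD[OF lim, of "- {north_pole}"] inv_stereographic_not_pole by auto
  then have ev: "\<forall>\<^sub>F n in sequentially. stereographic (y n) \<in> g"
  proof eventually_elim
    case (elim n)
    then have "y n \<in> inv_stereographic ` g" using y(1)[of n] by (simp add: sphere_image_def)
    then show ?case by (auto simp: stereographic_inverse)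
  qed
  have "\<forall>\<^sub>F n in sequentially. dist (stereographic (y n)) z < s / 4"
    using tendstoD[OF lim', of "s / 4"] s by simp
  with ev have "\<forall>\<^sub>F n in sequentially. stereographic (y n) \<in> g \<and> dist (stereographic (y n)) z < s / 4"
    by eventually_elim simp
  then obtain N where N: "\<And>n. n \<ge> N \<Longrightarrow> stereographic (y n) \<in> g \<and> dist (stereographic (y n)) z < s / 4"
    unfolding eventually_sequentially by blast
  \<comment> \<open>Two points within \<open>s / 4\<close> of \<open>z\<close> have Euclidean
    distance below \<open>s / 2\<close>, hence by \<open>dist_L1_le\<close> an \<open>L^1\<close>
    distance below \<open>s\<close>, which distinct points of \<open>g\<close> cannot have.\<close>
  have "stereographic (y n) = stereographic (y N)" if "n \<ge> N" for n
  proof (rule ccontr)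
    assume "stereographic (y n) \<noteq> stereographic (y N)"
    then have "s \<le> dist_L1 (stereographic (y n)) (stereographic (y N))"
      using g N[OF that] N[of N] by (auto simp: Conf_def)
    also have "\<dots> \<le> 2 * dist (stereographic (y n)) (stereographic (y N))"
      using dist_L1_le by (simp add: dist_norm)
    also have "\<dots> < s"
      using N[OF that] N[of N] dist_triangle2[of "stereographic (y n)" "stereographic (y N)" z] by simp
    finally show False by simp
  qed
  then have "(\<lambda>n. stereographic (y n)) \<longlonglongrightarrow> stereographic (y N)"
    by (rule tendsto_eventually[OF eventually_sequentiallyI])
  then have "z = stereographic (y N)" using LIMSEQ_unique[OF lim'] by blast
  then show ?thesis using N[of N] by simp
qed

lemma Metric_space_conf_dist:
  assumes s: "s > 0"
  shows "Metric_space (Conf s) conf_dist"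
proof
  note sub = sphere_image_subset and ne = sphere_image_nonempty
  have eq: "conf_dist g h = max (geodesic.excess (sphere_image g) (sphere_image h)) (geodesic.excess (sphere_image h) (sphere_image g))" for g h
    unfolding conf_dist_def sphere_image_def[symmetric] by (rule geodesic.hausdorff_dist_eq_excess[OF sub sub])
  show "0 \<le> conf_dist g h" "conf_dist g h = conf_dist h g" for g h
    unfolding eq using geodesic.excess_nonneg[OF sub sub ne ne] by (auto simp: max.commute le_max_iff_disj)
  have subset: "g \<subseteq> h" if h: "h \<in> Conf s" and le: "geodesic.excess (sphere_image g) (sphere_image h) \<le> 0" for g h
  proof
    fix z assume "z \<in> g"
    then have "inv_stereographic z \<in> sphere_image g" by (simp add: sphere_image_def)
    from geodesic.INF_le_excess[OF sub sub ne this] le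
    have "(INF y\<in>sphere_image h. geodesic_dist (inv_stereographic z) y) \<le> 0" by (rule order_trans)
    then show "z \<in> h" by (rule sphere_image_closed[OF h s])
  qed
  show "conf_dist g h = 0 \<longleftrightarrow> g = h" if "g \<in> Conf s" "h \<in> Conf s" for g h
  proof
    assume "conf_dist g h = 0"
    then have "geodesic.excess (sphere_image g) (sphere_image h) \<le> 0" "geodesic.excess (sphere_image h) (sphere_image g) \<le> 0"
      unfolding eq by linarith+
    then show "g = h" using subset that by blast
  next
    assume "g = h"
    then show "conf_dist g h = 0" by (simp add: eq geodesic.excess_self[OF sub ne])
  qed
  show "conf_dist f h \<le> conf_dist f g + conf_dist g h" for f g h
    unfolding eq using geodesic.excess_triangle[OF sub ne sub ne sub ne, of f h g]
      geodesic.excess_triangle[OF sub ne sub ne sub ne, of h f g] by linarith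
qed

lemma gdelta_in_Conf_topology_subset:
  assumes "gdelta_in (Conf_topology s) G" "s > 0"
  shows "G \<subseteq> Conf s"
  using gdelta_in_subset[OF assms(1)] Metric_space.topspace_mtopology[OF Metric_space_conf_dist[OF assms(2)]]
  by (simp add: Conf_topology_def)

text \<open>That the product flow is defined at all times \<open>t \<ge> 0\<close> belongs to the
  conclusion, so that \<open>the\<close> in the integrands is evaluated at genuine values
  only.\<close>

theorem corollary4:
  fixes s :: real and K :: nat
    and G :: "complex set set" and H :: "complex set"
    and g :: "complex set" and A :: "complex set" and \<theta> i j :: complex
  assumes "s > 0" and "K \<ge> 1"
    and "gdelta_in (Conf_topology s) G"
    and "Conf_topology s closure_of G = Conf s"
    and "gdelta_in (top_of_set (sphere 0 1)) H"
    and "top_of_set (sphere 0 1) closure_of H = sphere 0 1"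
    and "AE a in lborel. cis a \<in> H"
    and "\<And>g' \<theta>'. g' \<in> G \<Longrightarrow> \<theta>' \<in> H \<Longrightarrow>
           infinite_ergodic_index (billiard_measure s g' \<theta>') (billiard_flow s g' \<theta>')"
    and "g \<in> G"
    and "A \<in> sets lebesgue" and "A \<subseteq> table s g"
    and "0 < emeasure lebesgue A" and "emeasure lebesgue A < \<infinity>"
    and "\<theta> \<in> H" and "i \<in> directions \<theta>" and "j \<in> directions \<theta>"
  shows "AE x in Pi\<^sub>M {..<K} (\<lambda>_. billiard_measure s g \<theta>).
           (\<forall>t\<ge>0. product_flow K (billiard_flow s g \<theta>) t x \<noteq> None) \<and>
           ((\<lambda>T. (LINT t:{0..T}|lebesgue. real (num_in_direction_within K A i
                    (the (product_flow K (billiard_flow s g \<theta>) t x)))) /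
                 (LINT t:{0..T}|lebesgue. real (num_in_direction_within K A j
                    (the (product_flow K (billiard_flow s g \<theta>) t x)))))
             \<longlongrightarrow> 1) at_top"
proof -
  have "g \<in> Conf s" using gdelta_in_Conf_topology_subset[OF assms(3,1)] assms(9) by blast
  then show ?thesis
    by (rule direction_ratio[OF _ assms(1) assms(8)[OF assms(9,14)] assms(2,10,11,12,13,15,16)])
qed

end
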